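(* Let $T>0$, $Q=(0,1)\times(0,T)$, $y_0\in L^2(0,1)$ and $y_T\in\mathcal A_T(y_0)$. For $u\in L^2(Q)$ let $y^u$ denote the weak solution of the controlled heat equation with initial state $y_0$ and control $u$. Then there exists a unique control $u^*\in L^2(Q)$ such that $y^{u^*}(\cdot,T)=y_T$ and $u^*$ minimizes $$J(u)=\frac12\|u\|_{L^2(Q)}^2$$ over all $u\in L^2(Q)$ satisfying $y^u(\cdot,T)=y_T$.
   Context: All functions are real-valued. Fix $T>0$ and put $Q=(0,1)\times(0,T)$. For $y_0\in L^2(0,1)$ and $u\in L^2(Q)$, the controlled heat equation is $$y_t-y_{xx}=u\ \text{ in }Q,\qquad y(0,t)=y(1,t)=0\ \text{ for }t\in(0,T),\qquad y(x,0)=y_0(x)\ \text{ for }x\in(0,1).$$ It has a unique weak solution $y=y^u\in L^2(0,T;H_0^1(0,1))$ (in the standard sense, with $y_t\in L^2(0,T;H^{-1}(0,1))$, so that $y\in C([0,T];L^2(0,1))$ and $y(\cdot,T)\in L^2(0,1)$ is well defined). Let $e_n(x)=\sqrt2\sin(n\pi x)$ and $\lambda_n=(n\pi)^2$ for $n\ge1$; $\{e_n\}$ is an orthonormal basis of $L^2(0,1)$. For $y_0,y_T\in L^2(0,1)$ let $y_{0,n}=\int_0^1 y_0e_n\,dx$ and $y_{T,n}=\int_0^1 y_Te_n\,dx$ be their coefficients. The admissible target set is $$\mathcal A_T(y_0)=\left\{y_T\in L^2(0,1):\ \sum_{n=1}^\infty\frac{2\lambda_n}{1-e^{-2\lambda_nT}}\left|y_{T,n}-e^{-\lambda_nT}y_{0,n}\right|^2<\infty\right\}.$$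 *)

theory Defs
  imports "HOL-Analysis.Analysis"
begin

text \<open>
  Elements of Lebesgue, Sobolev and Bochner spaces are represented by functions; two functions
  represent the same element when they agree almost everywhere. A function of space and time is
  written either as \<open>y t x\<close> (a curve \<open>t \<mapsto> y(\<cdot>,t)\<close> of functions of \<open>x\<close>) or, for controls in
  \<open>L\<^sup>2(Q)\<close>, as \<open>u (x, t)\<close>.
\<close>

definition L2_space :: "'a measure \<Rightarrow> ('a \<Rightarrow> real) set" where
  "L2_space M = {f \<in> borel_measurable M. integrable M (\<lambda>x. (f x)\<^sup>2)}"

definition L2_norm :: "'a measure \<Rightarrow> ('a \<Rightarrow> real) \<Rightarrow> real" where
  "L2_norm M f = sqrt (\<integral>x. (f x)\<^sup>2 \<partial>M)"

abbreviation space_measure :: "real measure" where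
  "space_measure \<equiv> lebesgue_on {0<..<1}"

abbreviation (input) time_measure :: "real \<Rightarrow> real measure" where
  "time_measure T \<equiv> lebesgue_on {0<..<T}"

abbreviation Q_measure :: "real \<Rightarrow> (real \<times> real) measure" where
  "Q_measure T \<equiv> lebesgue_on ({0<..<1} \<times> {0<..<T})"


text \<open>\<open>C\<^sub>c\<^sup>\<infinity>(a,b)\<close>, extended by zero to the real line. The support is closed and contained in the
  bounded interval \<open>(a,b)\<close>, hence compact.\<close>

definition test_functions :: "real \<Rightarrow> real \<Rightarrow> (real \<Rightarrow> real) set" where
  "test_functions a b =
    {\<phi>. (\<forall>n x. (deriv ^^ n) \<phi> differentiable at x) \<and> closure {x. \<phi> x \<noteq> 0} \<subseteq> {a<..<b}}"

definition is_weak_deriv :: "(real \<Rightarrow> real) \<Rightarrow> (real \<Rightarrow> real) \<Rightarrow> bool" where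
  "is_weak_deriv v g \<longleftrightarrow>
    (\<forall>\<phi> \<in> test_functions 0 1.
      (\<integral>x. v x * deriv \<phi> x \<partial>space_measure) = - (\<integral>x. g x * \<phi> x \<partial>space_measure))"

definition H1 :: "(real \<Rightarrow> real) set" where
  "H1 = {v \<in> L2_space space_measure. \<exists>g \<in> L2_space space_measure. is_weak_deriv v g}"

text \<open>The weak derivative of an element of \<open>H\<^sup>1(0,1)\<close>; it is determined up to a null set.\<close>

definition weak_deriv :: "(real \<Rightarrow> real) \<Rightarrow> real \<Rightarrow> real" where
  "weak_deriv v = (SOME g. g \<in> L2_space space_measure \<and> is_weak_deriv v g)"

definition H1_norm :: "(real \<Rightarrow> real) \<Rightarrow> real" where
  "H1_norm v = sqrt ((L2_norm space_measure v)\<^sup>2 + (L2_norm space_measure (weak_deriv v))\<^sup>2)"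

text \<open>\<open>H\<^sub>0\<^sup>1(0,1)\<close> is the closure of the test functions in \<open>H\<^sup>1(0,1)\<close>.\<close>

definition H10 :: "(real \<Rightarrow> real) set" where
  "H10 = {v \<in> H1. \<exists>\<phi>. (\<forall>n. \<phi> n \<in> test_functions 0 1) \<and> (\<lambda>n. H1_norm (\<phi> n - v)) \<longlonglongrightarrow> 0}"

text \<open>\<open>H\<^sup>-\<^sup>1(0,1)\<close>, the dual of \<open>H\<^sub>0\<^sup>1(0,1)\<close>. Only the values on \<open>H10\<close> matter. Boundedness makes
  functionals insensitive to changes of their argument on null sets.\<close>

definition Hm1 :: "((real \<Rightarrow> real) \<Rightarrow> real) set" where
  "Hm1 = {F.
    (\<forall>v \<in> H10. \<forall>w \<in> H10. \<forall>a b. F (\<lambda>x. a * v x + b * w x) = a * F v + b * F w) \<and>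
    (\<exists>C. \<forall>v \<in> H10. \<bar>F v\<bar> \<le> C * H1_norm v)}"

definition Hm1_norm :: "((real \<Rightarrow> real) \<Rightarrow> real) \<Rightarrow> real" where
  "Hm1_norm F = (SUP v \<in> {v \<in> H10. H1_norm v \<le> 1}. \<bar>F v\<bar>)"


text \<open>Square integrable functions on \<open>M\<close> with values in the normed space \<open>(X, N)\<close>: strongly
  measurable (an almost everywhere limit of \<open>X\<close>-valued simple functions) with \<open>N (f t)\<close> square
  integrable. The difference of functions is the pointwise one.\<close>

definition bochner_L2 ::
  "real measure \<Rightarrow> 'a::minus set \<Rightarrow> ('a \<Rightarrow> real) \<Rightarrow> (real \<Rightarrow> 'a) set" where
  "bochner_L2 M X N = {f.
    (\<exists>s. (\<forall>n::nat. simple_function M (s n) \<and> s n ` space M \<subseteq> X) \<and>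
         (AE t in M. f t \<in> X \<and> (\<lambda>n. N (s n t - f t)) \<longlonglongrightarrow> 0)) \<and>
    integrable M (\<lambda>t. (N (f t))\<^sup>2)}"

definition continuous_into_L2 :: "real \<Rightarrow> (real \<Rightarrow> real \<Rightarrow> real) \<Rightarrow> bool" where
  "continuous_into_L2 T y \<longleftrightarrow>
    (\<forall>t \<in> {0..T}. y t \<in> L2_space space_measure) \<and>
    (\<forall>s \<in> {0..T}. ((\<lambda>t. L2_norm space_measure (y t - y s)) \<longlongrightarrow> 0) (at s within {0..T}))"

text \<open>\<open>w = y\<^sub>t\<close> in the sense of \<open>H\<^sup>-\<^sup>1\<close>-valued distributions on \<open>(0,T)\<close>, that is
  \<open>\<integral> \<phi>' y dt = - \<integral> \<phi> w dt\<close> in \<open>H\<^sup>-\<^sup>1(0,1)\<close>, evaluated at \<open>v \<in> H\<^sub>0\<^sup>1(0,1)\<close>; here \<open>y(t)\<close> acts on \<open>v\<close>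
  through the inner product of \<open>L\<^sup>2(0,1)\<close>.\<close>

definition is_time_deriv ::
  "real \<Rightarrow> (real \<Rightarrow> real \<Rightarrow> real) \<Rightarrow> (real \<Rightarrow> (real \<Rightarrow> real) \<Rightarrow> real) \<Rightarrow> bool" where
  "is_time_deriv T y w \<longleftrightarrow>
    (\<forall>\<phi> \<in> test_functions 0 T. \<forall>v \<in> H10.
      (\<integral>t. deriv \<phi> t * (\<integral>x. y t x * v x \<partial>space_measure) \<partial>time_measure T) =
      - (\<integral>t. \<phi> t * w t v \<partial>time_measure T))"

text \<open>Weak solutions in \<open>L\<^sup>2(0,T;H\<^sub>0\<^sup>1)\<close> with \<open>y\<^sub>t \<in> L\<^sup>2(0,T;H\<^sup>-\<^sup>1)\<close>. The curve \<open>y\<close> is taken to be the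
  representative in \<open>C([0,T];L\<^sup>2(0,1))\<close>, so that \<open>y 0\<close> and \<open>y T\<close> are meaningful.\<close>

definition weak_solution ::
  "real \<Rightarrow> (real \<Rightarrow> real) \<Rightarrow> (real \<times> real \<Rightarrow> real) \<Rightarrow> (real \<Rightarrow> real \<Rightarrow> real) \<Rightarrow> bool" where
  "weak_solution T y0 u y \<longleftrightarrow>
    continuous_into_L2 T y \<and>
    y \<in> bochner_L2 (time_measure T) H10 H1_norm \<and>
    (\<exists>w \<in> bochner_L2 (time_measure T) Hm1 Hm1_norm.
      is_time_deriv T y w \<and>
      (AE t in time_measure T. \<forall>v \<in> H10.
        w t v + (\<integral>x. weak_deriv (y t) x * weak_deriv v x \<partial>space_measure) =
        (\<integral>x. u (x, t) * v x \<partial>space_measure))) \<and>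
    (AE x in space_measure. y 0 x = y0 x)"

text \<open>\<open>y\<^sup>u(\<cdot>,T) = y\<^sub>T\<close>. As weak solutions are unique, \<open>y\<^sup>u\<close> is expressed relationally.\<close>

definition steers ::
  "real \<Rightarrow> (real \<Rightarrow> real) \<Rightarrow> (real \<Rightarrow> real) \<Rightarrow> (real \<times> real \<Rightarrow> real) \<Rightarrow> bool" where
  "steers T y0 yT u \<longleftrightarrow>
    (\<exists>y. weak_solution T y0 u y \<and> (AE x in space_measure. y T x = yT x))"

definition cost :: "real \<Rightarrow> (real \<times> real \<Rightarrow> real) \<Rightarrow> real" where
  "cost T u = 1/2 * (L2_norm (Q_measure T) u)\<^sup>2"

definition optimal_control ::
  "real \<Rightarrow> (real \<Rightarrow> real) \<Rightarrow> (real \<Rightarrow> real) \<Rightarrow> (real \<times> real \<Rightarrow> real) \<Rightarrow> bool" where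
  "optimal_control T y0 yT u \<longleftrightarrow>
    u \<in> L2_space (Q_measure T) \<and> steers T y0 yT u \<and>
    (\<forall>w \<in> L2_space (Q_measure T). steers T y0 yT w \<longrightarrow> cost T u \<le> cost T w)"


definition eigenfunction :: "nat \<Rightarrow> real \<Rightarrow> real" where
  "eigenfunction n x = sqrt 2 * sin (real n * pi * x)"

definition eigenvalue :: "nat \<Rightarrow> real" where
  "eigenvalue n = (real n * pi)\<^sup>2"

definition fourier_coeff :: "(real \<Rightarrow> real) \<Rightarrow> nat \<Rightarrow> real" where
  "fourier_coeff f n = (\<integral>x. f x * eigenfunction n x \<partial>space_measure)"

text \<open>The modes are numbered from \<open>1\<close>, hence the shift by \<open>Suc\<close>.\<close>

definition admissible_targets :: "real \<Rightarrow> (real \<Rightarrow> real) \<Rightarrow> (real \<Rightarrow> real) set" where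
  "admissible_targets T y0 = {yT \<in> L2_space space_measure.
    summable (\<lambda>k. let n = Suc k in
      2 * eigenvalue n / (1 - exp (- 2 * eigenvalue n * T)) *
      \<bar>fourier_coeff yT n - exp (- eigenvalue n * T) * fourier_coeff y0 n\<bar>\<^sup>2)}"

end

theory Submission imports Defs "HOL-Real_Asymp.Real_Asymp" begin

text \<open>
  In the orthonormal basis of the modes \<open>e\<^sub>k = \<surd>2 sin ((k + 1) \<pi> x)\<close> the heat equation decouples into
  the scalar equations \<open>Y\<^sub>k' + \<lambda>\<^sub>k Y\<^sub>k = U\<^sub>k\<close>. Integrating them shows that a control \<open>u\<close> can steer
  \<open>y0\<close> to \<open>yT\<close> only if its inner products in \<open>L\<^sup>2(Q)\<close> with the adjoint modes
  \<open>g\<^sub>k (x, t) = exp (- \<lambda>\<^sub>k (T - t)) e\<^sub>k x\<close> equal the gaps \<open>d\<^sub>k\<close> between the coefficients of \<open>yT\<close> and those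
  of the uncontrolled solution at time \<open>T\<close> (\<open>weak_solution_moment\<close>). The \<open>g\<^sub>k\<close> are orthogonal with
  \<open>\<parallel>g\<^sub>k\<parallel>\<^sup>2 = 1 / W\<^sub>k\<close> and \<open>W\<^sub>k = 2 \<lambda>\<^sub>k / (1 - exp (- 2 \<lambda>\<^sub>k T))\<close>. By Bessel's inequality every steering control
  satisfies \<open>\<parallel>u\<parallel>\<^sup>2 \<ge> \<Sum> W\<^sub>k d\<^sub>k\<^sup>2\<close>, and admissibility of \<open>yT\<close> says that this sum is finite. Its value is
  attained by the control \<open>\<Sum> W\<^sub>k d\<^sub>k g\<^sub>k\<close> (\<open>moments_norm_bound\<close>, \<open>control_norm\<close>). The moment conditions are
  preserved by midpoints, so that the parallelogram identity yields uniqueness.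

  It remains to see that this control does steer \<open>y0\<close> to \<open>yT\<close> in the weak sense (\<open>control_steers\<close>). The
  scalar equations have explicit solutions \<open>Y\<^sub>k\<close>. At interior times the coefficients decay exponentially
  in \<open>\<lambda>\<^sub>k\<close>, locally uniformly in time, so the sine series of the state, of its time derivative and of
  the control may be differentiated and integrated term by term. At the two end points only square
  summability is left, and continuity in \<open>L\<^sup>2\<close> follows from Parseval's identity with dominated
  convergence.

  Two tools enter throughout. One is the completeness of the sine system (\<open>Parseval\<close>), which is derived from
  the Weierstrass theorem for polynomials in \<open>cos (\<pi> x)\<close>. The other is a smooth cutoff built from
  \<open>exp (- 1 / x)\<close>. In space, cut-off modes approximate the modes in \<open>H\<^sup>1\<close>, which puts them into \<open>H\<^sub>0\<^sup>1\<close>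
  and makes weak derivatives unique; in time, the derivative of the cutoff extracts the values of the
  solution at \<open>0\<close> and \<open>T\<close> from its distributional derivative.
\<close>

section \<open>Smooth cutoff functions\<close>

definition smooth :: "(real \<Rightarrow> real) \<Rightarrow> bool" where
  "smooth f \<longleftrightarrow> (\<forall>n x. (deriv ^^ n) f differentiable at x)"

text \<open>Products and compositions are handled by induction on the number of derivatives, which
  needs the finite levels of smoothness.\<close>

primrec times_differentiable :: "nat \<Rightarrow> (real \<Rightarrow> real) \<Rightarrow> bool" where
  "times_differentiable 0 f \<longleftrightarrow> True"
| "times_differentiable (Suc n) f \<longleftrightarrow>
    (\<forall>x. f differentiable at x) \<and> times_differentiable n (deriv f)"

lemma times_differentiable_iff:
  "times_differentiable n f \<longleftrightarrow> (\<forall>m<n. \<forall>x. (deriv ^^ m) f differentiable at x)"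
proof (induction n arbitrary: f)
  case (Suc n)
  have "(\<forall>m<Suc n. P m) \<longleftrightarrow> P 0 \<and> (\<forall>m<n. P (Suc m))" for P
    using less_Suc_eq_0_disj by auto
  then show ?case by (simp add: Suc funpow_Suc_right del: funpow.simps(2))
qed simp

lemma smooth_iff: "smooth f \<longleftrightarrow> (\<forall>n. times_differentiable n f)"
  unfolding smooth_def times_differentiable_iff by auto

lemma smooth_differentiable: "smooth f \<Longrightarrow> f differentiable at x"
  unfolding smooth_def by (metis funpow_0)

lemma smooth_DERIV: "smooth f \<Longrightarrow> (f has_real_derivative deriv f x) (at x)"
  using smooth_differentiable DERIV_deriv_iff_real_differentiable by blast

lemma smooth_deriv: "smooth f \<Longrightarrow> smooth (deriv f)"
  unfolding smooth_iff by (metis times_differentiable.simps(2))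

lemma smooth_continuous: "smooth f \<Longrightarrow> continuous_on S f"
  by (meson DERIV_isCont continuous_at_imp_continuous_on smooth_DERIV)

lemma times_differentiable_mono: "times_differentiable n f \<Longrightarrow> m \<le> n \<Longrightarrow> times_differentiable m f"
  unfolding times_differentiable_iff by auto

lemma times_differentiable_add:
  "times_differentiable n f \<Longrightarrow> times_differentiable n g \<Longrightarrow> times_differentiable n (\<lambda>x. f x + g x)"
proof (induction n arbitrary: f g)
  case (Suc n)
  have "deriv (\<lambda>x. f x + g x) = (\<lambda>x. deriv f x + deriv g x)"
    using Suc.prems
    by (intro ext DERIV_imp_deriv DERIV_add) (auto simp: DERIV_deriv_iff_real_differentiable)
  with Suc show ?case by auto
qed simp

lemma times_differentiable_mult:
  "times_differentiable n f \<Longrightarrow> times_differentiable n g \<Longrightarrow> times_differentiable n (\<lambda>x. f x * g x)"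
proof (induction n arbitrary: f g)
  case (Suc n)
  have "deriv (\<lambda>x. f x * g x) = (\<lambda>x. deriv f x * g x + f x * deriv g x)"
  proof (intro ext DERIV_imp_deriv)
    fix x
    have "(f has_real_derivative deriv f x) (at x)" "(g has_real_derivative deriv g x) (at x)"
      using Suc.prems by (auto simp: DERIV_deriv_iff_real_differentiable)
    from DERIV_mult[OF this]
    show "((\<lambda>x. f x * g x) has_real_derivative deriv f x * g x + f x * deriv g x) (at x)"
      by (simp add: algebra_simps)
  qed
  moreover have "times_differentiable n f" "times_differentiable n g"
    using Suc.prems times_differentiable_mono[of "Suc n" _ n] by auto
  ultimately show ?case
    using Suc by (auto intro!: times_differentiable_add)
qed simp

lemma times_differentiable_affine:
  "times_differentiable n f \<Longrightarrow> times_differentiable n (\<lambda>x. f (a * x + b))"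
proof (induction n arbitrary: f)
  case (Suc n)
  have D: "((\<lambda>x. f (a * x + b)) has_real_derivative deriv f (a * x + b) * a) (at x)" for x
  proof (rule DERIV_chain'[of "\<lambda>x. a * x + b" a x UNIV f, simplified])
    show "((\<lambda>x. a * x + b) has_real_derivative a) (at x)"
      by (auto intro!: derivative_eq_intros)
    show "(f has_real_derivative deriv f (a * x + b)) (at (a * x + b))"
      using Suc.prems by (auto simp: DERIV_deriv_iff_real_differentiable)
  qed
  then have "deriv (\<lambda>x. f (a * x + b)) = (\<lambda>x. deriv f (a * x + b) * a)"
    by (intro ext DERIV_imp_deriv)
  moreover have const: "times_differentiable m (\<lambda>x. c)" for m and c :: real
    by (induction m arbitrary: c) auto
  moreover have "times_differentiable n (\<lambda>x. deriv f (a * x + b))"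
    using Suc by auto
  ultimately show ?case
    using D by (auto intro!: times_differentiable_mult simp: real_differentiable_def)
qed simp

lemma smooth_mult: "smooth f \<Longrightarrow> smooth g \<Longrightarrow> smooth (\<lambda>x. f x * g x)"
  unfolding smooth_iff by (blast intro: times_differentiable_mult)

lemma smooth_affine: "smooth f \<Longrightarrow> smooth (\<lambda>x. f (a * x + b))"
  unfolding smooth_iff by (blast intro: times_differentiable_affine)

lemma smooth_add: "smooth f \<Longrightarrow> smooth g \<Longrightarrow> smooth (\<lambda>x. f x + g x)"
  unfolding smooth_iff by (blast intro: times_differentiable_add)

lemma smooth_const: "smooth (\<lambda>_. c)"
proof -
  have "times_differentiable n (\<lambda>_. c)" for n and c :: real
    by (induction n arbitrary: c) auto
  then show ?thesis by (simp add: smooth_iff)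
qed

lemma smooth_exp: "smooth (\<lambda>x. exp (a * x + b))"
proof -
  have "deriv exp = (exp :: real \<Rightarrow> real)"
    by (intro ext DERIV_imp_deriv DERIV_exp)
  then have "(deriv ^^ n) exp = (exp :: real \<Rightarrow> real)" for n
    by (induction n) auto
  moreover have "exp differentiable at x" for x :: real
    using DERIV_exp[of x] unfolding real_differentiable_def ..
  ultimately have "smooth exp"
    unfolding smooth_def by simp
  then show ?thesis by (rule smooth_affine)
qed

text \<open>Sine and its derivatives are of the form \<open>x \<mapsto> sin (x + b)\<close> with a phase \<open>b\<close> that grows by
  a quarter period.\<close>

lemma smooth_sin: "smooth (\<lambda>x. sin (a * x))"
proof -
  define S :: "real \<Rightarrow> real \<Rightarrow> real" where "S b = (\<lambda>x. sin (x + b))" for b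
  have D: "(S b has_real_derivative S (b + pi/2) x) (at x)" for b x
  proof -
    have "S (b + pi/2) x = cos (x + b)"
      using sin_add[of "x + b" "pi/2"] by (simp add: S_def add.assoc)
    then show ?thesis
      unfolding S_def by (auto intro!: derivative_eq_intros)
  qed
  then have d: "deriv (S b) = S (b + pi/2)" for b
    by (intro ext DERIV_imp_deriv)
  have "\<exists>b. (deriv ^^ n) (S 0) = S b" for n
  proof (induction n)
    case (Suc n)
    then obtain b where "(deriv ^^ n) (S 0) = S b" ..
    then have "(deriv ^^ Suc n) (S 0) = S (b + pi/2)" by (simp add: d)
    then show ?case ..
  qed auto
  then have "smooth (S 0)"
    unfolding smooth_def real_differentiable_def by (metis D)
  from smooth_affine[OF this, of a 0] show ?thesis by (simp add: S_def)
qed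

text \<open>The function \<open>exp (-1/x)\<close>, extended by zero to \<open>x \<le> 0\<close>. All its derivatives have the form
  \<open>p (1/x) exp (-1/x)\<close> with a polynomial \<open>p\<close>, which makes the induction work.\<close>

definition flat_times :: "real poly \<Rightarrow> real \<Rightarrow> real" where
  "flat_times p x = (if x \<le> 0 then 0 else poly p (1/x) * exp (-1/x))"

lemma poly_over_exp_tendsto_0:
  "((\<lambda>x. poly p x * exp (- x)) \<longlongrightarrow> 0) (at_top :: real filter)"
proof -
  have "((\<lambda>x. \<Sum>i\<le>degree p. coeff p i * (x ^ i / exp x)) \<longlongrightarrow> (\<Sum>i\<le>degree p. coeff p i * 0)) at_top"
    by (intro tendsto_intros tendsto_power_div_exp_0)
  then show ?thesis
    by (simp add: poly_altdef sum_distrib_right exp_minus field_simps flip: sum_divide_distrib)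
qed

lemma flat_times_tendsto_0: "((\<lambda>x. poly p (1/x) * exp (-1/x)) \<longlongrightarrow> 0) (at_right (0::real))"
proof -
  have "filterlim (\<lambda>x::real. 1/x) at_top (at_right 0)"
    using filterlim_inverse_at_top_right by (simp add: inverse_eq_divide)
  from filterlim_compose[OF poly_over_exp_tendsto_0 this, of p] show ?thesis by simp
qed

lemma flat_times_DERIV:
  "(flat_times p has_real_derivative flat_times ([:0, 0, 1:] * (p - pderiv p)) x) (at x)"
proof -
  consider "x < 0" | "x = 0" | "x > 0" by linarith
  then show ?thesis
  proof cases
    assume "x < 0"
    have "eventually (\<lambda>y. y < 0) (nhds x)"
      using \<open>x < 0\<close> by (intro eventually_nhds_in_open[of "{..<0}", simplified]) auto
    then have "eventually (\<lambda>y. flat_times p y = 0) (nhds x)"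
      by eventually_elim (simp add: flat_times_def)
    then have "(flat_times p has_real_derivative 0) (at x) \<longleftrightarrow> ((\<lambda>_. 0::real) has_real_derivative 0) (at x)"
      by (intro DERIV_cong_ev) auto
    then show ?thesis using \<open>x < 0\<close> by (simp add: flat_times_def)
  next
    assume "x > 0"
    have "eventually (\<lambda>y. y > 0) (nhds x)"
      using \<open>x > 0\<close> by (intro eventually_nhds_in_open[of "{0<..}", simplified]) auto
    then have ev: "eventually (\<lambda>y. flat_times p y = poly p (1/y) * exp (-1/y)) (nhds x)"
      by eventually_elim (simp add: flat_times_def)
    have "((\<lambda>y. poly p (1/y) * exp (-1/y)) has_real_derivative
            (1/x)^2 * (poly p (1/x) - poly (pderiv p) (1/x)) * exp (-1/x)) (at x)"
      using \<open>x > 0\<close>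
      by (auto intro!: derivative_eq_intros DERIV_chain'[where g = "poly p"] poly_DERIV
            simp: field_simps power2_eq_square)
    then have "(flat_times p has_real_derivative
            (1/x)^2 * (poly p (1/x) - poly (pderiv p) (1/x)) * exp (-1/x)) (at x)"
      using DERIV_cong_ev[OF refl ev refl] by simp
    then show ?thesis
      using \<open>x > 0\<close> by (simp add: flat_times_def power2_eq_square algebra_simps)
  next
    assume x: "x = 0"
    have "((\<lambda>h. poly (pCons 0 p) (1/h) * exp (-1/h)) \<longlongrightarrow> 0) (at_right (0::real))"
      by (rule flat_times_tendsto_0)
    then have R: "((\<lambda>h. (flat_times p (0 + h) - flat_times p 0) / h) \<longlongrightarrow> 0) (at_right 0)"
      by (rule Lim_transform_eventually)
         (auto simp: eventually_at_filter flat_times_def intro!: always_eventually)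
    have L: "((\<lambda>h. (flat_times p (0 + h) - flat_times p 0) / h) \<longlongrightarrow> 0) (at_left 0)"
      by (rule Lim_transform_eventually[of "\<lambda>_. 0"])
         (auto simp: eventually_at_filter flat_times_def intro!: always_eventually)
    have "((\<lambda>h. (flat_times p (0 + h) - flat_times p 0) / h) \<longlongrightarrow> 0) (at 0)"
      using L R filterlim_split_at by blast
    then show ?thesis using x by (simp add: DERIV_def flat_times_def)
  qed
qed

lemma smooth_flat_times: "smooth (flat_times p)"
proof -
  have d: "deriv (flat_times p) = flat_times ([:0, 0, 1:] * (p - pderiv p))" for p
    by (intro ext DERIV_imp_deriv flat_times_DERIV)
  have "\<exists>q. (deriv ^^ n) (flat_times p) = flat_times q" for n
  proof (induction n)
    case (Suc n)
    then show ?case using d by auto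
  qed auto
  then show ?thesis
    unfolding smooth_def using flat_times_DERIV real_differentiable_def by metis
qed

text \<open>A smooth function that vanishes for \<open>x \<le> 0\<close> and increases to the limit \<open>1\<close> at infinity.\<close>

definition ramp :: "real \<Rightarrow> real" where
  "ramp = flat_times 1"

definition ramp' :: "real \<Rightarrow> real" where
  "ramp' = flat_times [:0, 0, 1:]"

lemma ramp_DERIV: "(ramp has_real_derivative ramp' x) (at x)"
  unfolding ramp_def ramp'_def using flat_times_DERIV[of 1 x] by simp

lemma smooth_ramp: "smooth ramp"
  unfolding ramp_def by (rule smooth_flat_times)

lemma deriv_ramp: "deriv ramp = ramp'"
  by (intro ext DERIV_imp_deriv ramp_DERIV)

lemma ramp_neg: "x \<le> 0 \<Longrightarrow> ramp x = 0" "x \<le> 0 \<Longrightarrow> ramp' x = 0"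
  by (auto simp: ramp_def ramp'_def flat_times_def)

lemma ramp_bounds: "0 \<le> ramp x" "ramp x \<le> 1" "0 \<le> ramp' x"
  by (auto simp: ramp_def ramp'_def flat_times_def)

lemma ramp_at_top: "(ramp \<longlongrightarrow> 1) at_top"
proof -
  have "((\<lambda>x::real. exp (- (1/x))) \<longlongrightarrow> exp (- 0)) at_top"
    by (intro tendsto_intros tendsto_divide_0[OF tendsto_const] filterlim_at_top_imp_at_infinity
        filterlim_ident)
  then have "((\<lambda>x::real. exp (- (1/x))) \<longlongrightarrow> 1) at_top" by simp
  then show ?thesis
    by (rule Lim_transform_eventually)
       (use eventually_gt_at_top[of 0] in eventually_elim, simp add: ramp_def flat_times_def)
qed

lemma ramp_continuous: "continuous_on S ramp" "continuous_on S ramp'"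
  using smooth_continuous[OF smooth_ramp] smooth_continuous[OF smooth_deriv[OF smooth_ramp]]
  by (auto simp: deriv_ramp)

lemma ramp_borel [measurable]: "ramp \<in> borel_measurable borel" "ramp' \<in> borel_measurable borel"
  using ramp_continuous by (auto intro: borel_measurable_continuous_onI)

text \<open>The derivative of a cutoff blows up near the end points like \<open>k ramp' (k x - 1)\<close>. Multiplied by a
  function that vanishes there linearly it becomes comparable to \<open>(z + 1) ramp' z\<close> with \<open>z = k x - 1\<close>,
  hence bounded and convergent to zero as \<open>k\<close> grows.\<close>

lemma weighted_ramp'_at_top: "((\<lambda>x. (x + 1) * ramp' x) \<longlongrightarrow> 0) at_top"
proof -
  have inv: "((\<lambda>x::real. 1/x) \<longlongrightarrow> 0) at_top"
    by (intro tendsto_divide_0[OF tendsto_const] filterlim_at_top_imp_at_infinity filterlim_ident)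
  have "((\<lambda>x::real. (1/x + (1/x)^2) * exp (- (1/x))) \<longlongrightarrow> (0 + 0^2) * exp (- 0)) at_top"
    by (intro tendsto_intros inv)
  then have "((\<lambda>x::real. (1/x + (1/x)^2) * exp (- (1/x))) \<longlongrightarrow> 0) at_top" by simp
  then show ?thesis
    by (rule Lim_transform_eventually)
       (use eventually_gt_at_top[of 0] in eventually_elim,
        simp add: ramp'_def flat_times_def field_simps power2_eq_square)
qed

lemma weighted_ramp'_bounded: "\<exists>C. \<forall>x. \<bar>(x + 1) * ramp' x\<bar> \<le> C"
proof -
  have "eventually (\<lambda>x. \<bar>(x + 1) * ramp' x\<bar> < 1) at_top"
    using order_tendstoD(2)[OF tendsto_rabs_zero[OF weighted_ramp'_at_top], of 1] by simp
  then obtain R where R: "\<And>x. x \<ge> R \<Longrightarrow> \<bar>(x + 1) * ramp' x\<bar> < 1"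
    unfolding eventually_at_top_linorder by blast
  have "bounded ((\<lambda>x. (x + 1) * ramp' x) ` {0..R})"
    by (intro compact_imp_bounded compact_continuous_image continuous_intros ramp_continuous) auto
  then obtain C where "\<forall>y \<in> (\<lambda>x. (x + 1) * ramp' x) ` {0..R}. norm y \<le> C"
    unfolding bounded_iff ..
  then have C: "\<bar>(x + 1) * ramp' x\<bar> \<le> C" if "x \<in> {0..R}" for x
    using that by auto
  have "\<bar>(x + 1) * ramp' x\<bar> \<le> max 1 C" for x
  proof (cases "x \<le> 0 \<or> x \<ge> R")
    case True
    then show ?thesis using R[of x] ramp_neg(2)[of x] by (auto simp: le_max_iff_disj)
  next
    case False
    then show ?thesis using C[of x] by (simp add: le_max_iff_disj)
  qed
  then show ?thesis by (intro exI[of _ "max 1 C"] allI)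
qed

text \<open>A smooth approximation of the indicator function of \<open>(a,b)\<close>. The shifts by \<open>1\<close> keep the support
  inside \<open>[a + 1/k, b - 1/k]\<close>, a compact subset of the open interval.\<close>

definition cutoff :: "real \<Rightarrow> real \<Rightarrow> nat \<Rightarrow> real \<Rightarrow> real" where
  "cutoff a b k x = ramp (real k * (x - a) - 1) * ramp (real k * (b - x) - 1)"

definition cutoff' :: "real \<Rightarrow> real \<Rightarrow> nat \<Rightarrow> real \<Rightarrow> real" where
  "cutoff' a b k x = real k * ramp' (real k * (x - a) - 1) * ramp (real k * (b - x) - 1)
    - real k * ramp' (real k * (b - x) - 1) * ramp (real k * (x - a) - 1)"

lemma cutoff_DERIV: "(cutoff a b k has_real_derivative cutoff' a b k x) (at x)"
proof -
  have "((\<lambda>x. ramp (real k * (x - a) - 1)) has_real_derivative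
      ramp' (real k * (x - a) - 1) * real k) (at x)"
    by (rule DERIV_chain'[OF _ ramp_DERIV]) (auto intro!: derivative_eq_intros)
  moreover have "((\<lambda>x. ramp (real k * (b - x) - 1)) has_real_derivative
      ramp' (real k * (b - x) - 1) * (- real k)) (at x)"
    by (rule DERIV_chain'[OF _ ramp_DERIV]) (auto intro!: derivative_eq_intros)
  ultimately have "((\<lambda>x. ramp (real k * (x - a) - 1) * ramp (real k * (b - x) - 1)) has_real_derivative
      cutoff' a b k x) (at x)"
    unfolding cutoff'_def
    by - (drule (1) DERIV_mult, simp add: algebra_simps)
  then show ?thesis unfolding cutoff_def[abs_def] .
qed

lemma smooth_cutoff: "smooth (cutoff a b k)"
proof -
  have "smooth (\<lambda>x. ramp (real k * x + (- real k * a - 1)) * ramp (- real k * x + (real k * b - 1)))"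
    by (intro smooth_mult smooth_affine smooth_ramp)
  then show ?thesis unfolding cutoff_def[abs_def] by (simp add: algebra_simps)
qed

lemma cutoff_continuous: "continuous_on S (cutoff a b k)" "continuous_on S (cutoff' a b k)"
proof -
  have "deriv (cutoff a b k) = cutoff' a b k" by (intro ext DERIV_imp_deriv cutoff_DERIV)
  then show "continuous_on S (cutoff a b k)" "continuous_on S (cutoff' a b k)"
    using smooth_continuous[OF smooth_cutoff] smooth_continuous[OF smooth_deriv[OF smooth_cutoff]] by metis+
qed

lemma cutoff_bounds: "0 \<le> cutoff a b k x" "cutoff a b k x \<le> 1"
  using ramp_bounds by (auto simp: cutoff_def mult_le_one)

lemma cutoff_borel [measurable]:
  "cutoff a b k \<in> borel_measurable borel" "cutoff' a b k \<in> borel_measurable borel"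
  unfolding cutoff_def[abs_def] cutoff'_def[abs_def] by measurable

lemma scaled_ramp_tendsto: "c > 0 \<Longrightarrow> (\<lambda>k. ramp (real k * c - 1)) \<longlonglongrightarrow> 1"
proof (rule filterlim_compose[OF ramp_at_top])
  assume "c > 0"
  then show "filterlim (\<lambda>k. real k * c - 1) at_top sequentially"
    by real_asymp
qed

lemma cutoff_tendsto: "x \<in> {a<..<b} \<Longrightarrow> (\<lambda>k. cutoff a b k x) \<longlonglongrightarrow> 1"
  unfolding cutoff_def
  using tendsto_mult[OF scaled_ramp_tendsto[of "x - a"] scaled_ramp_tendsto[of "b - x"]] by simp

lemma smooth_cutoff_in_test_functions:
  assumes "smooth f"
  shows "(\<lambda>x. cutoff a b k x * f x) \<in> test_functions a b"
proof -
  have "{x. cutoff a b k x * f x \<noteq> 0} \<subseteq> {a + 1 / real k..b - 1 / real k} \<inter> {x. k \<noteq> 0}"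
  proof
    fix x assume "x \<in> {x. cutoff a b k x * f x \<noteq> 0}"
    then have "\<not> real k * (x - a) - 1 \<le> 0" "\<not> real k * (b - x) - 1 \<le> 0"
      using ramp_neg unfolding cutoff_def by force+
    moreover from this have "k > 0" by (cases k) auto
    ultimately show "x \<in> {a + 1 / real k..b - 1 / real k} \<inter> {x. k \<noteq> 0}"
      by (simp add: field_simps)
  qed
  moreover have "closed ({a + 1 / real k..b - 1 / real k} \<inter> {x. k \<noteq> 0})"
    by (cases "k = 0") auto
  ultimately have "closure {x. cutoff a b k x * f x \<noteq> 0} \<subseteq> {a + 1 / real k..b - 1 / real k} \<inter> {x. k \<noteq> 0}"
    by (rule closure_minimal)
  also have "\<dots> \<subseteq> {a<..<b}"
  proof
    fix x assume "x \<in> {a + 1 / real k..b - 1 / real k} \<inter> {x. k \<noteq> 0}"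
    then have "a + 1 / real k \<le> x" "x \<le> b - 1 / real k" "1 / real k > 0"
      by (auto split: if_splits)
    then have "a < x" "x < b" by linarith+
    then show "x \<in> {a<..<b}" by simp
  qed
  finally show ?thesis
    using smooth_mult[OF smooth_cutoff assms, unfolded smooth_def] by (auto simp: test_functions_def)
qed


section \<open>Square integrable functions\<close>

lemma L2_measurable [measurable_dest]: "f \<in> L2_space M \<Longrightarrow> f \<in> borel_measurable M"
  by (simp add: L2_space_def)

lemma L2_integrable_mult:
  assumes "f \<in> L2_space M" "g \<in> L2_space M"
  shows "integrable M (\<lambda>x. f x * g x)"
proof (rule Bochner_Integration.integrable_bound)
  show "integrable M (\<lambda>x. (f x)\<^sup>2 + (g x)\<^sup>2)"
    using assms by (simp add: L2_space_def)
  show "AE x in M. norm (f x * g x) \<le> norm ((f x)\<^sup>2 + (g x)\<^sup>2)"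
  proof (rule always_eventually, rule allI)
    fix x
    have "2 * (\<bar>f x\<bar> * \<bar>g x\<bar>) \<le> (f x)\<^sup>2 + (g x)\<^sup>2"
      using sum_squares_bound[of "\<bar>f x\<bar>" "\<bar>g x\<bar>"] by simp
    moreover have "0 \<le> \<bar>f x\<bar> * \<bar>g x\<bar>" by simp
    ultimately have "\<bar>f x\<bar> * \<bar>g x\<bar> \<le> (f x)\<^sup>2 + (g x)\<^sup>2" by linarith
    then show "norm (f x * g x) \<le> norm ((f x)\<^sup>2 + (g x)\<^sup>2)"
      by (simp add: abs_mult)
  qed
qed (use assms in \<open>auto simp: L2_space_def\<close>)

lemma L2_combination:
  assumes "f \<in> L2_space M" "g \<in> L2_space M"
  shows "(\<lambda>x. a * f x + b * g x) \<in> L2_space M"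
proof -
  have "integrable M (\<lambda>x. a\<^sup>2 * (f x)\<^sup>2 + 2 * a * b * (f x * g x) + b\<^sup>2 * (g x)\<^sup>2)"
    using assms L2_integrable_mult[OF assms] by (auto simp: L2_space_def)
  moreover have "(\<lambda>x. a\<^sup>2 * (f x)\<^sup>2 + 2 * a * b * (f x * g x) + b\<^sup>2 * (g x)\<^sup>2)
      = (\<lambda>x. (a * f x + b * g x)\<^sup>2)"
    by (auto simp: power2_eq_square algebra_simps)
  ultimately show ?thesis using assms by (auto simp: L2_space_def)
qed

lemma L2_zero: "(\<lambda>x. 0) \<in> L2_space M"
  by (simp add: L2_space_def)

lemma L2_add: "f \<in> L2_space M \<Longrightarrow> g \<in> L2_space M \<Longrightarrow> (\<lambda>x. f x + g x) \<in> L2_space M"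
  using L2_combination[of f M g 1 1] by simp

lemma L2_diff: "f \<in> L2_space M \<Longrightarrow> g \<in> L2_space M \<Longrightarrow> (\<lambda>x. f x - g x) \<in> L2_space M"
  using L2_combination[of f M g 1 "-1"] by simp

lemma L2_cmult: "f \<in> L2_space M \<Longrightarrow> (\<lambda>x. a * f x) \<in> L2_space M"
  using L2_combination[of f M f a 0] by simp

lemma L2_sum: "(\<And>i. i \<in> I \<Longrightarrow> f i \<in> L2_space M) \<Longrightarrow> (\<lambda>x. \<Sum>i\<in>I. f i x) \<in> L2_space M"
  by (induction I rule: infinite_finite_induct) (auto simp: L2_zero L2_add)

lemma L2_norm_sq: "(L2_norm M f)\<^sup>2 = (\<integral>x. (f x)\<^sup>2 \<partial>M)"
  by (simp add: L2_norm_def)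

lemma L2_norm_nonneg [simp]: "0 \<le> L2_norm M f"
  by (simp add: L2_norm_def)

lemma L2_norm_cong_AE:
  assumes "AE x in M. f x = g x" "f \<in> borel_measurable M" "g \<in> borel_measurable M"
  shows "L2_norm M f = L2_norm M g"
proof -
  have "(\<integral>x. (f x)\<^sup>2 \<partial>M) = (\<integral>x. (g x)\<^sup>2 \<partial>M)"
    using assms by (intro integral_cong_AE) auto
  then show ?thesis by (simp add: L2_norm_def)
qed

lemma L2_norm_minus_commute: "L2_norm M (\<lambda>x. f x - g x) = L2_norm M (\<lambda>x. g x - f x)"
  by (simp add: L2_norm_def power2_commute)

lemma L2_norm_cmult: "L2_norm M (\<lambda>x. a * f x) = \<bar>a\<bar> * L2_norm M f"
  by (simp add: L2_norm_def power_mult_distrib real_sqrt_mult)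

lemma L2_norm_zero [simp]: "L2_norm M (\<lambda>x. 0) = 0"
  by (simp add: L2_norm_def)

lemma L2_norm_eq_0_AE:
  assumes "f \<in> L2_space M" "L2_norm M f = 0"
  shows "AE x in M. f x = 0"
proof -
  have "(\<integral>x. (f x)\<^sup>2 \<partial>M) = 0" using assms L2_norm_sq[of M f] by simp
  then have "AE x in M. (f x)\<^sup>2 = 0"
    using assms by (subst (asm) integral_nonneg_eq_0_iff_AE) (auto simp: L2_space_def)
  then show ?thesis by simp
qed

lemma L2_norm_sq_expand:
  assumes "f \<in> L2_space M" "g \<in> L2_space M"
  shows "(L2_norm M (\<lambda>x. f x + a * g x))\<^sup>2 =
    (L2_norm M f)\<^sup>2 + 2 * a * (\<integral>x. f x * g x \<partial>M) + a\<^sup>2 * (L2_norm M g)\<^sup>2"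
proof -
  have "(\<integral>x. (f x + a * g x)\<^sup>2 \<partial>M) = (\<integral>x. (f x)\<^sup>2 + 2 * a * (f x * g x) + a\<^sup>2 * (g x)\<^sup>2 \<partial>M)"
    by (intro Bochner_Integration.integral_cong) (auto simp: power2_eq_square algebra_simps)
  also have "\<dots> = (\<integral>x. (f x)\<^sup>2 \<partial>M) + 2 * a * (\<integral>x. f x * g x \<partial>M) + a\<^sup>2 * (\<integral>x. (g x)\<^sup>2 \<partial>M)"
    using assms L2_integrable_mult[OF assms] by (simp add: L2_space_def)
  finally show ?thesis by (simp add: L2_norm_sq)
qed

text \<open>The quadratic polynomial \<open>t \<mapsto> \<parallel>f + t g\<parallel>\<^sup>2\<close> is nonnegative, so its discriminant is not positive.\<close>

lemma L2_Cauchy_Schwarz: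
  assumes "f \<in> L2_space M" "g \<in> L2_space M"
  shows "\<bar>\<integral>x. f x * g x \<partial>M\<bar> \<le> L2_norm M f * L2_norm M g"
proof -
  define a where "a = (L2_norm M g)\<^sup>2"
  define b where "b = (\<integral>x. f x * g x \<partial>M)"
  define c where "c = (L2_norm M f)\<^sup>2"
  have pos: "0 \<le> c + 2 * t * b + t\<^sup>2 * a" for t
    using L2_norm_sq_expand[OF assms, of t] zero_le_power2[of "L2_norm M (\<lambda>x. f x + t * g x)"]
    by (simp add: a_def b_def c_def)
  have "b\<^sup>2 \<le> c * a"
  proof (cases "a = 0")
    case True
    have "b = 0"
    proof (rule ccontr)
      assume "b \<noteq> 0"
      with pos[of "- (c + 1) / (2 * b)"] True show False by (simp add: field_simps)
    qed
    then show ?thesis using True by simp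
  next
    case False
    then have "a > 0" by (simp add: a_def)
    with pos[of "- b / a"] show ?thesis by (simp add: field_simps power2_eq_square)
  qed
  then have "b\<^sup>2 \<le> (L2_norm M f * L2_norm M g)\<^sup>2"
    by (simp add: a_def c_def power_mult_distrib)
  then show ?thesis
    unfolding b_def by (intro abs_le_square_iff[THEN iffD2, of _ "L2_norm M f * L2_norm M g", simplified])
qed

lemma L2_triangle:
  assumes "f \<in> L2_space M" "g \<in> L2_space M"
  shows "L2_norm M (\<lambda>x. f x + g x) \<le> L2_norm M f + L2_norm M g"
proof (rule power2_le_imp_le)
  have "(L2_norm M (\<lambda>x. f x + g x))\<^sup>2 = (L2_norm M f)\<^sup>2 + 2 * (\<integral>x. f x * g x \<partial>M) + (L2_norm M g)\<^sup>2"
    using L2_norm_sq_expand[OF assms, of 1] by simp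
  also have "\<dots> \<le> (L2_norm M f + L2_norm M g)\<^sup>2"
    using L2_Cauchy_Schwarz[OF assms] by (simp add: power2_sum)
  finally show "(L2_norm M (\<lambda>x. f x + g x))\<^sup>2 \<le> (L2_norm M f + L2_norm M g)\<^sup>2" .
qed simp

lemma L2_triangle_diff:
  assumes "f \<in> L2_space M" "g \<in> L2_space M" "h \<in> L2_space M"
  shows "L2_norm M (\<lambda>x. f x - h x) \<le> L2_norm M (\<lambda>x. f x - g x) + L2_norm M (\<lambda>x. g x - h x)"
  using L2_triangle[OF L2_diff[OF assms(1,2)] L2_diff[OF assms(2,3)]] by simp

lemma L2_combination_tendsto:
  assumes "\<And>n. f n \<in> L2_space M" "F \<in> L2_space M" "\<And>n. g n \<in> L2_space M" "G \<in> L2_space M"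
    and "(\<lambda>n. L2_norm M (\<lambda>x. f n x - F x)) \<longlonglongrightarrow> 0" "(\<lambda>n. L2_norm M (\<lambda>x. g n x - G x)) \<longlonglongrightarrow> 0"
  shows "(\<lambda>n. L2_norm M (\<lambda>x. (a * f n x + b * g n x) - (a * F x + b * G x))) \<longlonglongrightarrow> 0"
proof (rule Lim_null_comparison[OF always_eventually], rule allI)
  fix n
  have "L2_norm M (\<lambda>x. a * (f n x - F x) + b * (g n x - G x))
      \<le> L2_norm M (\<lambda>x. a * (f n x - F x)) + L2_norm M (\<lambda>x. b * (g n x - G x))"
    by (intro L2_triangle L2_cmult L2_diff assms)
  then show "norm (L2_norm M (\<lambda>x. (a * f n x + b * g n x) - (a * F x + b * G x)))
      \<le> \<bar>a\<bar> * L2_norm M (\<lambda>x. f n x - F x) + \<bar>b\<bar> * L2_norm M (\<lambda>x. g n x - G x)"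
    unfolding L2_norm_cmult
    by (simp add: right_diff_distrib add_diff_add)
next
  have "(\<lambda>n. \<bar>a\<bar> * L2_norm M (\<lambda>x. f n x - F x) + \<bar>b\<bar> * L2_norm M (\<lambda>x. g n x - G x))
      \<longlonglongrightarrow> \<bar>a\<bar> * 0 + \<bar>b\<bar> * 0"
    by (intro tendsto_intros assms)
  then show "(\<lambda>n. \<bar>a\<bar> * L2_norm M (\<lambda>x. f n x - F x) + \<bar>b\<bar> * L2_norm M (\<lambda>x. g n x - G x)) \<longlonglongrightarrow> 0"
    by simp
qed

lemma L2_inner_tendsto:
  assumes "\<And>n. f n \<in> L2_space M" "F \<in> L2_space M" "g \<in> L2_space M"
    and "(\<lambda>n. L2_norm M (\<lambda>x. f n x - F x)) \<longlonglongrightarrow> 0"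
  shows "(\<lambda>n. \<integral>x. f n x * g x \<partial>M) \<longlonglongrightarrow> (\<integral>x. F x * g x \<partial>M)"
proof (rule LIM_zero_cancel, rule Lim_null_comparison)
  show "(\<lambda>n. L2_norm M (\<lambda>x. f n x - F x) * L2_norm M g) \<longlonglongrightarrow> 0"
    using tendsto_mult_right[OF assms(4), of "L2_norm M g"] by simp
  have "(\<integral>x. f n x * g x \<partial>M) - (\<integral>x. F x * g x \<partial>M) = (\<integral>x. (f n x - F x) * g x \<partial>M)" for n
    using assms by (simp add: L2_integrable_mult left_diff_distrib)
  then show "\<forall>\<^sub>F n in sequentially. norm ((\<integral>x. f n x * g x \<partial>M) - (\<integral>x. F x * g x \<partial>M))
      \<le> L2_norm M (\<lambda>x. f n x - F x) * L2_norm M g"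
    using L2_Cauchy_Schwarz[OF L2_diff[OF assms(1,2)] assms(3)] by simp
qed

lemma L2_bounded:
  assumes "finite_measure M" "f \<in> borel_measurable M" "AE x in M. \<bar>f x\<bar> \<le> B"
  shows "f \<in> L2_space M"
proof -
  have "AE x in M. (f x)\<^sup>2 \<le> B\<^sup>2"
    using assms(3) by eventually_elim (metis abs_ge_zero power2_abs power_mono)
  then have "integrable M (\<lambda>x. (f x)\<^sup>2)"
    using assms finite_measure.integrable_const_bound[OF assms(1), of "\<lambda>x. (f x)\<^sup>2" "B\<^sup>2"] by simp
  then show ?thesis using assms by (simp add: L2_space_def)
qed

lemma L2_dominated_convergence:
  assumes "\<And>n. f n \<in> borel_measurable M" "F \<in> borel_measurable M" "h \<in> L2_space M"
    and lim: "AE x in M. (\<lambda>n. f n x) \<longlonglongrightarrow> F x"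
    and bound: "\<And>n. AE x in M. \<bar>f n x - F x\<bar> \<le> \<bar>h x\<bar>"
  shows "(\<lambda>n. L2_norm M (\<lambda>x. f n x - F x)) \<longlonglongrightarrow> 0"
proof -
  have "(\<lambda>n. \<integral>x. (f n x - F x)\<^sup>2 \<partial>M) \<longlonglongrightarrow> (\<integral>x. 0 \<partial>M)"
  proof (rule integral_dominated_convergence[where w = "\<lambda>x. (h x)\<^sup>2"])
    show "AE x in M. (\<lambda>n. (f n x - F x)\<^sup>2) \<longlonglongrightarrow> 0"
      using lim
    proof eventually_elim
      case (elim x)
      then have "(\<lambda>n. (f n x - F x)\<^sup>2) \<longlonglongrightarrow> (F x - F x)\<^sup>2" by (intro tendsto_intros)
      then show ?case by simp
    qed
    show "AE x in M. norm ((f n x - F x)\<^sup>2) \<le> (h x)\<^sup>2" for n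
      using bound[of n] by eventually_elim (simp add: abs_le_square_iff)
  qed (use assms in \<open>auto simp: L2_space_def\<close>)
  then have "(\<lambda>n. sqrt (\<integral>x. (f n x - F x)\<^sup>2 \<partial>M)) \<longlonglongrightarrow> sqrt 0"
    by (intro tendsto_intros) simp
  then show ?thesis by (simp add: L2_norm_def)
qed


abbreviation (input) L2_unit :: "(real \<Rightarrow> real) set" where
  "L2_unit \<equiv> L2_space space_measure"

abbreviation (input) norm_unit :: "(real \<Rightarrow> real) \<Rightarrow> real" where
  "norm_unit \<equiv> L2_norm space_measure"


section \<open>Integration on bounded intervals\<close>

lemma finite_measure_interval: "finite_measure (lebesgue_on {a<..<b::real})"
proof (rule finite_measureI)
  have "emeasure lborel {a<..<b} \<le> emeasure lborel {a..b}"
    by (intro emeasure_mono) auto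
  also have "\<dots> < \<infinity>" by (cases "a \<le> b") auto
  finally show "emeasure (lebesgue_on {a<..<b}) (space (lebesgue_on {a<..<b})) \<noteq> \<infinity>"
    by (simp add: emeasure_restrict_space)
qed

lemma borel_measurable_interval [measurable (raw)]:
  "f \<in> borel_measurable borel \<Longrightarrow> f \<in> borel_measurable (lebesgue_on {a<..<b::real})"
  by (intro measurable_restrict_space1 measurable_completion) simp

lemma continuous_on_borel_measurable_interval:
  "continuous_on {a<..<b} f \<Longrightarrow> f \<in> borel_measurable (lebesgue_on {a<..<b::real})"
  by (intro continuous_imp_measurable_on_sets_lebesgue) auto

lemma AE_interval: "(\<And>x. a < x \<Longrightarrow> x < b \<Longrightarrow> P x) \<Longrightarrow> AE x in lebesgue_on {a<..<b::real}. P x"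
  by (auto intro!: AE_I2)

lemma integrable_bounded_interval:
  fixes f :: "real \<Rightarrow> real"
  assumes "f \<in> borel_measurable (lebesgue_on {a<..<b})" "\<And>x. a < x \<Longrightarrow> x < b \<Longrightarrow> \<bar>f x\<bar> \<le> B"
  shows "integrable (lebesgue_on {a<..<b}) f"
  using assms
  by (intro finite_measure.integrable_const_bound[OF finite_measure_interval, of f B] AE_interval) auto

lemma integrable_continuous_interval:
  fixes f :: "real \<Rightarrow> real"
  assumes "continuous_on {a..b} f"
  shows "integrable (lebesgue_on {a<..<b}) f"
proof -
  have "bounded (f ` {a..b})"
    using assms by (intro compact_imp_bounded compact_continuous_image) auto
  then obtain B where "\<forall>y \<in> f ` {a..b}. norm y \<le> B" unfolding bounded_iff ..
  then show ?thesis
    using continuous_on_subset[OF assms, of "{a<..<b}"]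
    by (intro integrable_bounded_interval[of _ _ _ B] continuous_on_borel_measurable_interval)
       (auto simp: subset_eq)
qed

lemma L2_continuous_interval:
  assumes "continuous_on {a..b::real} f"
  shows "f \<in> L2_space (lebesgue_on {a<..<b})"
proof -
  have "continuous_on {a<..<b} f"
    by (rule continuous_on_subset[OF assms]) auto
  then show ?thesis
    unfolding L2_space_def using assms
    by (auto intro!: integrable_continuous_interval continuous_on_borel_measurable_interval
        continuous_intros)
qed

lemma L2_const: "(\<lambda>_. c) \<in> L2_space (lebesgue_on {a<..<b::real})"
  by (rule L2_continuous_interval) simp

lemma integral_interval_FTC:
  fixes f :: "real \<Rightarrow> real"
  assumes "a \<le> b" "continuous_on {a..b} f"
    and "\<And>x. x \<in> {a..b} \<Longrightarrow> (F has_real_derivative f x) (at x within {a..b})"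
  shows "(\<integral>x. f x \<partial>lebesgue_on {a<..<b}) = F b - F a"
proof -
  have "(\<integral>x. f x \<partial>lebesgue_on {a<..<b}) = integral {a<..<b} f"
    using assms by (intro lebesgue_integral_eq_integral integrable_continuous_interval) auto
  also have "\<dots> = integral {a..b} f"
    by (simp add: integral_open_interval_real)
  also have "\<dots> = F b - F a"
    using assms
    by (intro integral_unique fundamental_theorem_of_calculus)
       (auto simp: has_real_derivative_iff_has_vector_derivative)
  finally show ?thesis .
qed

lemma test_function_smooth: "\<phi> \<in> test_functions a b \<Longrightarrow> smooth \<phi>"
  by (simp add: test_functions_def smooth_def)

text \<open>A test function vanishes in a neighbourhood of every point outside its closed support, and with it
  the derivative.\<close>

lemma test_function_locally_zero:
  assumes "\<phi> \<in> test_functions a b" "x \<notin> closure {x. \<phi> x \<noteq> 0}"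
  shows "\<forall>\<^sub>F y in nhds x. \<phi> y = 0 \<and> deriv \<phi> y = 0"
proof -
  have *: "\<forall>\<^sub>F y in nhds z. \<phi> y = 0" if "z \<notin> closure {x. \<phi> x \<noteq> 0}" for z
  proof -
    have "\<forall>\<^sub>F y in nhds z. y \<in> - closure {x. \<phi> x \<noteq> 0}"
      using that by (intro eventually_nhds_in_open) auto
    then show ?thesis
      by eventually_elim (use closure_subset[of "{x. \<phi> x \<noteq> 0}"] in auto)
  qed
  have "\<forall>\<^sub>F y in nhds x. y \<in> - closure {x. \<phi> x \<noteq> 0}"
    using assms by (intro eventually_nhds_in_open) auto
  then show ?thesis
  proof eventually_elim
    case (elim y)
    then have ev: "\<forall>\<^sub>F z in nhds y. \<phi> z = 0" by (intro *) simp
    then have "deriv \<phi> y = deriv (\<lambda>_. 0) y" by (intro deriv_cong_ev) auto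
    then show ?case using eventually_nhds_x_imp_x[OF ev] by simp
  qed
qed

lemma test_function_combination:
  assumes "\<phi> \<in> test_functions a b" "\<psi> \<in> test_functions a b"
  shows "(\<lambda>x. c * \<phi> x + d * \<psi> x) \<in> test_functions a b"
proof -
  have "closure {x. c * \<phi> x + d * \<psi> x \<noteq> 0} \<subseteq> closure ({x. \<phi> x \<noteq> 0} \<union> {x. \<psi> x \<noteq> 0})"
    by (intro closure_mono) auto
  then have "closure {x. c * \<phi> x + d * \<psi> x \<noteq> 0} \<subseteq> {a<..<b}"
    using assms by (auto simp: test_functions_def)
  moreover have "smooth (\<lambda>x. c * \<phi> x + d * \<psi> x)"
    by (intro smooth_add smooth_mult smooth_const assms[THEN test_function_smooth])
  ultimately show ?thesis by (simp add: test_functions_def smooth_def)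
qed

lemma test_function_outside:
  assumes "\<phi> \<in> test_functions a b" "x \<notin> {a<..<b}"
  shows "\<phi> x = 0" "deriv \<phi> x = 0"
proof -
  have "x \<notin> closure {x. \<phi> x \<noteq> 0}"
    using assms by (auto simp: test_functions_def)
  from eventually_nhds_x_imp_x[OF test_function_locally_zero[OF assms(1) this]]
  show "\<phi> x = 0" "deriv \<phi> x = 0" by auto
qed

lemma test_function_deriv_borel:
  assumes "\<phi> \<in> test_functions a b"
  shows "continuous_on S \<phi>" "continuous_on S (deriv \<phi>)"
    "\<phi> \<in> borel_measurable borel" "deriv \<phi> \<in> borel_measurable borel"
  using smooth_continuous[OF test_function_smooth[OF assms]]
    smooth_continuous[OF smooth_deriv[OF test_function_smooth[OF assms]]]
  by (auto intro: borel_measurable_continuous_onI)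

lemma test_function_L2:
  assumes "\<phi> \<in> test_functions a b"
  shows "\<phi> \<in> L2_space (lebesgue_on {a<..<b})" "deriv \<phi> \<in> L2_space (lebesgue_on {a<..<b})"
  using test_function_deriv_borel[OF assms] by (auto intro: L2_continuous_interval)

text \<open>Integration by parts has no boundary terms here: the product of a test function with a
  function that is differentiable on the open interval only is differentiable on the whole line,
  since it vanishes identically off the support.\<close>

lemma integral_by_parts_test_function:
  assumes phi: "\<phi> \<in> test_functions a b" and "a \<le> b"
    and D: "\<And>x. a < x \<Longrightarrow> x < b \<Longrightarrow> (f has_real_derivative f' x) (at x)"
    and cont: "continuous_on {a<..<b} f'"
  shows "(\<integral>x. deriv \<phi> x * f x \<partial>lebesgue_on {a<..<b}) = - (\<integral>x. \<phi> x * f' x \<partial>lebesgue_on {a<..<b})"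
proof -
  note [continuous_intros] = test_function_deriv_borel[OF phi]
  have mult: "isCont (\<lambda>x. \<psi> x * g x) x"
    if "continuous_on {a<..<b} g" "isCont \<psi> x"
      "x \<notin> closure {x. \<phi> x \<noteq> 0} \<Longrightarrow> \<forall>\<^sub>F y in nhds x. \<psi> y = 0" for \<psi> g :: "real \<Rightarrow> real" and x
  proof (cases "x \<in> closure {x. \<phi> x \<noteq> 0}")
    case True
    then have "x \<in> {a<..<b}" using phi by (auto simp: test_functions_def)
    then have "isCont g x" using that(1) by (simp add: continuous_on_eq_continuous_at)
    then show ?thesis using that(2) by (intro isCont_mult)
  next
    case False
    then have "\<forall>\<^sub>F y in nhds x. \<psi> y * g y = 0" using that(3) by (auto elim: eventually_mono)
    then have "isCont (\<lambda>x. \<psi> x * g x) x \<longleftrightarrow> isCont (\<lambda>x. 0::real) x" by (intro isCont_cong)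
    then show ?thesis by simp
  qed
  have contf: "continuous_on {a<..<b} f"
    by (intro continuous_at_imp_continuous_on ballI DERIV_isCont[OF D]) auto
  have c: "isCont \<phi> x" "isCont (deriv \<phi>) x" for x
    using test_function_deriv_borel(1,2)[OF phi, of UNIV]
    by (auto simp: continuous_on_eq_continuous_at)
  have z: "\<forall>\<^sub>F y in nhds x. \<phi> y = 0" "\<forall>\<^sub>F y in nhds x. deriv \<phi> y = 0"
    if "x \<notin> closure {x. \<phi> x \<noteq> 0}" for x
    using test_function_locally_zero[OF phi that] by (auto elim: eventually_mono)
  have c1: "continuous_on S (\<lambda>x. deriv \<phi> x * f x)" for S
    by (intro continuous_at_imp_continuous_on ballI mult contf c z)
  have c2: "continuous_on S (\<lambda>x. \<phi> x * f' x)" for S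
    by (intro continuous_at_imp_continuous_on ballI mult cont c z)
  have "((\<lambda>x. \<phi> x * f x) has_real_derivative deriv \<phi> x * f x + \<phi> x * f' x) (at x)" for x
  proof (cases "x \<in> closure {x. \<phi> x \<noteq> 0}")
    case True
    then have "a < x" "x < b" using phi by (auto simp: test_functions_def)
    from DERIV_mult[OF smooth_DERIV[OF test_function_smooth[OF phi]] D[OF this]]
    show ?thesis by (simp add: algebra_simps)
  next
    case False
    have "\<forall>\<^sub>F y in nhds x. \<phi> y * f y = 0" using z(1)[OF False] by (auto elim: eventually_mono)
    then have "((\<lambda>x. \<phi> x * f x) has_real_derivative 0) (at x) \<longleftrightarrow> ((\<lambda>x. 0::real) has_real_derivative 0) (at x)"
      by (intro DERIV_cong_ev) auto
    then show ?thesis using z[OF False, THEN eventually_nhds_x_imp_x] by simp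
  qed
  then have "(\<integral>x. deriv \<phi> x * f x + \<phi> x * f' x \<partial>lebesgue_on {a<..<b}) = \<phi> b * f b - \<phi> a * f a"
    using \<open>a \<le> b\<close>
    by (intro integral_interval_FTC continuous_intros c1 c2) (auto intro: has_field_derivative_at_within)
  also have "\<dots> = 0"
    using test_function_outside(1)[OF phi] by simp
  also have "(\<integral>x. deriv \<phi> x * f x + \<phi> x * f' x \<partial>lebesgue_on {a<..<b}) =
      (\<integral>x. deriv \<phi> x * f x \<partial>lebesgue_on {a<..<b}) + (\<integral>x. \<phi> x * f' x \<partial>lebesgue_on {a<..<b})"
    by (intro Bochner_Integration.integral_add integrable_continuous_interval c1 c2)
  finally show ?thesis by simp
qed


section \<open>Completeness of the sine system\<close>

abbreviation freq :: "nat \<Rightarrow> real" where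
  "freq k \<equiv> real (Suc k) * pi"

definition mode :: "nat \<Rightarrow> real \<Rightarrow> real" where
  "mode k x = sqrt 2 * sin (freq k * x)"

definition mode' :: "nat \<Rightarrow> real \<Rightarrow> real" where
  "mode' k x = sqrt 2 * freq k * cos (freq k * x)"

definition mode_coeff :: "(real \<Rightarrow> real) \<Rightarrow> nat \<Rightarrow> real" where
  "mode_coeff f k = (\<integral>x. f x * mode k x \<partial>space_measure)"

lemma eigenfunction_eq_mode: "eigenfunction (Suc k) = mode k"
  by (simp add: fun_eq_iff eigenfunction_def mode_def)

lemma fourier_coeff_eq_mode_coeff: "fourier_coeff f (Suc k) = mode_coeff f k"
  by (simp add: fourier_coeff_def mode_coeff_def eigenfunction_eq_mode)

lemma mode_DERIV: "(mode k has_real_derivative mode' k x) (at x)"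
  unfolding mode_def[abs_def] mode'_def by (auto intro!: derivative_eq_intros)

lemma mode'_DERIV: "(mode' k has_real_derivative - ((freq k)\<^sup>2 * mode k x)) (at x)"
  unfolding mode'_def[abs_def] mode_def
  by (auto intro!: derivative_eq_intros simp: power2_eq_square)

lemma mode_continuous: "continuous_on S (mode k)" "continuous_on S (mode' k)"
  unfolding mode_def[abs_def] mode'_def[abs_def] by (auto intro!: continuous_intros)

lemma mode_borel [measurable]: "mode k \<in> borel_measurable borel" "mode' k \<in> borel_measurable borel"
  using mode_continuous by (auto intro: borel_measurable_continuous_onI)

lemma mode_L2: "mode k \<in> L2_unit" "mode' k \<in> L2_unit"
  using mode_continuous by (auto intro: L2_continuous_interval)

lemma mode_bounds: "\<bar>mode k x\<bar> \<le> sqrt 2" "\<bar>mode' k x\<bar> \<le> sqrt 2 * freq k"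
proof -
  have "sqrt 2 * \<bar>sin (freq k * x)\<bar> \<le> sqrt 2 * 1" by (intro mult_left_mono) auto
  then show "\<bar>mode k x\<bar> \<le> sqrt 2" by (simp add: mode_def abs_mult)
  have "sqrt 2 * freq k * \<bar>cos (freq k * x)\<bar> \<le> sqrt 2 * freq k * 1" by (intro mult_left_mono) auto
  then show "\<bar>mode' k x\<bar> \<le> sqrt 2 * freq k" by (simp add: mode'_def abs_mult)
qed

lemma integral_cos_int:
  "(\<integral>x. cos (of_int m * pi * x) \<partial>space_measure) = (if m = 0 then 1 else 0)"
proof -
  define F where "F x = (if m = 0 then x else sin (of_int m * pi * x) / (of_int m * pi))" for x
  have "(\<integral>x. cos (of_int m * pi * x) \<partial>space_measure) = F 1 - F 0"
  proof (rule integral_interval_FTC)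
    show "continuous_on {0..1} (\<lambda>x. cos (real_of_int m * pi * x))" by (intro continuous_intros)
    show "(F has_real_derivative cos (of_int m * pi * x)) (at x within {0..1})" for x
      by (cases "m = 0") (auto simp: F_def[abs_def] intro!: derivative_eq_intros)
  qed simp
  also have "\<dots> = (if m = 0 then 1 else 0)"
    using sin_npi_int[of m] by (simp add: F_def mult.commute)
  finally show ?thesis .
qed

text \<open>The product formula turns \<open>e\<^sub>j e\<^sub>k\<close> into a difference of cosines with integer frequencies.\<close>

lemma mode_orthonormal:
  "(\<integral>x. mode j x * mode k x \<partial>space_measure) = (if j = k then 1 else 0)"
proof -
  have "mode j x * mode k x
      = cos (of_int (int j - int k) * pi * x) - cos (of_int (int j + int k + 2) * pi * x)" for x
  proof -
    have "of_int (int j - int k) * pi * x = freq j * x - freq k * x"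
      "of_int (int j + int k + 2) * pi * x = freq j * x + freq k * x"
      by (simp_all add: algebra_simps)
    moreover have "mode j x * mode k x = (sqrt 2 * sqrt 2) * (sin (freq j * x) * sin (freq k * x))"
      by (simp add: mode_def del: real_sqrt_mult_self)
    ultimately show ?thesis by (simp only: cos_diff cos_add real_sqrt_mult_self)
  qed
  then have "(\<integral>x. mode j x * mode k x \<partial>space_measure) =
    (\<integral>x. cos (of_int (int j - int k) * pi * x) \<partial>space_measure)
    - (\<integral>x. cos (of_int (int j + int k + 2) * pi * x) \<partial>space_measure)"
    by (simp only:) (intro Bochner_Integration.integral_diff integrable_continuous_interval continuous_intros)
  also have "\<dots> = (if j = k then 1 else 0)"
    unfolding integral_cos_int by auto
  finally show ?thesis .
qed

definition sine_polynomial :: "(real \<Rightarrow> real) \<Rightarrow> bool" where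
  "sine_polynomial f \<longleftrightarrow> (\<exists>N c. \<forall>x. f x = (\<Sum>k<N. c k * mode k x))"

lemma sine_polynomial_mode: "sine_polynomial (\<lambda>x. a * mode k x)"
  unfolding sine_polynomial_def
  by (intro exI[of _ "Suc k"] exI[of _ "\<lambda>j. if j = k then a else 0"])
     (simp add: if_distrib[of "\<lambda>c. c * _"] cong: if_cong)

lemma sine_polynomial_add:
  assumes "sine_polynomial f" "sine_polynomial g"
  shows "sine_polynomial (\<lambda>x. f x + g x)"
proof -
  obtain N c where f: "f x = (\<Sum>k<N. c k * mode k x)" for x
    using assms(1) unfolding sine_polynomial_def by blast
  obtain M d where g: "g x = (\<Sum>k<M. d k * mode k x)" for x
    using assms(2) unfolding sine_polynomial_def by blast
  have pad: "(\<Sum>k<K. c k * mode k x) = (\<Sum>k<max N M. (if k < K then c k else 0) * mode k x)"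
    if "K \<le> max N M" for K x and c :: "nat \<Rightarrow> real"
    using that by (intro sum.mono_neutral_cong_left) auto
  have "f x + g x = (\<Sum>k<max N M. ((if k < N then c k else 0) + (if k < M then d k else 0)) * mode k x)" for x
    using pad[of N c x] pad[of M d x] f g by (simp add: sum.distrib distrib_right)
  then show ?thesis unfolding sine_polynomial_def by (intro exI allI)
qed

lemma sine_polynomial_sum:
  "(\<And>i. i \<in> I \<Longrightarrow> sine_polynomial (f i)) \<Longrightarrow> sine_polynomial (\<lambda>x. \<Sum>i\<in>I. f i x)"
  using sine_polynomial_mode[of 0 0]
  by (induction I rule: infinite_finite_induct) (auto intro: sine_polynomial_add)

lemma sine_polynomial_cmult: "sine_polynomial f \<Longrightarrow> sine_polynomial (\<lambda>x. a * f x)"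
proof -
  assume "sine_polynomial f"
  then obtain N c where f: "f x = (\<Sum>k<N. c k * mode k x)" for x
    unfolding sine_polynomial_def by blast
  then have "a * f x = (\<Sum>k<N. (a * c k) * mode k x)" for x
    by (simp add: sum_distrib_left mult.assoc)
  then show ?thesis unfolding sine_polynomial_def by (intro exI allI)
qed

text \<open>Multiplication by \<open>cos (\<pi> x)\<close> shifts the modes, so that sine polynomials contain all
  products of \<open>sin (\<pi> x)\<close> with a polynomial in \<open>cos (\<pi> x)\<close>. As \<open>cos (\<pi> \<cdot>)\<close> is injective on
  \<open>[0,1]\<close>, the Weierstrass theorem applies to these polynomials.\<close>

lemma sine_polynomial_mult_cos:
  assumes "sine_polynomial f"
  shows "sine_polynomial (\<lambda>x. f x * cos (pi * x))"
proof -
  have shift: "sine_polynomial (\<lambda>x. a * mode k x * cos (pi * x))" for a k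
  proof -
    have up: "mode k x * cos (pi * x) = mode (Suc k) x / 2 + sqrt 2 * sin (real k * pi * x) / 2" for x
    proof -
      have "freq (Suc k) * x = freq k * x + pi * x" "real k * pi * x = freq k * x - pi * x"
        by (simp_all add: algebra_simps)
      then show ?thesis by (simp only: mode_def sin_add sin_diff) (simp add: field_simps)
    qed
    show ?thesis
    proof (cases k)
      case 0
      have "(\<lambda>x. a * mode k x * cos (pi * x)) = (\<lambda>x. (a/2) * mode (Suc k) x)"
        using up 0 by (simp add: fun_eq_iff mult.assoc)
      then show ?thesis using sine_polynomial_mode[of "a/2" "Suc k"] by (simp only:)
    next
      case (Suc j)
      have "(\<lambda>x. a * mode k x * cos (pi * x)) = (\<lambda>x. (a/2) * mode (Suc k) x + (a/2) * mode j x)"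
      proof
        fix x
        have "sqrt 2 * sin (real k * pi * x) = mode j x" using Suc by (simp add: mode_def)
        then have "mode k x * cos (pi * x) = mode (Suc k) x / 2 + mode j x / 2" using up[of x] by simp
        then show "a * mode k x * cos (pi * x) = (a/2) * mode (Suc k) x + (a/2) * mode j x"
          by (simp only: mult.assoc) (simp add: algebra_simps)
      qed
      then show ?thesis
        using sine_polynomial_add[OF sine_polynomial_mode[of "a/2" "Suc k"] sine_polynomial_mode[of "a/2" j]]
        by (simp only:)
    qed
  qed
  obtain N c where f: "f x = (\<Sum>k<N. c k * mode k x)" for x
    using assms(1) unfolding sine_polynomial_def by blast
  have "(\<lambda>x. f x * cos (pi * x)) = (\<lambda>x. \<Sum>k<N. c k * mode k x * cos (pi * x))"
    by (simp add: f sum_distrib_right)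
  then show ?thesis using sine_polynomial_sum[OF shift] by simp
qed

lemma sine_polynomial_sin_times_cos_polynomial:
  "sine_polynomial (\<lambda>x. sin (pi * x) * (\<Sum>i\<le>n. a i * cos (pi * x) ^ i))"
proof -
  have "sine_polynomial (\<lambda>x. sin (pi * x) * cos (pi * x) ^ i)" for i
  proof (induction i)
    case 0
    have "(\<lambda>x. sin (pi * x)) = (\<lambda>x. (1 / sqrt 2) * mode 0 x)"
      by (simp add: mode_def)
    then show ?case using sine_polynomial_mode[of "1 / sqrt 2" 0] by simp
  next
    case (Suc i)
    show ?case using sine_polynomial_mult_cos[OF Suc] by (simp add: mult_ac)
  qed
  then have "sine_polynomial (\<lambda>x. \<Sum>i\<le>n. a i * (sin (pi * x) * cos (pi * x) ^ i))"
    by (intro sine_polynomial_sum sine_polynomial_cmult)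
  then show ?thesis by (simp add: sum_distrib_left mult_ac)
qed

definition sine_approximable :: "(real \<Rightarrow> real) \<Rightarrow> bool" where
  "sine_approximable f \<longleftrightarrow>
    f \<in> L2_unit \<and>
    (\<forall>\<epsilon>>0. \<exists>p. sine_polynomial p \<and> norm_unit (\<lambda>x. f x - p x) < \<epsilon>)"

lemma sine_polynomial_L2: "sine_polynomial p \<Longrightarrow> p \<in> L2_unit"
proof -
  assume "sine_polynomial p"
  then obtain N c where p: "p = (\<lambda>x. \<Sum>k<N. c k * mode k x)"
    unfolding sine_polynomial_def fun_eq_iff by blast
  show ?thesis unfolding p by (intro L2_sum L2_cmult mode_L2)
qed

lemma sine_approximable_limit:
  assumes "\<And>n. sine_approximable (f n)" "F \<in> L2_unit"
    and "(\<lambda>n. norm_unit (\<lambda>x. f n x - F x)) \<longlonglongrightarrow> 0"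
  shows "sine_approximable F"
  unfolding sine_approximable_def
proof (intro conjI allI impI assms)
  fix \<epsilon> :: real assume "\<epsilon> > 0"
  then have "\<forall>\<^sub>F n in sequentially. norm_unit (\<lambda>x. f n x - F x) < \<epsilon>/2"
    by (intro order_tendstoD[OF assms(3)]) auto
  then obtain n where n: "norm_unit (\<lambda>x. f n x - F x) < \<epsilon>/2"
    unfolding eventually_sequentially by blast
  obtain p where p: "sine_polynomial p" "norm_unit (\<lambda>x. f n x - p x) < \<epsilon>/2"
    using assms(1)[of n] \<open>\<epsilon> > 0\<close> unfolding sine_approximable_def by (meson half_gt_zero)
  have "norm_unit (\<lambda>x. F x - p x)
      \<le> norm_unit (\<lambda>x. F x - f n x) + norm_unit (\<lambda>x. f n x - p x)"
    using assms(1)[of n] assms(2) sine_polynomial_L2[OF p(1)]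
    by (intro L2_triangle_diff) (auto simp: sine_approximable_def)
  also have "\<dots> < \<epsilon>"
    using n p(2) L2_norm_minus_commute[of space_measure F "f n"] by simp
  finally show "\<exists>p. sine_polynomial p \<and> norm_unit (\<lambda>x. F x - p x) < \<epsilon>"
    using p(1) by blast
qed

lemma sine_approximable_polynomial: "sine_polynomial p \<Longrightarrow> sine_approximable p"
  unfolding sine_approximable_def using sine_polynomial_L2 by (auto intro!: exI[of _ p])

text \<open>On \<open>[0,1]\<close> the factor \<open>g\<close> is a continuous function of \<open>cos (\<pi> x)\<close>, which polynomials approximate
  uniformly.\<close>

lemma sine_approximable_sin_times_continuous:
  assumes "continuous_on UNIV g"
  shows "sine_approximable (\<lambda>x. sin (pi * x) * g x)"
proof -
  define h where "h z = g (arccos z / pi)" for z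
  have "continuous_on {-1..1} h"
    unfolding h_def
    by (intro continuous_on_compose2[OF assms] continuous_intros continuous_on_arccos') auto
  then have "\<exists>q. real_polynomial_function q \<and> (\<forall>z\<in>{-1..1}. \<bar>h z - q z\<bar> < 1 / real (Suc n))" for n
    using Stone_Weierstrass_real_polynomial_function[of "{-1..1}" h "1 / real (Suc n)"]
    by (metis compact_Icc divide_pos_pos of_nat_0_less_iff zero_less_Suc zero_less_one)
  then obtain q where q: "\<And>n. real_polynomial_function (q n)"
    "\<And>n z. z \<in> {-1..1} \<Longrightarrow> \<bar>h z - q n z\<bar> < 1 / real (Suc n)"
    by metis
  define f where "f n x = sin (pi * x) * q n (cos (pi * x))" for n x
  have f: "sine_polynomial (f n)" for n
  proof -
    obtain a m where "q n = (\<lambda>x. \<Sum>i\<le>m. a i * x^i)"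
      using q(1)[of n] unfolding real_polynomial_function_iff_sum by (metis (no_types))
    then have "f n = (\<lambda>x. sin (pi * x) * (\<Sum>i\<le>m. a i * cos (pi * x) ^ i))"
      by (simp add: f_def[abs_def])
    then show ?thesis using sine_polynomial_sin_times_cos_polynomial by simp
  qed
  have err: "\<bar>f n x - sin (pi * x) * g x\<bar> \<le> 1 / real (Suc n)" if "0 < x" "x < 1" for n x
  proof -
    have "h (cos (pi * x)) = g x"
      using that by (simp add: h_def arccos_cos)
    then have "\<bar>q n (cos (pi * x)) - g x\<bar> \<le> 1 / real (Suc n)"
      using q(2)[of "cos (pi * x)" n] by auto
    then have "\<bar>sin (pi * x)\<bar> * \<bar>q n (cos (pi * x)) - g x\<bar> \<le> 1 * (1 / real (Suc n))"
      by (intro mult_mono) auto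
    then show ?thesis by (simp add: f_def abs_mult flip: right_diff_distrib)
  qed
  have cont: "continuous_on S (\<lambda>x. sin (pi * x) * g x)" for S
    by (intro continuous_intros continuous_on_subset[OF assms]) auto
  show ?thesis
  proof (rule sine_approximable_limit[of f])
    show "(\<lambda>x. sin (pi * x) * g x) \<in> L2_unit"
      by (rule L2_continuous_interval[OF cont])
    show "(\<lambda>n. norm_unit (\<lambda>x. f n x - sin (pi * x) * g x)) \<longlonglongrightarrow> 0"
    proof (rule L2_dominated_convergence[where h = "\<lambda>_. 1"])
      show "(\<lambda>_. 1) \<in> L2_unit"
        by (rule L2_continuous_interval) simp
      show "f n \<in> borel_measurable space_measure" for n
        using sine_polynomial_L2[OF f] by (simp add: L2_space_def)
      show "(\<lambda>x. sin (pi * x) * g x) \<in> borel_measurable space_measure"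
        by (rule continuous_on_borel_measurable_interval[OF cont])
      show "AE x in space_measure. (\<lambda>n. f n x) \<longlonglongrightarrow> sin (pi * x) * g x"
      proof (rule AE_interval)
        fix x :: real assume "0 < x" "x < 1"
        then show "(\<lambda>n. f n x) \<longlonglongrightarrow> sin (pi * x) * g x"
          using err
          by (intro LIM_zero_cancel[OF Lim_null_comparison[OF always_eventually LIMSEQ_inverse_real_of_nat]])
             (simp add: inverse_eq_divide)
      qed
      show "AE x in space_measure. \<bar>f n x - sin (pi * x) * g x\<bar> \<le> \<bar>1\<bar>" for n
      proof (rule AE_interval)
        fix x :: real assume "0 < x" "x < 1"
        from err[OF this, of n] show "\<bar>f n x - sin (pi * x) * g x\<bar> \<le> \<bar>1\<bar>"
          by (rule order_trans) simp
      qed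
    qed
  qed (use f sine_approximable_polynomial in auto)
qed

text \<open>A bounded measurable function is the almost everywhere limit of continuous functions \<open>g n\<close>;
  multiplying them by \<open>sin (\<pi> x) / (sin (\<pi> x) + \<epsilon>)\<close> with small \<open>\<epsilon>\<close> produces the factor \<open>sin (\<pi> x)\<close>.\<close>

lemma sine_approximable_bounded:
  assumes "f \<in> borel_measurable space_measure" "\<And>x. \<bar>f x\<bar> \<le> B"
  shows "sine_approximable f"
proof -
  have B: "0 \<le> B" using assms(2)[of 0] by linarith
  have "(\<lambda>x. if x \<in> {0<..<1} then f x else 0) \<in> borel_measurable lebesgue"
    using assms(1) by (subst borel_measurable_if) auto
  then have "(\<lambda>x. if x \<in> {0<..<1} then f x else 0) measurable_on UNIV"
    by (intro lebesgue_measurable_imp_measurable_on_real) auto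
  then obtain N g where N: "negligible N" and g: "\<And>n. continuous_on UNIV (g n :: real \<Rightarrow> real)"
    and lim: "\<And>x. x \<notin> N \<Longrightarrow> (\<lambda>n. g n x) \<longlonglongrightarrow> (if x \<in> {0<..<1} then f x else 0)"
    unfolding measurable_on_def by auto
  define G where "G n x = max (- B) (min B (g n x)) / (\<bar>sin (pi * x)\<bar> + 1 / real (Suc n))" for n x
  have pos: "\<bar>sin (pi * x)\<bar> + 1 / real (Suc n) > 0" for n x
    by (intro add_nonneg_pos) auto
  have G: "continuous_on UNIV (G n)" for n
    unfolding G_def[abs_def] using pos by (intro continuous_intros g) (auto simp: less_imp_neq[symmetric])
  have "AE x in lebesgue. x \<notin> N"
    using N by (simp add: negligible_iff_null_sets AE_not_in)
  then have notN: "AE x in space_measure. x \<in> {0<..<1} \<and> x \<notin> N"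
    by (subst AE_restrict_space_iff) (auto elim: eventually_mono)
  show ?thesis
  proof (rule sine_approximable_limit[of "\<lambda>n x. sin (pi * x) * G n x"])
    show "sine_approximable (\<lambda>x. sin (pi * x) * G n x)" for n
      by (rule sine_approximable_sin_times_continuous[OF G])
    show "f \<in> L2_unit"
      using assms by (intro L2_bounded[OF finite_measure_interval, of _ _ _ B]) auto
    show "(\<lambda>n. norm_unit (\<lambda>x. sin (pi * x) * G n x - f x)) \<longlonglongrightarrow> 0"
    proof (rule L2_dominated_convergence[where h = "\<lambda>_. 2 * B"])
      show "(\<lambda>_. 2 * B) \<in> L2_unit"
        by (rule L2_continuous_interval) simp
      show "(\<lambda>x. sin (pi * x) * G n x) \<in> borel_measurable space_measure" for n
        by (intro continuous_on_borel_measurable_interval continuous_intros continuous_on_subset[OF G]) auto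
      show "AE x in space_measure. (\<lambda>n. sin (pi * x) * G n x) \<longlonglongrightarrow> f x"
        using notN
      proof eventually_elim
        case (elim x)
        then have s: "sin (pi * x) > 0"
          using sin_gt_zero[of "pi * x"] by simp
        have "(\<lambda>n. sin (pi * x) * (max (- B) (min B (g n x)) / (\<bar>sin (pi * x)\<bar> + inverse (real (Suc n)))))
          \<longlonglongrightarrow> sin (pi * x) * (max (- B) (min B (f x)) / (\<bar>sin (pi * x)\<bar> + 0))"
          using elim s lim[of x] LIMSEQ_inverse_real_of_nat by (intro tendsto_intros) auto
        moreover have "max (- B) (min B (f x)) = f x"
          using assms(2)[of x] by (auto simp: abs_le_iff)
        ultimately show ?case using s by (simp add: G_def inverse_eq_divide)
      qed
      show "AE x in space_measure. \<bar>sin (pi * x) * G n x - f x\<bar> \<le> \<bar>2 * B\<bar>" for n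
      proof (rule always_eventually, rule allI)
        fix x
        have "\<bar>max (- B) (min B (g n x))\<bar> \<le> B" using B by auto
        then have "\<bar>sin (pi * x)\<bar> * \<bar>max (- B) (min B (g n x))\<bar>
            \<le> (\<bar>sin (pi * x)\<bar> + 1 / real (Suc n)) * B"
          by (intro mult_mono) auto
        then have "\<bar>sin (pi * x) * G n x\<bar> \<le> B"
          using pos[of x n] by (simp add: G_def abs_mult pos_divide_le_eq mult.commute)
        then show "\<bar>sin (pi * x) * G n x - f x\<bar> \<le> \<bar>2 * B\<bar>"
          using assms(2)[of x] by linarith
      qed
    qed (use assms in auto)
  qed
qed

text \<open>Truncation reduces the claim to bounded functions.\<close>

lemma sine_approximable_L2:
  assumes "f \<in> L2_unit"
  shows "sine_approximable f"
proof (rule sine_approximable_limit[of "\<lambda>n x. max (- real n) (min (real n) (f x))"])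
  note [measurable] = L2_measurable[OF assms]
  show "sine_approximable (\<lambda>x. max (- real n) (min (real n) (f x)))" for n
    by (rule sine_approximable_bounded[of _ "real n"]) auto
  show "(\<lambda>n. norm_unit (\<lambda>x. max (- real n) (min (real n) (f x)) - f x)) \<longlonglongrightarrow> 0"
  proof (rule L2_dominated_convergence[where h = f])
    show "AE x in space_measure. (\<lambda>n. max (- real n) (min (real n) (f x))) \<longlonglongrightarrow> f x"
    proof (rule always_eventually, rule allI)
      fix x
      obtain m where "\<bar>f x\<bar> < real m" using reals_Archimedean2 by blast
      then have "\<forall>\<^sub>F n in sequentially. f x = max (- real n) (min (real n) (f x))"
        by (intro eventually_mono[OF eventually_ge_at_top[of m]]) (auto simp: max_def min_def)
      then show "(\<lambda>n. max (- real n) (min (real n) (f x))) \<longlonglongrightarrow> f x"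
        by (rule Lim_transform_eventually[OF tendsto_const])
    qed
  qed (use assms in auto)
qed (rule assms)

text \<open>Completing squares: among all combinations of finitely many modes, the one with the Fourier
  coefficients of \<open>f\<close> is closest to \<open>f\<close>.\<close>

lemma L2_distance_sine_sum:
  assumes "f \<in> L2_unit"
  shows "(norm_unit (\<lambda>x. f x - (\<Sum>k<N. c k * mode k x)))\<^sup>2 =
    (norm_unit f)\<^sup>2 - (\<Sum>k<N. (mode_coeff f k)\<^sup>2) + (\<Sum>k<N. (c k - mode_coeff f k)\<^sup>2)"
proof (induction N)
  case (Suc N)
  define g where "g x = f x - (\<Sum>k<N. c k * mode k x)" for x
  have g: "g \<in> L2_unit"
    unfolding g_def[abs_def] by (intro L2_diff assms L2_sum L2_cmult mode_L2)
  have "(\<integral>x. g x * mode N x \<partial>space_measure) =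
      (\<integral>x. f x * mode N x - (\<Sum>k<N. c k * (mode k x * mode N x)) \<partial>space_measure)"
    by (simp add: g_def left_diff_distrib sum_distrib_right mult.assoc)
  also have "\<dots> = mode_coeff f N - (\<Sum>k<N. c k * (if k = N then 1 else 0))"
    using assms by (simp add: L2_integrable_mult mode_L2 mode_coeff_def mode_orthonormal)
  also have "\<dots> = mode_coeff f N" by simp
  finally have inner: "(\<integral>x. g x * mode N x \<partial>space_measure) = mode_coeff f N" .
  have "(norm_unit (mode N))\<^sup>2 = 1"
    unfolding L2_norm_sq using mode_orthonormal[of N N] by (simp add: power2_eq_square)
  then have "(norm_unit (\<lambda>x. g x + (- c N) * mode N x))\<^sup>2 =
      (norm_unit g)\<^sup>2 + 2 * (- c N) * mode_coeff f N + (c N)\<^sup>2"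
    using L2_norm_sq_expand[OF g mode_L2(1), of "- c N" N] inner by simp
  moreover have "(\<lambda>x. f x - (\<Sum>k<Suc N. c k * mode k x)) = (\<lambda>x. g x + (- c N) * mode N x)"
    by (simp add: g_def fun_eq_iff)
  ultimately show ?case
    unfolding Suc[folded g_def[abs_def]] by (simp add: Suc[folded g_def[abs_def]] power2_diff)
qed simp

text \<open>Bessel's inequality bounds the partial sums. They come arbitrarily close to the bound because some
  sine polynomial is close to \<open>f\<close>, and the Fourier sum with as many modes is at least as close.\<close>

theorem Parseval:
  assumes "f \<in> L2_unit"
  shows "(\<lambda>k. (mode_coeff f k)\<^sup>2) sums (norm_unit f)\<^sup>2"
  unfolding sums_def
proof (rule metric_LIMSEQ_I)
  fix r :: real assume "r > 0"
  define n2 where "n2 = (norm_unit f)\<^sup>2"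
  have bessel: "(\<Sum>k<n. (mode_coeff f k)\<^sup>2) \<le> n2" for n
    using L2_distance_sine_sum[OF assms, where N = n and c = "mode_coeff f"]
      zero_le_power2[of "norm_unit (\<lambda>x. f x - (\<Sum>k<n. mode_coeff f k * mode k x))"]
    by (simp add: n2_def)
  obtain p where p: "sine_polynomial p" "norm_unit (\<lambda>x. f x - p x) < sqrt r"
    using sine_approximable_L2[OF assms] \<open>r > 0\<close>
    unfolding sine_approximable_def by (meson real_sqrt_gt_0_iff)
  then obtain N c where "p = (\<lambda>x. \<Sum>k<N. c k * mode k x)"
    unfolding sine_polynomial_def fun_eq_iff by blast
  then have "(norm_unit (\<lambda>x. f x - (\<Sum>k<N. c k * mode k x)))\<^sup>2 < (sqrt r)\<^sup>2"
    using p(2) by (intro power_strict_mono) auto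
  then have "n2 - (\<Sum>k<N. (mode_coeff f k)\<^sup>2) + (\<Sum>k<N. (c k - mode_coeff f k)\<^sup>2) < r"
    using L2_distance_sine_sum[OF assms] \<open>r > 0\<close> by (simp add: n2_def)
  moreover have "0 \<le> (\<Sum>k<N. (c k - mode_coeff f k)\<^sup>2)"
    by (intro sum_nonneg) auto
  ultimately have N: "n2 - (\<Sum>k<N. (mode_coeff f k)\<^sup>2) < r" by linarith
  show "\<exists>N. \<forall>n\<ge>N. dist (\<Sum>k<n. (mode_coeff f k)\<^sup>2) ((norm_unit f)\<^sup>2) < r"
  proof (intro exI allI impI)
    fix n assume "N \<le> n"
    then have "(\<Sum>k<N. (mode_coeff f k)\<^sup>2) \<le> (\<Sum>k<n. (mode_coeff f k)\<^sup>2)"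
      by (intro sum_mono2) auto
    then show "dist (\<Sum>k<n. (mode_coeff f k)\<^sup>2) ((norm_unit f)\<^sup>2) < r"
      using N bessel[of n] by (simp add: dist_real_def n2_def)
  qed
qed

lemma L2_zero_if_mode_coeffs_zero:
  assumes "f \<in> L2_unit" "\<And>k. mode_coeff f k = 0"
  shows "AE x in space_measure. f x = 0"
proof -
  have "(norm_unit f)\<^sup>2 = 0"
    using sums_unique[OF Parseval[OF assms(1)]] assms(2) by simp
  then show ?thesis using L2_norm_eq_0_AE[OF assms(1)] by simp
qed


section \<open>Weak derivatives and \<open>H\<^sub>0\<^sup>1(0,1)\<close>\<close>

text \<open>The modes are even or odd about \<open>1/2\<close>, so estimates near \<open>0\<close> carry over to \<open>1\<close>.\<close>

lemma mode_reflect: "\<bar>mode k (1 - x)\<bar> = \<bar>mode k x\<bar>"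
proof -
  have "freq k * (1 - x) = real (Suc k) * pi - freq k * x" by (simp add: algebra_simps)
  then have "mode k (1 - x) = sqrt 2 * (sin (real (Suc k) * pi) * cos (freq k * x)
      - cos (real (Suc k) * pi) * sin (freq k * x))"
    by (simp only: mode_def sin_diff)
  moreover have "\<bar>cos (real (Suc k) * pi)\<bar> = 1"
    by (simp only: cos_npi) (simp add: power_abs)
  ultimately show ?thesis
    by (simp only: sin_npi) (simp add: mode_def abs_mult)
qed

lemma mode_vanishes_linearly: "\<bar>mode k x\<bar> \<le> sqrt 2 * freq k * \<bar>x\<bar>"
  using abs_sin_x_le_abs_x[of "freq k * x"] by (simp add: mode_def abs_mult mult.assoc mult_left_mono)

lemma cutoff'_mult_mode_bound:
  "\<bar>cutoff' 0 1 n x * mode k x\<bar> \<le> sqrt 2 * freq k *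
     (\<bar>(real n * x - 1 + 1) * ramp' (real n * x - 1)\<bar>
      + \<bar>(real n * (1 - x) - 1 + 1) * ramp' (real n * (1 - x) - 1)\<bar>)"
proof -
  have one: "\<bar>real n * ramp' (real n * z - 1) * ramp w * mode k x\<bar>
      \<le> sqrt 2 * freq k * \<bar>(real n * z - 1 + 1) * ramp' (real n * z - 1)\<bar>"
    if "\<bar>mode k x\<bar> \<le> sqrt 2 * freq k * \<bar>z\<bar>" for z w
  proof -
    have "\<bar>real n * ramp' (real n * z - 1)\<bar> * (ramp w * \<bar>mode k x\<bar>)
        \<le> \<bar>real n * ramp' (real n * z - 1)\<bar> * (1 * (sqrt 2 * freq k * \<bar>z\<bar>))"
      using that ramp_bounds by (intro mult_left_mono mult_mono) auto
    then show ?thesis using ramp_bounds by (simp add: abs_mult mult_ac)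
  qed
  have "\<bar>cutoff' 0 1 n x * mode k x\<bar> \<le>
    \<bar>real n * ramp' (real n * x - 1) * ramp (real n * (1 - x) - 1) * mode k x\<bar>
    + \<bar>real n * ramp' (real n * (1 - x) - 1) * ramp (real n * x - 1) * mode k x\<bar>"
    unfolding cutoff'_def by (simp add: left_diff_distrib abs_triangle_ineq4)
  also have "\<dots> \<le> sqrt 2 * freq k * \<bar>(real n * x - 1 + 1) * ramp' (real n * x - 1)\<bar>
      + sqrt 2 * freq k * \<bar>(real n * (1 - x) - 1 + 1) * ramp' (real n * (1 - x) - 1)\<bar>"
    using mode_vanishes_linearly[of k x] mode_vanishes_linearly[of k "1 - x"]
    by (intro add_mono one) (simp_all add: mode_reflect)
  finally show ?thesis by (simp only: distrib_left)
qed

lemma smooth_mode: "smooth (mode k)"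
proof -
  have "smooth (\<lambda>x. sqrt 2 * sin (freq k * x))"
    by (intro smooth_mult smooth_const smooth_sin)
  then show ?thesis by (simp add: mode_def[abs_def])
qed

lemma cutoff_mode_test_function: "(\<lambda>x. cutoff 0 1 n x * mode k x) \<in> test_functions 0 1"
  by (rule smooth_cutoff_in_test_functions[OF smooth_mode])

lemma cutoff_mode_deriv:
  "deriv (\<lambda>x. cutoff 0 1 n x * mode k x) = (\<lambda>x. cutoff' 0 1 n x * mode k x + cutoff 0 1 n x * mode' k x)"
proof
  fix x
  show "deriv (\<lambda>x. cutoff 0 1 n x * mode k x) x = cutoff' 0 1 n x * mode k x + cutoff 0 1 n x * mode' k x"
    using DERIV_mult[OF cutoff_DERIV[of 0 1 n x] mode_DERIV[of k x]]
    by (intro DERIV_imp_deriv) (simp add: algebra_simps)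
qed

lemma cutoff_mode_tendsto:
  "(\<lambda>n. norm_unit (\<lambda>x. cutoff 0 1 n x * mode k x - mode k x)) \<longlonglongrightarrow> 0"
proof (rule L2_dominated_convergence[where h = "\<lambda>_. 1 * sqrt 2"])
  show "AE x in space_measure. (\<lambda>n. cutoff 0 1 n x * mode k x) \<longlonglongrightarrow> mode k x"
  proof (rule AE_interval)
    fix x :: real assume "0 < x" "x < 1"
    then have "(\<lambda>n. cutoff 0 1 n x * mode k x) \<longlonglongrightarrow> 1 * mode k x"
      by (intro tendsto_mult cutoff_tendsto tendsto_const) auto
    then show "(\<lambda>n. cutoff 0 1 n x * mode k x) \<longlonglongrightarrow> mode k x" by simp
  qed
  show "AE x in space_measure. \<bar>cutoff 0 1 n x * mode k x - mode k x\<bar> \<le> \<bar>1 * sqrt 2\<bar>" for n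
  proof (rule always_eventually, rule allI)
    fix x
    have "\<bar>cutoff 0 1 n x - 1\<bar> * \<bar>mode k x\<bar> \<le> 1 * sqrt 2"
      using cutoff_bounds[of 0 1 n x] mode_bounds(1) by (intro mult_mono) auto
    then show "\<bar>cutoff 0 1 n x * mode k x - mode k x\<bar> \<le> \<bar>1 * sqrt 2\<bar>"
      by (simp add: left_diff_distrib flip: abs_mult)
  qed
qed (auto intro: L2_const)

text \<open>The term with \<open>cutoff'\<close> is bounded and tends to zero pointwise because the modes vanish linearly at
  both end points.\<close>

lemma cutoff_mode_deriv_tendsto:
  "(\<lambda>n. norm_unit (\<lambda>x. deriv (\<lambda>x. cutoff 0 1 n x * mode k x) x - mode' k x)) \<longlonglongrightarrow> 0"
  unfolding cutoff_mode_deriv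
proof -
  define W where "W z = \<bar>(z + 1) * ramp' z\<bar>" for z
  obtain C where C: "\<And>z. W z \<le> C"
    using weighted_ramp'_bounded unfolding W_def by metis
  have W: "(\<lambda>n. W (real n * c - 1)) \<longlonglongrightarrow> 0" if "c > 0" for c
    unfolding W_def
  proof (intro tendsto_rabs_zero filterlim_compose[OF weighted_ramp'_at_top])
    show "filterlim (\<lambda>n. real n * c - 1) at_top sequentially" using that by real_asymp
  qed
  have bound: "\<bar>cutoff' 0 1 n x * mode k x\<bar>
      \<le> sqrt 2 * freq k * (W (real n * x - 1) + W (real n * (1 - x) - 1))" for n x
    unfolding W_def by (rule cutoff'_mult_mode_bound)
  show "(\<lambda>n. norm_unit
      (\<lambda>x. cutoff' 0 1 n x * mode k x + cutoff 0 1 n x * mode' k x - mode' k x)) \<longlonglongrightarrow> 0"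
  proof (rule L2_dominated_convergence[where h = "\<lambda>_. sqrt 2 * freq k * (C + C) + 1 * (sqrt 2 * freq k)"])
    show "AE x in space_measure.
      (\<lambda>n. cutoff' 0 1 n x * mode k x + cutoff 0 1 n x * mode' k x) \<longlonglongrightarrow> mode' k x"
    proof (rule AE_interval)
      fix x :: real assume x: "0 < x" "x < 1"
      then have "(\<lambda>n. sqrt 2 * freq k * (W (real n * x - 1) + W (real n * (1 - x) - 1)))
          \<longlonglongrightarrow> sqrt 2 * freq k * (0 + 0)"
        by (intro tendsto_mult[OF tendsto_const] tendsto_add W) auto
      then have lim0: "(\<lambda>n. sqrt 2 * freq k * (W (real n * x - 1) + W (real n * (1 - x) - 1))) \<longlonglongrightarrow> 0"
        by simp
      have "(\<lambda>n. cutoff' 0 1 n x * mode k x) \<longlonglongrightarrow> 0"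
        by (rule Lim_null_comparison[OF always_eventually lim0]) (use bound in simp)
      moreover have "(\<lambda>n. cutoff 0 1 n x * mode' k x) \<longlonglongrightarrow> 1 * mode' k x"
        using x by (intro tendsto_mult cutoff_tendsto tendsto_const) auto
      ultimately have "(\<lambda>n. cutoff' 0 1 n x * mode k x + cutoff 0 1 n x * mode' k x) \<longlonglongrightarrow> 0 + 1 * mode' k x"
        by (rule tendsto_add)
      then show "(\<lambda>n. cutoff' 0 1 n x * mode k x + cutoff 0 1 n x * mode' k x) \<longlonglongrightarrow> mode' k x"
        by simp
    qed
    show "AE x in space_measure. \<bar>cutoff' 0 1 n x * mode k x + cutoff 0 1 n x * mode' k x - mode' k x\<bar>
        \<le> \<bar>sqrt 2 * freq k * (C + C) + 1 * (sqrt 2 * freq k)\<bar>" for n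
    proof (rule always_eventually, rule allI)
      fix x
      have "\<bar>cutoff 0 1 n x - 1\<bar> * \<bar>mode' k x\<bar> \<le> 1 * (sqrt 2 * freq k)"
        using cutoff_bounds[of 0 1 n x] mode_bounds(2) by (intro mult_mono) auto
      then have "\<bar>cutoff 0 1 n x * mode' k x - mode' k x\<bar> \<le> 1 * (sqrt 2 * freq k)"
        by (simp add: left_diff_distrib flip: abs_mult)
      moreover have "\<bar>cutoff' 0 1 n x * mode k x\<bar> \<le> sqrt 2 * freq k * (C + C)"
        by (rule order_trans[OF bound]) (intro mult_left_mono add_mono C, auto)
      ultimately show "\<bar>cutoff' 0 1 n x * mode k x + cutoff 0 1 n x * mode' k x - mode' k x\<bar>
        \<le> \<bar>sqrt 2 * freq k * (C + C) + 1 * (sqrt 2 * freq k)\<bar>"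
        by linarith
    qed
  qed (auto intro: L2_const)
qed

text \<open>The fundamental lemma of the calculus of variations. Cut-off modes are test functions and converge
  to the modes, so all sine coefficients of \<open>g\<close> vanish.\<close>

lemma AE_zero_if_orthogonal_to_test_functions:
  assumes "g \<in> L2_unit"
    and "\<And>\<phi>. \<phi> \<in> test_functions 0 1 \<Longrightarrow> (\<integral>x. g x * \<phi> x \<partial>space_measure) = 0"
  shows "AE x in space_measure. g x = 0"
proof (rule L2_zero_if_mode_coeffs_zero[OF assms(1)])
  fix k
  have "(\<lambda>n. \<integral>x. (cutoff 0 1 n x * mode k x) * g x \<partial>space_measure) \<longlonglongrightarrow> (\<integral>x. mode k x * g x \<partial>space_measure)"
    by (intro L2_inner_tendsto cutoff_mode_tendsto assms(1) mode_L2
        test_function_L2(1)[OF cutoff_mode_test_function])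
  moreover have "(\<integral>x. (cutoff 0 1 n x * mode k x) * g x \<partial>space_measure) = 0" for n
    using assms(2)[OF cutoff_mode_test_function] by (simp add: mult.commute)
  ultimately show "mode_coeff g k = 0"
    by (simp add: mode_coeff_def mult.commute LIMSEQ_const_iff)
qed

lemma is_weak_deriv_combination:
  assumes "v \<in> L2_unit" "g \<in> L2_unit" "is_weak_deriv v g"
    and "w \<in> L2_unit" "h \<in> L2_unit" "is_weak_deriv w h"
  shows "is_weak_deriv (\<lambda>x. a * v x + b * w x) (\<lambda>x. a * g x + b * h x)"
  unfolding is_weak_deriv_def
proof
  fix \<phi> assume phi: "\<phi> \<in> test_functions 0 1"
  have *: "(\<integral>x. (a * f x + b * f' x) * \<psi> x \<partial>space_measure)
      = a * (\<integral>x. f x * \<psi> x \<partial>space_measure) + b * (\<integral>x. f' x * \<psi> x \<partial>space_measure)"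
    if "f \<in> L2_unit" "f' \<in> L2_unit" "\<psi> \<in> L2_unit" for f f' \<psi>
    using L2_integrable_mult[OF that(1,3)] L2_integrable_mult[OF that(2,3)]
    by (simp add: distrib_right mult.assoc)
  show "(\<integral>x. (a * v x + b * w x) * deriv \<phi> x \<partial>space_measure)
      = - (\<integral>x. (a * g x + b * h x) * \<phi> x \<partial>space_measure)"
    using assms(3,6) phi test_function_L2[OF phi] assms(1,2,4,5)
    by (simp add: * is_weak_deriv_def)
qed

lemma is_weak_deriv_unique:
  assumes "g \<in> L2_unit" "h \<in> L2_unit"
    and "is_weak_deriv v g" "is_weak_deriv v h"
  shows "AE x in space_measure. g x = h x"
proof -
  have "AE x in space_measure. g x - h x = 0"
  proof (rule AE_zero_if_orthogonal_to_test_functions)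
    fix \<phi> assume phi: "\<phi> \<in> test_functions 0 1"
    then have "(\<integral>x. g x * \<phi> x \<partial>space_measure) = (\<integral>x. h x * \<phi> x \<partial>space_measure)"
      using assms(3,4) by (simp add: is_weak_deriv_def)
    then show "(\<integral>x. (g x - h x) * \<phi> x \<partial>space_measure) = 0"
      using assms(1,2) test_function_L2(1)[OF phi] by (simp add: left_diff_distrib L2_integrable_mult)
  qed (intro L2_diff assms)
  then show ?thesis by simp
qed

lemma H1_weak_deriv:
  assumes "v \<in> H1"
  shows "v \<in> L2_unit" "weak_deriv v \<in> L2_unit"
    "is_weak_deriv v (weak_deriv v)"
proof -
  have "\<exists>g. g \<in> L2_unit \<and> is_weak_deriv v g"
    using assms by (auto simp: H1_def)
  from someI_ex[OF this] show "weak_deriv v \<in> L2_unit" "is_weak_deriv v (weak_deriv v)"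
    by (auto simp: weak_deriv_def)
  show "v \<in> L2_unit" using assms by (simp add: H1_def)
qed

lemma H1I:
  assumes "v \<in> L2_unit" "g \<in> L2_unit" "is_weak_deriv v g"
  shows "v \<in> H1" "AE x in space_measure. weak_deriv v x = g x"
proof -
  show H: "v \<in> H1" using assms by (auto simp: H1_def)
  show "AE x in space_measure. weak_deriv v x = g x"
    using is_weak_deriv_unique H1_weak_deriv[OF H] assms by blast
qed

lemma H1_norm_eq:
  assumes "v \<in> L2_unit" "g \<in> L2_unit" "is_weak_deriv v g"
  shows "H1_norm v = sqrt ((norm_unit v)\<^sup>2 + (norm_unit g)\<^sup>2)"
proof -
  have "norm_unit (weak_deriv v) = norm_unit g"
    using H1I(2)[OF assms] assms(2) H1_weak_deriv(2)[OF H1I(1)[OF assms]]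
    by (intro L2_norm_cong_AE) auto
  then show ?thesis by (simp add: H1_norm_def)
qed

lemma H1_norm_nonneg [simp]: "0 \<le> H1_norm v"
  by (simp add: H1_norm_def)

lemma L2_norm_le_H1_norm:
  "norm_unit v \<le> H1_norm v" "norm_unit (weak_deriv v) \<le> H1_norm v"
  unfolding H1_norm_def by (auto intro: real_le_rsqrt)

lemma test_function_H1:
  assumes "\<phi> \<in> test_functions 0 1"
  shows "is_weak_deriv \<phi> (deriv \<phi>)"
  unfolding is_weak_deriv_def
proof
  fix \<psi> assume psi: "\<psi> \<in> test_functions 0 1"
  have "(\<integral>x. deriv \<psi> x * \<phi> x \<partial>space_measure) = - (\<integral>x. \<psi> x * deriv \<phi> x \<partial>space_measure)"
    using smooth_DERIV[OF test_function_smooth[OF assms]] test_function_deriv_borel(2)[OF assms]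
    by (intro integral_by_parts_test_function[OF psi]) auto
  then show "(\<integral>x. \<phi> x * deriv \<psi> x \<partial>space_measure) = - (\<integral>x. deriv \<phi> x * \<psi> x \<partial>space_measure)"
    by (simp add: mult.commute)
qed

lemma mode_is_weak_deriv:
  "is_weak_deriv (mode k) (mode' k)"
  "is_weak_deriv (mode' k) (\<lambda>x. - ((freq k)\<^sup>2 * mode k x))"
proof -
  have "(\<integral>x. deriv \<psi> x * mode k x \<partial>space_measure) = - (\<integral>x. \<psi> x * mode' k x \<partial>space_measure)"
    "(\<integral>x. deriv \<psi> x * mode' k x \<partial>space_measure) = - (\<integral>x. \<psi> x * - ((freq k)\<^sup>2 * mode k x) \<partial>space_measure)"
    if psi: "\<psi> \<in> test_functions 0 1" for \<psi>
    by (rule integral_by_parts_test_function[OF psi _ mode_DERIV mode_continuous(2)], simp)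
       (rule integral_by_parts_test_function[OF psi _ mode'_DERIV], simp,
        intro continuous_intros mode_continuous)
  then show "is_weak_deriv (mode k) (mode' k)"
    "is_weak_deriv (mode' k) (\<lambda>x. - ((freq k)\<^sup>2 * mode k x))"
    unfolding is_weak_deriv_def by (simp_all add: mult.commute[of _ "deriv _ _"] mult.commute[of "mode' k _"]
        mult.commute[of _ "_ :: real"])
qed

lemma H1_diff_norm:
  assumes "v \<in> L2_unit" "g \<in> L2_unit" "is_weak_deriv v g"
    and "w \<in> L2_unit" "h \<in> L2_unit" "is_weak_deriv w h"
  shows "H1_norm (v - w) = sqrt ((norm_unit (\<lambda>x. v x - w x))\<^sup>2
    + (norm_unit (\<lambda>x. g x - h x))\<^sup>2)"
proof -
  have "is_weak_deriv (\<lambda>x. 1 * v x + (-1) * w x) (\<lambda>x. 1 * g x + (-1) * h x)"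
    by (rule is_weak_deriv_combination[OF assms])
  then have "is_weak_deriv (v - w) (\<lambda>x. g x - h x)"
    by (simp add: fun_diff_def)
  moreover have "v - w \<in> L2_unit"
    using L2_diff[OF assms(1,4)] by (simp add: fun_diff_def)
  ultimately have "H1_norm (v - w) = sqrt ((norm_unit (v - w))\<^sup>2
    + (norm_unit (\<lambda>x. g x - h x))\<^sup>2)"
    using L2_diff[OF assms(2,5)] by (intro H1_norm_eq)
  then show ?thesis by (simp add: fun_diff_def)
qed

lemma H10_L2:
  assumes "v \<in> H10"
  shows "v \<in> L2_unit" "weak_deriv v \<in> L2_unit"
    "is_weak_deriv v (weak_deriv v)"
  using assms H1_weak_deriv by (auto simp: H10_def)

text \<open>With uniqueness of weak derivatives, convergence in \<open>H1_norm\<close>, which involves a choice of the weak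
  derivative, becomes convergence of functions and of derivatives in \<open>L\<^sup>2\<close>.\<close>

lemma H10_approx:
  assumes "v \<in> H10"
  obtains \<phi> where "\<And>n. \<phi> n \<in> test_functions 0 1"
    "(\<lambda>n. norm_unit (\<lambda>x. \<phi> n x - v x)) \<longlonglongrightarrow> 0"
    "(\<lambda>n. norm_unit (\<lambda>x. deriv (\<phi> n) x - weak_deriv v x)) \<longlonglongrightarrow> 0"
proof -
  obtain \<phi> where phi: "\<And>n. \<phi> n \<in> test_functions 0 1" and lim: "(\<lambda>n. H1_norm (\<phi> n - v)) \<longlonglongrightarrow> 0"
    using assms by (auto simp: H10_def)
  have "H1_norm (\<phi> n - v) = sqrt ((norm_unit (\<lambda>x. \<phi> n x - v x))\<^sup>2
      + (norm_unit (\<lambda>x. deriv (\<phi> n) x - weak_deriv v x))\<^sup>2)" for n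
    by (intro H1_diff_norm test_function_L2[OF phi] test_function_H1[OF phi] H10_L2[OF assms])
  then have "norm_unit (\<lambda>x. \<phi> n x - v x) \<le> H1_norm (\<phi> n - v)"
    "norm_unit (\<lambda>x. deriv (\<phi> n) x - weak_deriv v x) \<le> H1_norm (\<phi> n - v)" for n
    by (auto intro: real_le_rsqrt)
  then show thesis
    using phi by (intro that[of \<phi>] tendsto_0_le[OF lim, of _ 1] always_eventually allI) auto
qed

text \<open>The defining identity of the weak derivative passes to the limit, so an approximating sequence of test
  functions reveals the weak derivative along with membership in \<open>H\<^sub>0\<^sup>1\<close>.\<close>

lemma H10I:
  assumes v: "v \<in> L2_unit" and g: "g \<in> L2_unit"
    and phi: "\<And>n. \<phi> n \<in> test_functions 0 1"
    and lim: "(\<lambda>n. norm_unit (\<lambda>x. \<phi> n x - v x)) \<longlonglongrightarrow> 0"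
    and lim': "(\<lambda>n. norm_unit (\<lambda>x. deriv (\<phi> n) x - g x)) \<longlonglongrightarrow> 0"
  shows "v \<in> H10" "is_weak_deriv v g"
proof -
  note L2 = test_function_L2[OF phi]
  show w: "is_weak_deriv v g"
    unfolding is_weak_deriv_def
  proof
    fix \<psi> assume psi: "\<psi> \<in> test_functions 0 1"
    have "(\<lambda>n. \<integral>x. \<phi> n x * deriv \<psi> x \<partial>space_measure) \<longlonglongrightarrow> (\<integral>x. v x * deriv \<psi> x \<partial>space_measure)"
      by (intro L2_inner_tendsto L2 v lim test_function_L2[OF psi])
    moreover have "(\<lambda>n. - (\<integral>x. deriv (\<phi> n) x * \<psi> x \<partial>space_measure)) \<longlonglongrightarrow> - (\<integral>x. g x * \<psi> x \<partial>space_measure)"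
      by (intro tendsto_minus L2_inner_tendsto L2 g lim' test_function_L2[OF psi])
    moreover have "(\<integral>x. \<phi> n x * deriv \<psi> x \<partial>space_measure) = - (\<integral>x. deriv (\<phi> n) x * \<psi> x \<partial>space_measure)" for n
      using test_function_H1[OF phi[of n]] psi by (simp add: is_weak_deriv_def)
    ultimately show "(\<integral>x. v x * deriv \<psi> x \<partial>space_measure) = - (\<integral>x. g x * \<psi> x \<partial>space_measure)"
      using LIMSEQ_unique by simp
  qed
  have "H1_norm (\<phi> n - v) = sqrt ((norm_unit (\<lambda>x. \<phi> n x - v x))\<^sup>2
      + (norm_unit (\<lambda>x. deriv (\<phi> n) x - g x))\<^sup>2)" for n
    by (intro H1_diff_norm L2 v g w test_function_H1 phi)
  moreover have "(\<lambda>n. sqrt ((norm_unit (\<lambda>x. \<phi> n x - v x))\<^sup>2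
      + (norm_unit (\<lambda>x. deriv (\<phi> n) x - g x))\<^sup>2)) \<longlonglongrightarrow> sqrt (0\<^sup>2 + 0\<^sup>2)"
    by (intro tendsto_intros lim lim')
  ultimately show "v \<in> H10"
    using H1I(1)[OF v g w] phi by (auto simp: H10_def intro!: exI[of _ \<phi>])
qed

lemma mode_H10: "mode k \<in> H10"
  by (rule H10I(1)[OF mode_L2 cutoff_mode_test_function cutoff_mode_tendsto cutoff_mode_deriv_tendsto])

lemma H10_combination:
  assumes "v \<in> H10" "w \<in> H10"
  shows "(\<lambda>x. a * v x + b * w x) \<in> H10"
proof -
  obtain \<phi> where phi: "\<And>n. \<phi> n \<in> test_functions 0 1"
    "(\<lambda>n. norm_unit (\<lambda>x. \<phi> n x - v x)) \<longlonglongrightarrow> 0"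
    "(\<lambda>n. norm_unit (\<lambda>x. deriv (\<phi> n) x - weak_deriv v x)) \<longlonglongrightarrow> 0"
    using H10_approx[OF assms(1)] by blast
  obtain \<psi> where psi: "\<And>n. \<psi> n \<in> test_functions 0 1"
    "(\<lambda>n. norm_unit (\<lambda>x. \<psi> n x - w x)) \<longlonglongrightarrow> 0"
    "(\<lambda>n. norm_unit (\<lambda>x. deriv (\<psi> n) x - weak_deriv w x)) \<longlonglongrightarrow> 0"
    using H10_approx[OF assms(2)] by blast
  have d: "deriv (\<lambda>x. a * \<phi> n x + b * \<psi> n x) = (\<lambda>x. a * deriv (\<phi> n) x + b * deriv (\<psi> n) x)" for n
    by (intro ext DERIV_imp_deriv DERIV_add DERIV_cmult smooth_DERIV
        test_function_smooth[OF phi(1)] test_function_smooth[OF psi(1)])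
  note L2 = H10_L2[OF assms(1)] H10_L2[OF assms(2)] test_function_L2[OF phi(1)] test_function_L2[OF psi(1)]
  show ?thesis
  proof (rule H10I(1))
    show "(\<lambda>x. a * \<phi> n x + b * \<psi> n x) \<in> test_functions 0 1" for n
      by (intro test_function_combination phi psi)
    show "(\<lambda>x. a * v x + b * w x) \<in> L2_unit"
      "(\<lambda>x. a * weak_deriv v x + b * weak_deriv w x) \<in> L2_unit"
      by (intro L2_combination L2)+
    show "(\<lambda>n. norm_unit (\<lambda>x. a * \<phi> n x + b * \<psi> n x - (a * v x + b * w x))) \<longlonglongrightarrow> 0"
      by (intro L2_combination_tendsto L2 phi psi)
    show "(\<lambda>n. norm_unit (\<lambda>x. deriv (\<lambda>x. a * \<phi> n x + b * \<psi> n x) x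
        - (a * weak_deriv v x + b * weak_deriv w x))) \<longlonglongrightarrow> 0"
      unfolding d by (intro L2_combination_tendsto L2 phi psi)
  qed
qed

text \<open>Closedness of \<open>H\<^sub>0\<^sup>1\<close>, by a diagonal choice of test functions.\<close>

lemma H10_closed:
  assumes f: "\<And>n. f n \<in> H10" "\<And>n. f' n \<in> L2_unit" "\<And>n. is_weak_deriv (f n) (f' n)"
    and v: "v \<in> L2_unit" and g: "g \<in> L2_unit"
    and lim: "(\<lambda>n. norm_unit (\<lambda>x. f n x - v x)) \<longlonglongrightarrow> 0"
    and lim': "(\<lambda>n. norm_unit (\<lambda>x. f' n x - g x)) \<longlonglongrightarrow> 0"
  shows "v \<in> H10" "is_weak_deriv v g"
proof -
  have "\<forall>n. \<exists>\<phi>. \<phi> \<in> test_functions 0 1 \<and> norm_unit (\<lambda>x. \<phi> x - f n x) < 1 / real (Suc n)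
      \<and> norm_unit (\<lambda>x. deriv \<phi> x - f' n x) < 1 / real (Suc n)"
  proof
    fix n
    obtain \<phi> where phi: "\<And>n. \<phi> n \<in> test_functions 0 1"
      "(\<lambda>m. norm_unit (\<lambda>x. \<phi> m x - f n x)) \<longlonglongrightarrow> 0"
      "(\<lambda>m. norm_unit (\<lambda>x. deriv (\<phi> m) x - weak_deriv (f n) x)) \<longlonglongrightarrow> 0"
      using H10_approx[OF f(1)] by blast
    have "\<forall>\<^sub>F m in sequentially. norm_unit (\<lambda>x. \<phi> m x - f n x) < 1 / real (Suc n)
      \<and> norm_unit (\<lambda>x. deriv (\<phi> m) x - weak_deriv (f n) x) < 1 / real (Suc n)"
      using phi(2,3) by (intro eventually_conj order_tendstoD(2)[of _ 0]) auto
    then obtain m where m: "norm_unit (\<lambda>x. \<phi> m x - f n x) < 1 / real (Suc n)"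
      "norm_unit (\<lambda>x. deriv (\<phi> m) x - weak_deriv (f n) x) < 1 / real (Suc n)"
      unfolding eventually_sequentially by blast
    have "AE x in space_measure. weak_deriv (f n) x = f' n x"
      using H1I(2) H10_L2[OF f(1)] f(2,3) by blast
    then have "norm_unit (\<lambda>x. deriv (\<phi> m) x - weak_deriv (f n) x)
        = norm_unit (\<lambda>x. deriv (\<phi> m) x - f' n x)"
      using f(2) H10_L2(2)[OF f(1)] test_function_L2(2)[OF phi(1)]
      by (intro L2_norm_cong_AE) (auto intro!: borel_measurable_diff L2_measurable)
    with m phi(1) show "\<exists>\<phi>. \<phi> \<in> test_functions 0 1 \<and> norm_unit (\<lambda>x. \<phi> x - f n x) < 1 / real (Suc n)
      \<and> norm_unit (\<lambda>x. deriv \<phi> x - f' n x) < 1 / real (Suc n)"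
      by auto
  qed
  from choice[OF this]
  obtain \<phi> where phi: "\<And>n. \<phi> n \<in> test_functions 0 1"
    and near: "\<And>n. norm_unit (\<lambda>x. \<phi> n x - f n x) < 1 / real (Suc n)"
      "\<And>n. norm_unit (\<lambda>x. deriv (\<phi> n) x - f' n x) < 1 / real (Suc n)"
    by blast
  have lim_sum: "(\<lambda>n. norm_unit (\<lambda>x. p n x - F x)) \<longlonglongrightarrow> 0"
    if "\<And>n. p n \<in> L2_unit" "\<And>n. q n \<in> L2_unit" "F \<in> L2_unit"
      "\<And>n. norm_unit (\<lambda>x. p n x - q n x) < 1 / real (Suc n)"
      "(\<lambda>n. norm_unit (\<lambda>x. q n x - F x)) \<longlonglongrightarrow> 0" for p q F
  proof (rule Lim_null_comparison[OF always_eventually], rule allI)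
    fix n
    show "norm (norm_unit (\<lambda>x. p n x - F x))
        \<le> inverse (real (Suc n)) + norm_unit (\<lambda>x. q n x - F x)"
      using L2_triangle_diff[OF that(1)[of n] that(2)[of n] that(3)] that(4)[of n]
      by (simp add: inverse_eq_divide)
    show "(\<lambda>n. inverse (real (Suc n)) + norm_unit (\<lambda>x. q n x - F x)) \<longlonglongrightarrow> 0"
      using tendsto_add[OF LIMSEQ_inverse_real_of_nat that(5)] by simp
  qed
  have "(\<lambda>n. norm_unit (\<lambda>x. \<phi> n x - v x)) \<longlonglongrightarrow> 0"
    by (rule lim_sum[OF test_function_L2(1)[OF phi] H10_L2(1)[OF f(1)] v near(1) lim])
  moreover have "(\<lambda>n. norm_unit (\<lambda>x. deriv (\<phi> n) x - g x)) \<longlonglongrightarrow> 0"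
    by (rule lim_sum[OF test_function_L2(2)[OF phi] f(2) g near(2) lim'])
  ultimately show "v \<in> H10" "is_weak_deriv v g"
    using H10I[OF v g phi] by auto
qed

text \<open>The modes are eigenfunctions of the Dirichlet form. That no boundary terms appear reflects the boundary
  condition of \<open>v\<close>, which enters through the approximation by test functions.\<close>

lemma Dirichlet_form_mode:
  assumes "v \<in> H10"
  shows "(\<integral>x. weak_deriv v x * mode' k x \<partial>space_measure) = (freq k)\<^sup>2 * mode_coeff v k"
proof -
  obtain \<phi> where phi: "\<And>n. \<phi> n \<in> test_functions 0 1"
    "(\<lambda>n. norm_unit (\<lambda>x. \<phi> n x - v x)) \<longlonglongrightarrow> 0"
    "(\<lambda>n. norm_unit (\<lambda>x. deriv (\<phi> n) x - weak_deriv v x)) \<longlonglongrightarrow> 0"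
    using H10_approx[OF assms] by blast
  have A: "(\<lambda>n. \<integral>x. deriv (\<phi> n) x * mode' k x \<partial>space_measure)
      \<longlonglongrightarrow> (\<integral>x. weak_deriv v x * mode' k x \<partial>space_measure)"
    by (intro L2_inner_tendsto test_function_L2 phi H10_L2 assms mode_L2)
  have B: "(\<lambda>n. (freq k)\<^sup>2 * (\<integral>x. \<phi> n x * mode k x \<partial>space_measure))
      \<longlonglongrightarrow> (freq k)\<^sup>2 * (\<integral>x. v x * mode k x \<partial>space_measure)"
    by (intro tendsto_intros L2_inner_tendsto test_function_L2 phi H10_L2 assms mode_L2)
  have E: "(\<integral>x. deriv (\<phi> n) x * mode' k x \<partial>space_measure)
      = (freq k)\<^sup>2 * (\<integral>x. \<phi> n x * mode k x \<partial>space_measure)" for n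
  proof -
    have "(\<integral>x. mode' k x * deriv (\<phi> n) x \<partial>space_measure)
        = - (\<integral>x. - ((freq k)\<^sup>2 * mode k x) * \<phi> n x \<partial>space_measure)"
      using mode_is_weak_deriv(2)[of k] phi(1)[of n] unfolding is_weak_deriv_def by blast
    also have "\<dots> = (\<integral>x. (freq k)\<^sup>2 * (\<phi> n x * mode k x) \<partial>space_measure)"
      unfolding mult_minus_left Bochner_Integration.integral_minus minus_minus
      by (simp only: mult_ac)
    finally show ?thesis by (simp add: mult.commute[of "mode' k _"])
  qed
  show ?thesis
    unfolding mode_coeff_def by (rule LIMSEQ_unique[OF A[unfolded E] B])
qed


section \<open>Sine series with rapidly decaying coefficients\<close>

definition lam :: "nat \<Rightarrow> real" where
  "lam k = (freq k)\<^sup>2"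

lemma eigenvalue_eq_lam: "eigenvalue (Suc k) = lam k"
  by (simp add: eigenvalue_def lam_def)

lemma freq_ge_1: "1 \<le> freq k"
proof -
  have "1 * 1 \<le> real (Suc k) * pi" using pi_gt3 by (intro mult_mono) auto
  then show ?thesis by simp
qed

lemma freq_le_lam: "freq k \<le> lam k" and lam_ge_1: "1 \<le> lam k"
proof -
  show "freq k \<le> lam k"
    using mult_left_mono[OF freq_ge_1[of k], of "freq k"] order_trans[OF zero_le_one freq_ge_1[of k]]
    by (simp only: lam_def power2_eq_square mult_1_right)
  then show "1 \<le> lam k" using freq_ge_1[of k] by linarith
qed

lemma lam_pos: "0 < lam k" using lam_ge_1[of k] by linarith

text \<open>Enough decay to differentiate the sine series term by term.\<close>

definition rapid :: "(nat \<Rightarrow> real) \<Rightarrow> bool" where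
  "rapid b \<longleftrightarrow> summable (\<lambda>k. lam k * \<bar>b k\<bar>)"

definition field :: "(nat \<Rightarrow> real) \<Rightarrow> real \<Rightarrow> real" where
  "field b x = (\<Sum>k. b k * mode k x)"

definition field' :: "(nat \<Rightarrow> real) \<Rightarrow> real \<Rightarrow> real" where
  "field' b x = (\<Sum>k. b k * mode' k x)"

lemma rapid_diff:
  assumes "rapid b" "rapid c"
  shows "rapid (\<lambda>k. b k - c k)"
  unfolding rapid_def
proof (rule summable_comparison_test'[where N = 0])
  show "summable (\<lambda>k. lam k * \<bar>b k\<bar> + lam k * \<bar>c k\<bar>)"
    using assms unfolding rapid_def by (rule summable_add)
  show "norm (lam k * \<bar>b k - c k\<bar>) \<le> lam k * \<bar>b k\<bar> + lam k * \<bar>c k\<bar>" for k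
    using mult_left_mono[OF abs_triangle_ineq4[of "b k" "c k"], of "lam k"] lam_pos[of k]
    by (simp add: abs_mult distrib_left)
qed

lemma mode_bounds_lam: "\<bar>mode k x\<bar> \<le> sqrt 2 * lam k" "\<bar>mode' k x\<bar> \<le> sqrt 2 * lam k"
proof -
  have "sqrt 2 * 1 \<le> sqrt 2 * lam k" "sqrt 2 * freq k \<le> sqrt 2 * lam k"
    using lam_ge_1[of k] freq_le_lam[of k] by (intro mult_left_mono; simp)+
  then show "\<bar>mode k x\<bar> \<le> sqrt 2 * lam k" "\<bar>mode' k x\<bar> \<le> sqrt 2 * lam k"
    using mode_bounds[of k x] by linarith+
qed

lemma mode_term_bounds:
  "\<bar>b k * mode k x\<bar> \<le> sqrt 2 * (lam k * \<bar>b k\<bar>)" "\<bar>b k * mode' k x\<bar> \<le> sqrt 2 * (lam k * \<bar>b k\<bar>)"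
  using mult_left_mono[OF mode_bounds_lam(1)[of k x], of "\<bar>b k\<bar>"]
    mult_left_mono[OF mode_bounds_lam(2)[of k x], of "\<bar>b k\<bar>"]
  by (simp_all add: abs_mult mult_ac)

lemma rapid_mode_summable:
  assumes "rapid b"
  shows "summable (\<lambda>k. b k * mode k x)" "summable (\<lambda>k. b k * mode' k x)"
proof -
  have s: "summable (\<lambda>k. sqrt 2 * (lam k * \<bar>b k\<bar>))"
    using assms unfolding rapid_def by (rule summable_mult)
  show "summable (\<lambda>k. b k * mode k x)" "summable (\<lambda>k. b k * mode' k x)"
    by (rule summable_comparison_test'[OF s, of 0]; simp add: mode_term_bounds del: abs_mult)+
qed

lemma field_diff:
  assumes "rapid b" "rapid c"
  shows "field b x - field c x = field (\<lambda>k. b k - c k) x" "field' b x - field' c x = field' (\<lambda>k. b k - c k) x"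
  unfolding field_def field'_def
  using assms by (simp_all add: suminf_diff rapid_mode_summable left_diff_distrib)

lemma field_borel [measurable]: "field b \<in> borel_measurable borel" "field' b \<in> borel_measurable borel"
  unfolding field_def[abs_def] field'_def[abs_def] by measurable

text \<open>A summable majorant makes the series converge pointwise with bounded partial sums, hence in \<open>L\<^sup>2\<close> by
  dominated convergence.\<close>

lemma bounded_series_tendsto_L2:
  assumes s: "summable M" and bound: "\<And>k x. \<bar>g k x\<bar> \<le> M k"
    and meas: "\<And>k. g k \<in> borel_measurable borel"
  shows "(\<lambda>x. \<Sum>k. g k x) \<in> L2_unit"
    "(\<lambda>N. norm_unit (\<lambda>x. (\<Sum>k<N. g k x) - (\<Sum>k. g k x))) \<longlonglongrightarrow> 0"
proof -
  have bm: "(\<lambda>x. \<Sum>k<N. g k x) \<in> borel_measurable borel" "(\<lambda>x. \<Sum>k. g k x) \<in> borel_measurable borel" for N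
    by (auto intro!: borel_measurable_sum borel_measurable_suminf meas)
  have M: "0 \<le> M k" for k using bound[of k 0] by linarith
  have sg: "summable (\<lambda>k. \<bar>g k x\<bar>)" for x
    by (rule summable_comparison_test'[OF s, of 0]) (simp add: bound)
  have part: "\<bar>\<Sum>k<N. g k x\<bar> \<le> suminf M" for N x
  proof -
    have "\<bar>\<Sum>k<N. g k x\<bar> \<le> (\<Sum>k<N. \<bar>g k x\<bar>)" by (rule sum_abs)
    also have "\<dots> \<le> (\<Sum>k<N. M k)" by (intro sum_mono bound)
    also have "\<dots> \<le> suminf M" by (intro sum_le_suminf s) (auto simp: M)
    finally show ?thesis .
  qed
  have tot: "\<bar>\<Sum>k. g k x\<bar> \<le> suminf M" for x
  proof -
    have "\<bar>\<Sum>k. g k x\<bar> \<le> (\<Sum>k. \<bar>g k x\<bar>)" by (rule summable_rabs[OF sg])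
    also have "\<dots> \<le> suminf M" by (rule suminf_le[OF _ sg s]) (rule bound)
    finally show ?thesis .
  qed
  show "(\<lambda>x. \<Sum>k. g k x) \<in> L2_unit"
  proof (rule L2_bounded[OF finite_measure_interval])
    show "(\<lambda>x. \<Sum>k. g k x) \<in> borel_measurable space_measure" by (rule borel_measurable_interval[OF bm(2)])
    show "AE x in space_measure. \<bar>\<Sum>k. g k x\<bar> \<le> suminf M" by (rule AE_I2) (rule tot)
  qed
  show "(\<lambda>N. norm_unit (\<lambda>x. (\<Sum>k<N. g k x) - (\<Sum>k. g k x))) \<longlonglongrightarrow> 0"
  proof (rule L2_dominated_convergence[where f = "\<lambda>N x. \<Sum>k<N. g k x" and F = "\<lambda>x. \<Sum>k. g k x"
        and h = "\<lambda>_. suminf M + suminf M"])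
    show "AE x in space_measure. (\<lambda>N. \<Sum>k<N. g k x) \<longlonglongrightarrow> (\<Sum>k. g k x)"
    proof (rule AE_I2)
      show "(\<lambda>N. \<Sum>k<N. g k x) \<longlonglongrightarrow> (\<Sum>k. g k x)" for x
        by (rule summable_LIMSEQ[OF summable_rabs_cancel[OF sg]])
    qed
    show "AE x in space_measure. \<bar>(\<Sum>k<N. g k x) - (\<Sum>k. g k x)\<bar> \<le> \<bar>suminf M + suminf M\<bar>" for N
    proof (rule AE_I2)
      show "\<bar>(\<Sum>k<N. g k x) - (\<Sum>k. g k x)\<bar> \<le> \<bar>suminf M + suminf M\<bar>" for x
        using part[where x=x and N=N] tot[of x] by linarith
    qed
    show "(\<lambda>x. \<Sum>k<N. g k x) \<in> borel_measurable space_measure" for N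
      by (rule borel_measurable_interval[OF bm(1)])
    show "(\<lambda>x. \<Sum>k. g k x) \<in> borel_measurable space_measure"
      by (rule borel_measurable_interval[OF bm(2)])
    show "(\<lambda>_. suminf M + suminf M) \<in> L2_unit"
      by (rule L2_const)
  qed
qed

lemma field_tendsto:
  assumes "rapid b"
  shows "field b \<in> L2_unit" "field' b \<in> L2_unit"
    "(\<lambda>N. norm_unit (\<lambda>x. (\<Sum>k<N. b k * mode k x) - field b x)) \<longlonglongrightarrow> 0"
    "(\<lambda>N. norm_unit (\<lambda>x. (\<Sum>k<N. b k * mode' k x) - field' b x)) \<longlonglongrightarrow> 0"
proof -
  have s: "summable (\<lambda>k. sqrt 2 * (lam k * \<bar>b k\<bar>))"
    using assms unfolding rapid_def by (rule summable_mult)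
  note * = bounded_series_tendsto_L2[where g = "\<lambda>k x. b k * mode k x", OF s mode_term_bounds(1)[of b]]
    bounded_series_tendsto_L2[where g = "\<lambda>k x. b k * mode' k x", OF s mode_term_bounds(2)[of b]]
  have m: "(\<lambda>x. b k * mode k x) \<in> borel_measurable borel" "(\<lambda>x. b k * mode' k x) \<in> borel_measurable borel" for k
    by measurable
  show "field b \<in> L2_unit"
    "(\<lambda>N. norm_unit (\<lambda>x. (\<Sum>k<N. b k * mode k x) - field b x)) \<longlonglongrightarrow> 0"
    unfolding field_def[abs_def] by (rule *(1,2)[OF m(1)])+
  show "field' b \<in> L2_unit"
    "(\<lambda>N. norm_unit (\<lambda>x. (\<Sum>k<N. b k * mode' k x) - field' b x)) \<longlonglongrightarrow> 0"
    unfolding field'_def[abs_def] by (rule *(3,4)[OF m(2)])+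
qed

lemma zero_H10: "(\<lambda>x. 0) \<in> H10" and zero_weak_deriv: "is_weak_deriv (\<lambda>x. 0) (\<lambda>x. 0)"
  using H10_combination[OF mode_H10 mode_H10, of 0 0 0 0] by (auto simp: is_weak_deriv_def)

lemma sine_sum_H10:
  "(\<lambda>x. \<Sum>k<N. b k * mode k x) \<in> H10"
  "is_weak_deriv (\<lambda>x. \<Sum>k<N. b k * mode k x) (\<lambda>x. \<Sum>k<N. b k * mode' k x)"
proof (induction N)
  case (Suc N)
  {
    case 1
    show ?case using H10_combination[OF Suc(1) mode_H10, of 1 "b N" N] by simp
  next
    case 2
    show ?case
      using is_weak_deriv_combination[OF H10_L2(1)[OF Suc(1)] _ Suc(2) mode_L2(1) mode_L2(2) mode_is_weak_deriv(1),
          of 1 "b N" N]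
      by (simp add: L2_sum L2_cmult mode_L2)
  }
qed (auto intro: zero_H10 zero_weak_deriv)

lemma field_H10:
  assumes "rapid b"
  shows "field b \<in> H10" "is_weak_deriv (field b) (field' b)"
    "AE x in space_measure. weak_deriv (field b) x = field' b x"
proof -
  have L2: "(\<lambda>x. \<Sum>k<N. b k * mode' k x) \<in> L2_unit" for N
    by (intro L2_sum L2_cmult mode_L2)
  note * = H10_closed[OF sine_sum_H10(1) L2 sine_sum_H10(2) field_tendsto[OF assms]]
  from * show "field b \<in> H10" "is_weak_deriv (field b) (field' b)" .
  then show "AE x in space_measure. weak_deriv (field b) x = field' b x"
    using H1I(2)[OF field_tendsto(1,2)[OF assms]] by blast
qed

lemma field_inner_sums:
  assumes "rapid b" "v \<in> L2_unit"
  shows "(\<lambda>k. b k * mode_coeff v k) sums (\<integral>x. field b x * v x \<partial>space_measure)"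
proof -
  have "(\<lambda>N. \<integral>x. (\<Sum>k<N. b k * mode k x) * v x \<partial>space_measure) \<longlonglongrightarrow> (\<integral>x. field b x * v x \<partial>space_measure)"
    by (intro L2_inner_tendsto field_tendsto assms L2_sum L2_cmult mode_L2)
  moreover have "(\<integral>x. (\<Sum>k<N. b k * mode k x) * v x \<partial>space_measure) = (\<Sum>k<N. b k * mode_coeff v k)" for N
    using assms(2)
    by (simp add: sum_distrib_right mult.assoc L2_integrable_mult mode_L2 mode_coeff_def mult.commute[of "mode _ _"])
  ultimately show ?thesis by (simp add: sums_def)
qed

text \<open>For \<open>v \<in> H\<^sub>0\<^sup>1\<close> the inner products with the derivatives of the modes are given by \<open>Dirichlet_form_mode\<close>.\<close>

lemma field'_inner_sums:
  assumes "rapid b" "v \<in> H10"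
  shows "(\<lambda>k. lam k * b k * mode_coeff v k) sums (\<integral>x. field' b x * weak_deriv v x \<partial>space_measure)"
proof -
  have "(\<lambda>N. \<integral>x. (\<Sum>k<N. b k * mode' k x) * weak_deriv v x \<partial>space_measure)
      \<longlonglongrightarrow> (\<integral>x. field' b x * weak_deriv v x \<partial>space_measure)"
    by (intro L2_inner_tendsto field_tendsto assms L2_sum L2_cmult mode_L2 H10_L2)
  moreover have "(\<integral>x. (\<Sum>k<N. b k * mode' k x) * weak_deriv v x \<partial>space_measure)
      = (\<Sum>k<N. lam k * b k * mode_coeff v k)" for N
  proof -
    have "(\<integral>x. (\<Sum>k<N. b k * mode' k x) * weak_deriv v x \<partial>space_measure)
      = (\<Sum>k<N. b k * (\<integral>x. weak_deriv v x * mode' k x \<partial>space_measure))"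
      using H10_L2[OF assms(2)]
      by (simp add: sum_distrib_right mult.assoc L2_integrable_mult mode_L2 mult.commute[of "mode' _ _"])
    then show ?thesis
      by (simp only: Dirichlet_form_mode[OF assms(2)] lam_def mult_ac)
  qed
  ultimately show ?thesis by (simp add: sums_def)
qed

lemma mode_coeff_field:
  assumes "rapid b"
  shows "mode_coeff (field b) k = b k"
proof -
  have "mode_coeff (mode k) j = (if j = k then 1 else 0)" for j
    unfolding mode_coeff_def mode_orthonormal by auto
  then have "(\<lambda>j. b j * mode_coeff (mode k) j) = (\<lambda>j. if j = k then b j else 0)"
    by (intro ext) simp
  then have "(\<lambda>j. if j = k then b j else 0) sums mode_coeff (field b) k"
    using field_inner_sums[OF assms mode_L2(1)[of k]]
    by (simp only: mode_coeff_def[of "field b"])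
  moreover have "(\<lambda>j. if j = k then b j else 0) sums b k"
    using sums_single[of k b] by simp
  ultimately show ?thesis by (rule sums_unique2)
qed

text \<open>The Dirichlet energy is obtained by inserting the series itself into its inner product with
  \<open>H\<^sub>0\<^sup>1\<close> functions; this replaces a Parseval identity for the cosines.\<close>

lemma field_norm_sums:
  assumes "rapid b"
  shows "(\<lambda>k. (b k)\<^sup>2) sums (norm_unit (field b))\<^sup>2"
    "(\<lambda>k. lam k * (b k)\<^sup>2) sums (norm_unit (field' b))\<^sup>2"
    "(\<lambda>k. (1 + lam k) * (b k)\<^sup>2) sums (H1_norm (field b))\<^sup>2"
proof -
  show 1: "(\<lambda>k. (b k)\<^sup>2) sums (norm_unit (field b))\<^sup>2"
    using Parseval[OF field_tendsto(1)[OF assms]] by (simp add: mode_coeff_field[OF assms])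
  have "(\<integral>x. field' b x * weak_deriv (field b) x \<partial>space_measure) = (norm_unit (field' b))\<^sup>2"
    unfolding L2_norm_sq
    using field_H10(3)[OF assms] H10_L2(2)[OF field_H10(1)[OF assms]]
    by (intro integral_cong_AE) (auto simp: power2_eq_square elim!: eventually_mono dest: L2_measurable)
  then show 2: "(\<lambda>k. lam k * (b k)\<^sup>2) sums (norm_unit (field' b))\<^sup>2"
    using field'_inner_sums[OF assms field_H10(1)[OF assms]]
    by (simp add: mode_coeff_field[OF assms] power2_eq_square mult.assoc)
  have "(H1_norm (field b))\<^sup>2 = (norm_unit (field b))\<^sup>2 + (norm_unit (field' b))\<^sup>2"
    using H1_norm_eq[OF field_tendsto(1,2)[OF assms] field_H10(2)[OF assms]] by simp
  then show "(\<lambda>k. (1 + lam k) * (b k)\<^sup>2) sums (H1_norm (field b))\<^sup>2"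
    using sums_add[OF 1 2] by (simp add: distrib_right)
qed


section \<open>Curves in normed spaces\<close>

text \<open>A norm continuous curve is strongly measurable: it is the limit of its values at the midpoints of ever
  finer equidistant partitions. Midpoints stay inside the open interval, where the curve takes values in \<open>X\<close>.\<close>

lemma bochner_L2_continuous:
  assumes "T > 0" and X: "\<And>t. t \<in> {0<..<T} \<Longrightarrow> f t \<in> X"
    and cont: "\<And>t. t \<in> {0<..<T} \<Longrightarrow> ((\<lambda>r. N (f r - f t)) \<longlongrightarrow> 0) (nhds t)"
    and int: "integrable (time_measure T) (\<lambda>t. (N (f t))\<^sup>2)"
  shows "f \<in> bochner_L2 (time_measure T) X N"
proof -
  define \<rho> where "\<rho> n t = T * (real_of_int \<lfloor>real (Suc n) * t / T\<rfloor> + 1/2) / real (Suc n)" for n t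
  have floor_range: "\<lfloor>real (Suc n) * t / T\<rfloor> \<in> {0..int n}" if "t \<in> {0<..<T}" for n t
  proof -
    have "real (Suc n) * t / T < real (Suc n) * 1"
      using that \<open>T > 0\<close> by (simp add: divide_less_eq del: of_nat_Suc)
    then have "\<lfloor>real (Suc n) * t / T\<rfloor> < int (Suc n)" by (simp only: floor_less_iff) simp
    moreover have "0 \<le> \<lfloor>real (Suc n) * t / T\<rfloor>" using that \<open>T > 0\<close> by simp
    ultimately show ?thesis by simp
  qed
  have range: "\<rho> n t \<in> {0<..<T}" if t: "t \<in> {0<..<T}" for n t
  proof -
    define m where "m = real_of_int \<lfloor>real (Suc n) * t / T\<rfloor>"
    have "0 \<le> m" "m \<le> real n" using floor_range[OF t, of n] by (auto simp: m_def)
    then have "0 < T * (m + 1/2)" "T * (m + 1/2) < T * real (Suc n)"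
      using \<open>T > 0\<close> by (auto intro!: mult_pos_pos)
    then show ?thesis by (simp add: \<rho>_def m_def[symmetric] divide_less_eq del: of_nat_Suc)
  qed
  have near: "\<bar>\<rho> n t - t\<bar> \<le> T * inverse (real (Suc n))" for n t
  proof -
    define z where "z = real (Suc n) * t / T"
    have t: "t = T * z / real (Suc n)" using \<open>T > 0\<close> by (simp add: z_def)
    have "\<rho> n t - T * z / real (Suc n) = T * (real_of_int \<lfloor>z\<rfloor> + 1/2 - z) / real (Suc n)"
      unfolding \<rho>_def z_def[symmetric]
      by (simp only: diff_divide_distrib[symmetric] right_diff_distrib[symmetric])
    then have "\<rho> n t - t = T * (real_of_int \<lfloor>z\<rfloor> + 1/2 - z) / real (Suc n)"
      using t by simp
    moreover have "\<bar>real_of_int \<lfloor>z\<rfloor> + 1/2 - z\<bar> \<le> 1"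
      using floor_correct[of z] by linarith
    then have "T * \<bar>real_of_int \<lfloor>z\<rfloor> + 1/2 - z\<bar> / real (Suc n) \<le> T * 1 / real (Suc n)"
      using \<open>T > 0\<close> by (intro divide_right_mono mult_left_mono) auto
    moreover have "\<bar>T * (real_of_int \<lfloor>z\<rfloor> + 1/2 - z) / real (Suc n)\<bar>
        = T * \<bar>real_of_int \<lfloor>z\<rfloor> + 1/2 - z\<bar> / real (Suc n)"
      using \<open>T > 0\<close> by (simp only: abs_divide abs_mult abs_of_pos abs_of_nat)
    ultimately show ?thesis by (simp only: divide_inverse mult_1_right)
  qed
  have lim: "(\<lambda>n. \<rho> n t) \<longlonglongrightarrow> t" for t
  proof (rule LIM_zero_cancel, rule Lim_null_comparison[OF always_eventually])
    show "\<forall>n. norm (\<rho> n t - t) \<le> T * inverse (real (Suc n))" using near by simp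
    show "(\<lambda>n. T * inverse (real (Suc n))) \<longlonglongrightarrow> 0"
      using tendsto_mult_left[OF LIMSEQ_inverse_real_of_nat, of T] by simp
  qed
  have "simple_function (time_measure T) (\<rho> n)" for n
  proof (rule simple_function_borel_measurable)
    show "\<rho> n \<in> borel_measurable (time_measure T)"
      unfolding \<rho>_def[abs_def] by measurable
    have "\<rho> n ` {0<..<T} \<subseteq> (\<lambda>m. T * (real_of_int m + 1/2) / real (Suc n)) ` {0..int n}"
      unfolding \<rho>_def using floor_range by fast
    then show "finite (\<rho> n ` space (time_measure T))"
      using finite_subset by (simp add: space_restrict_space) blast
  qed
  then have "simple_function (time_measure T) (f \<circ> \<rho> n)" for n
    by (rule simple_function_compose)
  moreover have "(f \<circ> \<rho> n) ` space (time_measure T) \<subseteq> X" for n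
    using X[OF range] by (auto simp: space_restrict_space)
  moreover have "AE t in time_measure T. f t \<in> X \<and> (\<lambda>n. N ((f \<circ> \<rho> n) t - f t)) \<longlonglongrightarrow> 0"
  proof (intro AE_interval conjI)
    fix t assume t: "0 < t" "t < T"
    then show "f t \<in> X" using X by simp
    show "(\<lambda>n. N ((f \<circ> \<rho> n) t - f t)) \<longlonglongrightarrow> 0"
      using filterlim_compose[OF cont[of t] lim[of t]] t by simp
  qed
  ultimately show ?thesis
    using int unfolding bochner_L2_def by (intro CollectI conjI exI[of _ "\<lambda>n. f \<circ> \<rho> n"] allI) blast+
qed

text \<open>The embedding of \<open>L\<^sup>2\<close> into \<open>H\<^sup>-\<^sup>1\<close>.\<close>

definition L2_functional :: "(real \<Rightarrow> real) \<Rightarrow> (real \<Rightarrow> real) \<Rightarrow> real" where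
  "L2_functional f v = (\<integral>x. f x * v x \<partial>space_measure)"

lemma L2_functional_bound:
  assumes "f \<in> L2_unit" "v \<in> H10"
  shows "\<bar>L2_functional f v\<bar> \<le> norm_unit f * H1_norm v"
  unfolding L2_functional_def
  using L2_Cauchy_Schwarz[OF assms(1) H10_L2(1)[OF assms(2)]] L2_norm_le_H1_norm(1)[of v]
  by (meson L2_norm_nonneg mult_left_mono order_trans)

lemma L2_functional_Hm1:
  assumes "f \<in> L2_unit"
  shows "L2_functional f \<in> Hm1"
proof -
  have "L2_functional f (\<lambda>x. a * v x + b * w x) = a * L2_functional f v + b * L2_functional f w"
    if "v \<in> H10" "w \<in> H10" for v w a b
  proof -
    have "L2_functional f (\<lambda>x. a * v x + b * w x) = (\<integral>x. a * (f x * v x) + b * (f x * w x) \<partial>space_measure)"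
      unfolding L2_functional_def by (simp add: algebra_simps)
    also have "\<dots> = a * L2_functional f v + b * L2_functional f w"
      using L2_integrable_mult[OF assms H10_L2(1)[OF that(1)]] L2_integrable_mult[OF assms H10_L2(1)[OF that(2)]]
      by (simp add: L2_functional_def)
    finally show ?thesis .
  qed
  then show ?thesis
    unfolding Hm1_def using L2_functional_bound[OF assms] by blast
qed

lemma H1_norm_zero: "H1_norm (\<lambda>x. 0) = 0"
  using H1_norm_eq[OF L2_zero L2_zero zero_weak_deriv] by simp

lemma Hm1_norm_le:
  assumes "\<And>v. v \<in> H10 \<Longrightarrow> \<bar>F v\<bar> \<le> C * H1_norm v" "0 \<le> C"
  shows "Hm1_norm F \<le> C"
  unfolding Hm1_norm_def
proof (rule cSUP_least)
  show "{v \<in> H10. H1_norm v \<le> 1} \<noteq> {}" using zero_H10 H1_norm_zero by auto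
  fix v assume v: "v \<in> {v \<in> H10. H1_norm v \<le> 1}"
  then have "C * H1_norm v \<le> C * 1" using \<open>0 \<le> C\<close> by (intro mult_left_mono) auto
  then show "\<bar>F v\<bar> \<le> C" using assms(1)[of v] v by simp
qed

lemma Hm1_norm_upper:
  assumes "\<And>v. v \<in> H10 \<Longrightarrow> \<bar>F v\<bar> \<le> C * H1_norm v" "v \<in> H10" "H1_norm v \<le> 1"
  shows "\<bar>F v\<bar> \<le> Hm1_norm F"
  unfolding Hm1_norm_def
proof (rule cSUP_upper)
  show "bdd_above ((\<lambda>v. \<bar>F v\<bar>) ` {v \<in> H10. H1_norm v \<le> 1})"
  proof (rule bdd_aboveI2)
    fix v assume v: "v \<in> {v \<in> H10. H1_norm v \<le> 1}"
    then have "C * H1_norm v \<le> \<bar>C\<bar> * 1" by (intro mult_mono) auto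
    then show "\<bar>F v\<bar> \<le> \<bar>C\<bar>" using assms(1)[of v] v by simp
  qed
qed (use assms in auto)

lemma Hm1_norm_nonneg:
  assumes "f \<in> L2_unit"
  shows "0 \<le> Hm1_norm (L2_functional f)"
  using order_trans[OF abs_ge_zero Hm1_norm_upper[OF L2_functional_bound[OF assms] zero_H10]] H1_norm_zero
  by simp

lemma Hm1_norm_L2_functional_diff:
  assumes "f \<in> L2_unit" "g \<in> L2_unit"
  shows "0 \<le> Hm1_norm (L2_functional f - L2_functional g)"
    "Hm1_norm (L2_functional f - L2_functional g) \<le> norm_unit (\<lambda>x. f x - g x)"
    "\<bar>Hm1_norm (L2_functional f) - Hm1_norm (L2_functional g)\<bar> \<le> norm_unit (\<lambda>x. f x - g x)"
proof -
  have diff: "L2_functional p v - L2_functional q v = L2_functional (\<lambda>x. p x - q x) v"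
    if "p \<in> L2_unit" "q \<in> L2_unit" "v \<in> H10" for p q v
    using L2_integrable_mult[OF that(1) H10_L2(1)[OF that(3)]] L2_integrable_mult[OF that(2) H10_L2(1)[OF that(3)]]
    by (simp add: L2_functional_def left_diff_distrib)
  have b: "\<bar>(L2_functional f - L2_functional g) v\<bar> \<le> norm_unit (\<lambda>x. f x - g x) * H1_norm v"
    if "v \<in> H10" for v
    using L2_functional_bound[OF L2_diff[OF assms] that] diff[OF assms that] by simp
  show "0 \<le> Hm1_norm (L2_functional f - L2_functional g)"
    by (rule order_trans[OF abs_ge_zero Hm1_norm_upper[OF b zero_H10]]) (simp_all add: H1_norm_zero)
  show "Hm1_norm (L2_functional f - L2_functional g) \<le> norm_unit (\<lambda>x. f x - g x)"
    by (rule Hm1_norm_le[OF b]) auto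
  have one: "Hm1_norm (L2_functional p) \<le> Hm1_norm (L2_functional q) + norm_unit (\<lambda>x. p x - q x)"
    if pq: "p \<in> L2_unit" "q \<in> L2_unit" for p q
    unfolding Hm1_norm_def[of "L2_functional p"]
  proof (rule cSUP_least)
    show "{v \<in> H10. H1_norm v \<le> 1} \<noteq> {}" using zero_H10 H1_norm_zero by auto
    fix v assume "v \<in> {v \<in> H10. H1_norm v \<le> 1}"
    then have v: "v \<in> H10" "H1_norm v \<le> 1" by auto
    have "\<bar>L2_functional (\<lambda>x. p x - q x) v\<bar> \<le> norm_unit (\<lambda>x. p x - q x) * H1_norm v"
      by (rule L2_functional_bound[OF L2_diff[OF pq] v(1)])
    also have "\<dots> \<le> norm_unit (\<lambda>x. p x - q x) * 1"
      using v(2) by (intro mult_left_mono) auto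
    finally show "\<bar>L2_functional p v\<bar> \<le> Hm1_norm (L2_functional q) + norm_unit (\<lambda>x. p x - q x)"
      using Hm1_norm_upper[OF L2_functional_bound[OF pq(2)] v] diff[OF pq v(1)] by simp
  qed
  show "\<bar>Hm1_norm (L2_functional f) - Hm1_norm (L2_functional g)\<bar> \<le> norm_unit (\<lambda>x. f x - g x)"
    using one[OF assms] one[OF assms(2,1)] L2_norm_minus_commute[of space_measure f g] by linarith
qed


section \<open>Families of rapidly decaying coefficients\<close>

lemma isCont_iff_tendsto_nhds: "isCont g s \<longleftrightarrow> (g \<longlongrightarrow> g s) (nhds s)"
  unfolding isCont_def by (rule tendsto_at_iff_tendsto_nhds)

lemma tendsto_suminf_dominated:
  fixes A :: "nat \<Rightarrow> 'a \<Rightarrow> real"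
  assumes "\<And>k. (A k \<longlongrightarrow> L k) F" "\<forall>\<^sub>F t in F. \<forall>k. \<bar>A k t\<bar> \<le> M k" "summable M" "F \<noteq> bot"
  shows "((\<lambda>t. \<Sum>k. A k t) \<longlongrightarrow> (\<Sum>k. L k)) F"
proof -
  have "eventually (\<lambda>(k, t). norm (A k t) \<le> M k) (at_top \<times>\<^sub>F F)"
    unfolding eventually_prod_filter
    by (rule exI[of _ "\<lambda>_. True"], rule exI[of _ "\<lambda>t. \<forall>k. \<bar>A k t\<bar> \<le> M k"]) (use assms(2) in auto)
  from tannerys_theorem[OF assms(1) this assms(3,4)] show ?thesis by blast
qed

text \<open>Since \<open>z ^ (m + 1) exp (- z)\<close> is bounded, the terms are dominated by a multiple of \<open>1 / lam k\<close>, hence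
  of \<open>1 / (k + 1)\<^sup>2\<close>.\<close>

lemma summable_lam_exp:
  assumes "\<delta> > 0"
  shows "summable (\<lambda>k. lam k ^ m * exp (- (lam k * \<delta>)))"
proof -
  have "\<forall>\<^sub>F x in at_top. x ^ Suc m / exp x < (1::real)"
    using order_tendstoD(2)[OF tendsto_power_div_exp_0[of "Suc m"], of 1] by simp
  then obtain R where R: "\<And>x. x \<ge> R \<Longrightarrow> x ^ Suc m / exp x < (1::real)"
    unfolding eventually_at_top_linorder by blast
  define C where "C = 1 + \<bar>R\<bar> ^ Suc m"
  have C: "x ^ Suc m * exp (- x) \<le> C" if "x \<ge> 0" for x :: real
  proof (cases "x \<ge> R")
    case True
    from R[OF this] show ?thesis by (simp add: exp_minus divide_inverse C_def add_increasing2)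
  next
    case False
    then have "x ^ Suc m * exp (- x) \<le> \<bar>R\<bar> ^ Suc m * 1"
      using that by (intro mult_mono power_mono) auto
    then show ?thesis by (simp add: C_def)
  qed
  have inv: "summable (\<lambda>k. C / \<delta> ^ Suc m * (inverse (real (Suc k)))\<^sup>2)"
    using inverse_power_summable[of 2, where 'a = real]
    by (intro summable_mult) (subst summable_Suc_iff[of "\<lambda>k. (inverse (real k))\<^sup>2"], simp add: power_inverse)
  show ?thesis
  proof (rule summable_comparison_test'[OF inv, of 0])
    fix k
    have "real (Suc k) \<le> freq k"
      using mult_left_mono[of 1 pi "real (Suc k)"] pi_gt3 by simp
    then have sq: "(real (Suc k))\<^sup>2 \<le> lam k"
      unfolding lam_def by (intro power_mono) auto
    have "\<delta> ^ Suc m * (lam k * (lam k ^ m * exp (- (lam k * \<delta>)))) \<le> C"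
      using C[of "lam k * \<delta>"] lam_pos[of k] assms by (simp add: power_mult_distrib mult_ac)
    then have "lam k ^ m * exp (- (lam k * \<delta>)) \<le> C / \<delta> ^ Suc m * inverse (lam k)"
      using assms lam_pos[of k] by (simp add: field_simps)
    also have "\<dots> \<le> C / \<delta> ^ Suc m * inverse ((real (Suc k))\<^sup>2)"
      using sq assms by (intro mult_left_mono le_imp_inverse_le) (auto simp: C_def)
    finally show "norm (lam k ^ m * exp (- (lam k * \<delta>))) \<le> C / \<delta> ^ Suc m * (inverse (real (Suc k)))\<^sup>2"
      using lam_pos[of k] by (simp add: power_inverse)
  qed
qed

text \<open>The decay that the heat semigroup produces on compact time intervals: exponential in \<open>lam k\<close>, up to the
  factor \<open>lam k\<close> which the control and the time derivative contribute.\<close>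

definition regular_family :: "real \<Rightarrow> (real \<Rightarrow> nat \<Rightarrow> real) \<Rightarrow> bool" where
  "regular_family T B \<longleftrightarrow>
    (\<forall>k. continuous_on UNIV (\<lambda>t. B t k)) \<and>
    (\<forall>\<delta>>0. \<exists>K\<ge>0. \<forall>t\<in>{\<delta>..T - \<delta>}. \<forall>k. \<bar>B t k\<bar> \<le> K * (lam k * exp (- (lam k * \<delta>))))"

lemma regular_family_bound:
  assumes "regular_family T B" "\<delta> > 0"
  obtains K where "K \<ge> 0" "\<And>t k. \<delta> \<le> t \<Longrightarrow> t \<le> T - \<delta> \<Longrightarrow> \<bar>B t k\<bar> \<le> K * (lam k * exp (- (lam k * \<delta>)))"
  using assms unfolding regular_family_def by (metis atLeastAtMost_iff)

lemma regular_family_cont: "regular_family T B \<Longrightarrow> isCont (\<lambda>t. B t k) s"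
  unfolding regular_family_def by (simp add: continuous_on_eq_continuous_at)

lemma interior_margin:
  assumes "s \<in> {0<..<T}"
  obtains \<delta> :: real where "\<delta> > 0" "\<delta> < s" "s < T - \<delta>"
  using assms by (intro that[of "min s (T - s) / 2"]) (auto simp: min_def field_simps)

lemma eventually_in_margin:
  fixes s :: real
  assumes "\<delta> < s" "s < T - \<delta>"
  shows "\<forall>\<^sub>F t in nhds s. \<delta> \<le> t \<and> t \<le> T - \<delta>"
proof -
  have "\<forall>\<^sub>F t in nhds s. t \<in> {\<delta><..<T - \<delta>}"
    using assms by (intro eventually_nhds_in_open) auto
  then show ?thesis by eventually_elim auto
qed

lemma regular_family_rapid:
  assumes "regular_family T B" "t \<in> {0<..<T}"
  shows "rapid (B t)"
proof -
  obtain \<delta> where \<delta>: "\<delta> > 0" "\<delta> < t" "t < T - \<delta>" using interior_margin[OF assms(2)] .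
  obtain K where K: "K \<ge> 0" "\<And>k. \<bar>B t k\<bar> \<le> K * (lam k * exp (- (lam k * \<delta>)))"
    using regular_family_bound[OF assms(1) \<delta>(1)] \<delta>(2,3) by (metis less_imp_le)
  show ?thesis
    unfolding rapid_def
  proof (rule summable_comparison_test'[of _ 0])
    show "summable (\<lambda>k. K * (lam k ^ 2 * exp (- (lam k * \<delta>))))"
      by (intro summable_mult summable_lam_exp \<delta>)
    fix k
    have "lam k * \<bar>B t k\<bar> \<le> lam k * (K * (lam k * exp (- (lam k * \<delta>))))"
      using K(2) lam_pos[of k] by (intro mult_left_mono) auto
    then show "norm (lam k * \<bar>B t k\<bar>) \<le> K * (lam k ^ 2 * exp (- (lam k * \<delta>)))"
      using lam_pos[of k] by (simp add: power2_eq_square mult_ac)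
  qed
qed

text \<open>The squared norm is a series in the squared coefficient differences, and the exponential decay near
  \<open>s\<close> provides the majorant for passing to the limit.\<close>

lemma regular_family_H1_continuous:
  assumes B: "regular_family T B" and s: "s \<in> {0<..<T}"
  shows "((\<lambda>t. H1_norm (field (B t) - field (B s))) \<longlongrightarrow> 0) (nhds s)"
proof -
  obtain \<delta> where \<delta>: "\<delta> > 0" "\<delta> < s" "s < T - \<delta>" using interior_margin[OF s] .
  obtain K where K: "K \<ge> 0"
    "\<And>t k. \<delta> \<le> t \<Longrightarrow> t \<le> T - \<delta> \<Longrightarrow> \<bar>B t k\<bar> \<le> K * (lam k * exp (- (lam k * \<delta>)))"
    using regular_family_bound[OF B \<delta>(1)] by metis
  note ev = eventually_in_margin[OF \<delta>(2,3)]
  have "((\<lambda>t. \<Sum>k. (1 + lam k) * (B t k - B s k)\<^sup>2) \<longlongrightarrow> (\<Sum>k::nat. 0)) (nhds s)"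
  proof (rule tendsto_suminf_dominated)
    show "((\<lambda>t. (1 + lam k) * (B t k - B s k)\<^sup>2) \<longlongrightarrow> 0) (nhds s)" for k
    proof -
      have "((\<lambda>t. B t k) \<longlongrightarrow> B s k) (nhds s)"
        using regular_family_cont[OF B] by (simp only: isCont_iff_tendsto_nhds)
      then have "((\<lambda>t. (1 + lam k) * (B t k - B s k)\<^sup>2) \<longlongrightarrow> (1 + lam k) * (B s k - B s k)\<^sup>2) (nhds s)"
        by (intro tendsto_intros)
      then show ?thesis by simp
    qed
    show "summable (\<lambda>k. 8 * K\<^sup>2 * (lam k ^ 3 * exp (- (lam k * \<delta>))))"
      by (intro summable_mult summable_lam_exp \<delta>)
    show "\<forall>\<^sub>F t in nhds s. \<forall>k. \<bar>(1 + lam k) * (B t k - B s k)\<^sup>2\<bar> \<le> 8 * K\<^sup>2 * (lam k ^ 3 * exp (- (lam k * \<delta>)))"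
      using ev
    proof (eventually_elim, intro allI)
      fix t k assume t: "\<delta> \<le> t \<and> t \<le> T - \<delta>"
      define E where "E = exp (- (lam k * \<delta>))"
      have E: "0 \<le> E" "E \<le> 1" using lam_pos[of k] \<delta> by (auto simp: E_def)
      have "\<bar>B t k - B s k\<bar> \<le> 2 * (K * (lam k * E))"
        using K(2)[of t k] K(2)[of s k] t \<delta> by (auto simp: E_def)
      then have "(B t k - B s k)\<^sup>2 \<le> (2 * (K * (lam k * E)))\<^sup>2"
        by (rule power2_le_iff_abs_le[THEN iffD2, rotated]) (use K E lam_pos[of k] in auto)
      then have "(1 + lam k) * (B t k - B s k)\<^sup>2 \<le> (2 * lam k) * (2 * (K * (lam k * E)))\<^sup>2"
        using lam_ge_1[of k] by (intro mult_mono) auto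
      also have "\<dots> = 8 * K\<^sup>2 * (lam k ^ 3 * E) * E"
        by (simp add: power2_eq_square power3_eq_cube)
      also have "\<dots> \<le> 8 * K\<^sup>2 * (lam k ^ 3 * E) * 1"
        using E lam_pos[of k] by (intro mult_left_mono) auto
      finally show "\<bar>(1 + lam k) * (B t k - B s k)\<^sup>2\<bar> \<le> 8 * K\<^sup>2 * (lam k ^ 3 * exp (- (lam k * \<delta>)))"
        using lam_pos[of k] by (simp add: E_def)
    qed
  qed simp
  then have "((\<lambda>t. sqrt (\<Sum>k. (1 + lam k) * (B t k - B s k)\<^sup>2)) \<longlongrightarrow> 0) (nhds s)"
    using tendsto_real_sqrt by fastforce
  moreover have "\<forall>\<^sub>F t in nhds s. sqrt (\<Sum>k. (1 + lam k) * (B t k - B s k)\<^sup>2) = H1_norm (field (B t) - field (B s))"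
    using ev
  proof eventually_elim
    case (elim t)
    then have r: "rapid (B t)" "rapid (B s)"
      using s \<delta> by (auto intro: regular_family_rapid[OF B])
    then have "field (B t) - field (B s) = field (\<lambda>k. B t k - B s k)"
      using field_diff(1)[OF r] by (auto simp: fun_eq_iff)
    then show ?case
      using sums_unique[OF field_norm_sums(3)[OF rapid_diff[OF r]]] by (simp add: real_sqrt_unique)
  qed
  ultimately show ?thesis by (rule Lim_transform_eventually)
qed

lemma regular_family_L2_continuous:
  assumes B: "regular_family T B" and s: "s \<in> {0<..<T}"
  shows "((\<lambda>t. norm_unit (\<lambda>x. field (B t) x - field (B s) x)) \<longlongrightarrow> 0) (nhds s)"
proof (rule Lim_null_comparison[OF always_eventually regular_family_H1_continuous[OF assms]], rule allI)
  fix t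
  show "norm (norm_unit (\<lambda>x. field (B t) x - field (B s) x)) \<le> H1_norm (field (B t) - field (B s))"
    using L2_norm_le_H1_norm(1)[of "field (B t) - field (B s)"] by (simp add: fun_diff_def)
qed

lemma mode_coeff_bound:
  assumes "v \<in> L2_unit"
  shows "\<bar>mode_coeff v k\<bar> \<le> norm_unit v"
proof -
  have "(norm_unit (mode k))\<^sup>2 = 1"
    unfolding L2_norm_sq using mode_orthonormal[of k k] by (simp add: power2_eq_square)
  then have "norm_unit (mode k) = 1"
    using L2_norm_nonneg[of space_measure "mode k"] by (simp add: power2_eq_1_iff)
  then show ?thesis
    using L2_Cauchy_Schwarz[OF assms mode_L2(1), of k] by (simp add: mode_coeff_def)
qed

text \<open>Inner products with a fixed \<open>v\<close> may be differentiated term by term, as the derivatives converge uniformly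
  on compact time intervals.\<close>

lemma regular_family_inner:
  assumes B: "regular_family T B" and v: "v \<in> L2_unit"
  shows "continuous_on {0<..<T} (\<lambda>t. \<integral>x. field (B t) x * v x \<partial>space_measure)"
    "\<And>B' s. regular_family T B' \<Longrightarrow> (\<And>k t. ((\<lambda>t. B t k) has_real_derivative B' t k) (at t)) \<Longrightarrow> s \<in> {0<..<T} \<Longrightarrow>
      ((\<lambda>t. \<integral>x. field (B t) x * v x \<partial>space_measure) has_real_derivative
        (\<integral>x. field (B' s) x * v x \<partial>space_measure)) (at s)"
proof -
  show "continuous_on {0<..<T} (\<lambda>t. \<integral>x. field (B t) x * v x \<partial>space_measure)"
  proof (intro continuous_at_imp_continuous_on ballI)
    fix s assume s: "s \<in> {0<..<T}"
    obtain \<delta> where \<delta>: "\<delta> > 0" "\<delta> < s" "s < T - \<delta>" using interior_margin[OF s] .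
    have "((\<lambda>t. (\<integral>x. field (B t) x * v x \<partial>space_measure) - (\<integral>x. field (B s) x * v x \<partial>space_measure)) \<longlongrightarrow> 0) (nhds s)"
    proof (rule Lim_null_comparison)
      show "((\<lambda>t. norm_unit (\<lambda>x. field (B t) x - field (B s) x) * norm_unit v) \<longlongrightarrow> 0) (nhds s)"
        using tendsto_mult_right[OF regular_family_L2_continuous[OF B s], of "norm_unit v"] by simp
      show "\<forall>\<^sub>F t in nhds s. norm ((\<integral>x. field (B t) x * v x \<partial>space_measure) - (\<integral>x. field (B s) x * v x \<partial>space_measure))
          \<le> norm_unit (\<lambda>x. field (B t) x - field (B s) x) * norm_unit v"
        using eventually_in_margin[OF \<delta>(2,3)]
      proof eventually_elim
        case (elim t)
        then have L2: "field (B t) \<in> L2_unit" "field (B s) \<in> L2_unit"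
          using s \<delta> by (auto intro!: field_tendsto(1) regular_family_rapid[OF B])
        have "(\<integral>x. field (B t) x * v x \<partial>space_measure) - (\<integral>x. field (B s) x * v x \<partial>space_measure)
          = (\<integral>x. (field (B t) x - field (B s) x) * v x \<partial>space_measure)"
          using L2 v by (simp add: left_diff_distrib L2_integrable_mult)
        then show ?case using L2_Cauchy_Schwarz[OF L2_diff[OF L2] v] by simp
      qed
    qed
    then have "((\<lambda>t. \<integral>x. field (B t) x * v x \<partial>space_measure) \<longlongrightarrow> (\<integral>x. field (B s) x * v x \<partial>space_measure)) (nhds s)"
      by (rule LIM_zero_cancel)
    then show "isCont (\<lambda>t. \<integral>x. field (B t) x * v x \<partial>space_measure) s"
      by (simp only: isCont_iff_tendsto_nhds)
  qed
next
  fix B' s assume B': "regular_family T B'" and D: "\<And>k t. ((\<lambda>t. B t k) has_real_derivative B' t k) (at t)"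
    and s: "s \<in> {0<..<T}"
  obtain \<delta> where \<delta>: "\<delta> > 0" "\<delta> < s" "s < T - \<delta>" using interior_margin[OF s] .
  obtain K where K: "K \<ge> 0"
    "\<And>t k. \<delta> \<le> t \<Longrightarrow> t \<le> T - \<delta> \<Longrightarrow> \<bar>B' t k\<bar> \<le> K * (lam k * exp (- (lam k * \<delta>)))"
    using regular_family_bound[OF B' \<delta>(1)] by metis
  have sums: "(\<lambda>k. C t k * mode_coeff v k) sums (\<integral>x. field (C t) x * v x \<partial>space_measure)"
    if "regular_family T C" "t \<in> {\<delta>..T - \<delta>}" for C t
    using that \<delta> by (intro field_inner_sums regular_family_rapid[OF that(1)] v) auto
  have unif: "uniformly_convergent_on {\<delta>..T - \<delta>} (\<lambda>n t. \<Sum>k<n. B' t k * mode_coeff v k)"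
  proof (rule Weierstrass_m_test')
    show "summable (\<lambda>k. (K * norm_unit v) * (lam k ^ 1 * exp (- (lam k * \<delta>))))"
      by (intro summable_mult summable_lam_exp \<delta>)
    fix k t assume "t \<in> {\<delta>..T - \<delta>}"
    then have "\<bar>B' t k\<bar> * \<bar>mode_coeff v k\<bar> \<le> (K * (lam k * exp (- (lam k * \<delta>)))) * norm_unit v"
      using mode_coeff_bound[OF v] K lam_pos[of k] by (intro mult_mono) auto
    then show "norm (B' t k * mode_coeff v k) \<le> (K * norm_unit v) * (lam k ^ 1 * exp (- (lam k * \<delta>)))"
      by (simp add: abs_mult mult_ac)
  qed
  have inS: "s \<in> interior {\<delta>..T - \<delta>}" "s \<in> {\<delta>..T - \<delta>}" using \<delta> by auto
  have D_sum: "((\<lambda>t. \<Sum>k. B t k * mode_coeff v k) has_real_derivative (\<Sum>k. B' s k * mode_coeff v k)) (at s)"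
  proof (rule has_field_derivative_series'(2)[OF _ _ unif inS(2) _ inS(1)])
    show "((\<lambda>t. B t k * mode_coeff v k) has_real_derivative B' t k * mode_coeff v k) (at t within {\<delta>..T - \<delta>})" for k t
      by (intro DERIV_cmult_right has_field_derivative_at_within[OF D])
    show "summable (\<lambda>k. B s k * mode_coeff v k)"
      using sums[OF B inS(2)] by (rule sums_summable)
  qed simp
  have lim: "(\<Sum>k. B' s k * mode_coeff v k) = (\<integral>x. field (B' s) x * v x \<partial>space_measure)"
    using sums_unique[OF sums[OF B' inS(2)]] by simp
  have ev: "\<forall>\<^sub>F t in nhds s. (\<Sum>k. B t k * mode_coeff v k) = (\<integral>x. field (B t) x * v x \<partial>space_measure)"
    using eventually_in_margin[OF \<delta>(2,3)]
  proof eventually_elim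
    case (elim t)
    then show ?case using sums_unique[OF sums[OF B, of t]] by simp
  qed
  show "((\<lambda>t. \<integral>x. field (B t) x * v x \<partial>space_measure) has_real_derivative
      (\<integral>x. field (B' s) x * v x \<partial>space_measure)) (at s)"
    using DERIV_cong_ev[OF refl ev refl] D_sum lim by simp
qed


section \<open>The explicit control and trajectory\<close>

lemma integral_exp_interval:
  fixes c T :: real
  assumes "c \<noteq> 0" "T > 0"
  shows "(\<integral>t. exp (c * t) \<partial>time_measure T) = (exp (c * T) - 1) / c"
proof -
  have "(\<integral>t. exp (c * t) \<partial>time_measure T) = exp (c * T) / c - exp (c * 0) / c"
  proof (rule integral_interval_FTC)
    show "((\<lambda>t. exp (c * t) / c) has_real_derivative exp (c * t)) (at t within {0..T})" for t
      using assms(1) by (auto intro!: derivative_eq_intros)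
  qed (use assms in \<open>auto intro!: continuous_intros\<close>)
  then show ?thesis by (simp add: diff_divide_distrib)
qed

lemma square_sum_le: "(x + y)\<^sup>2 \<le> 2 * (x\<^sup>2 + y\<^sup>2)" for x y :: real
  using sum_squares_bound[of x y] by (simp add: power2_sum)

locale steering =
  fixes T :: real and y0 yT :: "real \<Rightarrow> real"
  assumes T_pos: "0 < T"
    and y0_L2: "y0 \<in> L2_unit"
    and yT_admissible: "yT \<in> admissible_targets T y0"
begin

definition initial :: "nat \<Rightarrow> real" where
  "initial k = mode_coeff y0 k"

definition gap :: "nat \<Rightarrow> real" where
  "gap k = mode_coeff yT k - exp (- (lam k * T)) * initial k"

text \<open>The reciprocal of the squared \<open>L\<^sup>2(Q)\<close> norm of the adjoint mode.\<close>

definition weight :: "nat \<Rightarrow> real" where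
  "weight k = 2 * lam k / (1 - exp (- (2 * lam k * T)))"

text \<open>The control is a combination of the adjoint modes \<open>exp (- lam k * (T - t)) e\<^sub>k\<close>, with the coefficients that
  fill the gaps.\<close>

definition U :: "real \<Rightarrow> nat \<Rightarrow> real" where
  "U t k = weight k * gap k * exp (- (lam k * (T - t)))"

text \<open>This is \<open>sinh (lam k * t) / sinh (lam k * T)\<close>, the response to the control scaled to \<open>1\<close> at time
  \<open>T\<close>. Only decaying exponentials are used, which makes its bounds visible.\<close>

definition R :: "real \<Rightarrow> nat \<Rightarrow> real" where
  "R t k = (exp (- (lam k * (T - t))) - exp (- (lam k * (T + t)))) / (1 - exp (- (2 * lam k * T)))"

definition Y :: "real \<Rightarrow> nat \<Rightarrow> real" where
  "Y t k = exp (- (lam k * t)) * initial k + gap k * R t k"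

text \<open>The time derivative of \<open>Y\<close>, as prescribed by the heat equation.\<close>

definition V :: "real \<Rightarrow> nat \<Rightarrow> real" where
  "V t k = U t k - lam k * Y t k"

lemma yT_L2: "yT \<in> L2_unit"
  using yT_admissible by (simp add: admissible_targets_def)

lemma denominator_pos: "0 < 1 - exp (- (2 * lam k * T))" "1 - exp (- (2 * lam k * T)) \<le> 1"
  using lam_pos[of k] T_pos by auto

lemma weight_ge_1: "1 \<le> weight k"
proof -
  have "1 - exp (- (2 * lam k * T)) \<le> 1" by (rule denominator_pos)
  also have "1 \<le> 2 * lam k" using lam_ge_1[of k] by simp
  finally have "1 * (1 - exp (- (2 * lam k * T))) \<le> 2 * lam k" by simp
  then show ?thesis using denominator_pos[of k] by (simp add: weight_def le_divide_eq)
qed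

lemma summable_weighted_gap: "summable (\<lambda>k. weight k * (gap k)\<^sup>2)"
  using yT_admissible
  by (simp add: admissible_targets_def Let_def eigenvalue_eq_lam fourier_coeff_eq_mode_coeff
      weight_def gap_def initial_def del: of_nat_Suc)

lemma summable_gap: "summable (\<lambda>k. (gap k)\<^sup>2)"
proof (rule summable_comparison_test'[OF summable_weighted_gap, of 0])
  show "norm ((gap k)\<^sup>2) \<le> weight k * (gap k)\<^sup>2" for k
    using mult_right_mono[OF weight_ge_1[of k], of "(gap k)\<^sup>2"] by simp
qed

lemma summable_initial: "summable (\<lambda>k. (initial k)\<^sup>2)"
  unfolding initial_def using Parseval[OF y0_L2] by (rule sums_summable)

lemma bounded_if_square_summable:
  fixes a :: "nat \<Rightarrow> real"
  assumes "summable (\<lambda>k. (a k)\<^sup>2)"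
  obtains C where "C \<ge> 0" "\<And>k. \<bar>a k\<bar> \<le> C"
proof (rule that[of "sqrt (\<Sum>k. (a k)\<^sup>2)"])
  show "\<bar>a k\<bar> \<le> sqrt (\<Sum>k. (a k)\<^sup>2)" for k
    using sum_le_suminf[OF assms, of "{k}"] by (intro real_le_rsqrt) simp
qed (intro real_sqrt_ge_zero suminf_nonneg assms, simp)

lemma R_bounds:
  assumes "0 \<le> t" "t \<le> T"
  shows "0 \<le> R t k" "R t k \<le> exp (- (lam k * (T - t)))"
proof -
  have e: "exp (- (lam k * (T + t))) = exp (- (lam k * (T - t))) * exp (- (2 * lam k * t))"
    by (simp add: algebra_simps flip: exp_add)
  have num: "exp (- (lam k * (T - t))) - exp (- (lam k * (T + t)))
      = exp (- (lam k * (T - t))) * (1 - exp (- (2 * lam k * t)))"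
    unfolding e by (simp add: algebra_simps)
  have "0 \<le> 1 - exp (- (2 * lam k * t))" using lam_pos[of k] assms by simp
  then show "0 \<le> R t k"
    unfolding R_def num using denominator_pos[of k] by (intro divide_nonneg_pos mult_nonneg_nonneg) auto
  have "1 - exp (- (2 * lam k * t)) \<le> 1 - exp (- (2 * lam k * T))"
    using lam_pos[of k] assms by simp
  then show "R t k \<le> exp (- (lam k * (T - t)))"
    unfolding R_def num using denominator_pos[of k]
    by (simp add: divide_le_eq mult_left_mono)
qed

lemma Y_bound:
  assumes "0 \<le> t" "t \<le> T"
  shows "\<bar>Y t k\<bar> \<le> exp (- (lam k * t)) * \<bar>initial k\<bar> + exp (- (lam k * (T - t))) * \<bar>gap k\<bar>"
proof -
  have "\<bar>Y t k\<bar> \<le> exp (- (lam k * t)) * \<bar>initial k\<bar> + \<bar>gap k\<bar> * R t k"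
    unfolding Y_def using R_bounds[OF assms]
    by (intro order_trans[OF abs_triangle_ineq]) (simp add: abs_mult)
  moreover have "\<bar>gap k\<bar> * R t k \<le> \<bar>gap k\<bar> * exp (- (lam k * (T - t)))"
    using R_bounds[OF assms] by (intro mult_left_mono) auto
  ultimately show ?thesis by (simp add: mult.commute)
qed

lemma Y_initial: "Y 0 k = mode_coeff y0 k"
  by (simp add: Y_def R_def initial_def)

lemma Y_final: "Y T k = mode_coeff yT k"
proof -
  have "exp (- (lam k * (T + T))) = exp (- (2 * lam k * T))" by (simp add: algebra_simps)
  then have "R T k = (1 - exp (- (2 * lam k * T))) / (1 - exp (- (2 * lam k * T)))"
    by (simp only: R_def) simp
  then have "R T k = 1" using denominator_pos(1)[of k] by (simp only: divide_self less_imp_neq[symmetric] not_False_eq_True)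
  then show ?thesis by (simp add: Y_def gap_def)
qed

lemma Y_DERIV: "((\<lambda>t. Y t k) has_real_derivative V t k) (at t)"
proof -
  have "((\<lambda>t. Y t k) has_real_derivative
      - lam k * exp (- (lam k * t)) * initial k
      + gap k * ((lam k * exp (- (lam k * (T - t))) + lam k * exp (- (lam k * (T + t))))
          / (1 - exp (- (2 * lam k * T))))) (at t)"
    unfolding Y_def R_def
    using denominator_pos(1)[of k]
    by (auto intro!: derivative_eq_intros simp: divide_simps) (simp_all add: algebra_simps)?
  moreover have "V t k = - lam k * exp (- (lam k * t)) * initial k
      + gap k * ((lam k * exp (- (lam k * (T - t))) + lam k * exp (- (lam k * (T + t))))
          / (1 - exp (- (2 * lam k * T))))"
  proof -
    have "2 * l / D * g * E - l * (e * a + g * ((E - E') / D)) = - l * e * a + g * ((l * E + l * E') / D)"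
      for l D g E E' e a :: real
      by (cases "D = 0") (simp_all add: field_simps)
    then show ?thesis unfolding V_def U_def Y_def R_def weight_def .
  qed
  ultimately show ?thesis by simp
qed

lemma continuous_on_YUV:
  "continuous_on S (\<lambda>t. Y t k)" "continuous_on S (\<lambda>t. U t k)" "continuous_on S (\<lambda>t. V t k)"
proof -
  show Y: "continuous_on S (\<lambda>t. Y t k)"
    by (intro continuous_at_imp_continuous_on ballI DERIV_isCont[OF Y_DERIV])
  show U: "continuous_on S (\<lambda>t. U t k)"
    unfolding U_def by (intro continuous_intros)
  show "continuous_on S (\<lambda>t. V t k)"
    unfolding V_def by (intro continuous_intros Y U)
qed

lemma regular_YUV: "regular_family T Y" "regular_family T U" "regular_family T V"
proof -
  obtain A where A: "A \<ge> 0" "\<And>k. \<bar>initial k\<bar> \<le> A" using bounded_if_square_summable[OF summable_initial] by metis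
  obtain D where D: "D \<ge> 0" "\<And>k. \<bar>gap k\<bar> \<le> D" using bounded_if_square_summable[OF summable_gap] by metis
  define W where "W = 2 / (1 - exp (- (2 * T)))"
  have W: "W \<ge> 0" "\<And>k. weight k \<le> W * lam k"
  proof -
    have pos: "0 < 1 - exp (- (2 * T))" using T_pos by simp
    then show "W \<ge> 0" by (simp add: W_def)
    fix k
    have "1 - exp (- (2 * T)) \<le> 1 - exp (- (2 * lam k * T))"
      using lam_ge_1[of k] T_pos by simp
    then have "2 * lam k / (1 - exp (- (2 * lam k * T))) \<le> 2 * lam k / (1 - exp (- (2 * T)))"
      using pos lam_pos[of k] by (intro divide_left_mono) auto
    then show "weight k \<le> W * lam k" by (simp add: weight_def W_def)
  qed
  have Yb: "\<bar>Y t k\<bar> \<le> (A + D) * exp (- (lam k * \<delta>))"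
    and Ub: "\<bar>U t k\<bar> \<le> (W * D) * (lam k * exp (- (lam k * \<delta>)))"
    if "\<delta> > 0" "\<delta> \<le> t" "t \<le> T - \<delta>" for t k \<delta>
  proof -
    have e: "exp (- (lam k * t)) \<le> exp (- (lam k * \<delta>))" "exp (- (lam k * (T - t))) \<le> exp (- (lam k * \<delta>))"
      using that lam_pos[of k] by auto
    have "\<bar>Y t k\<bar> \<le> exp (- (lam k * t)) * \<bar>initial k\<bar> + exp (- (lam k * (T - t))) * \<bar>gap k\<bar>"
      using that by (intro Y_bound) auto
    also have "\<dots> \<le> exp (- (lam k * \<delta>)) * A + exp (- (lam k * \<delta>)) * D"
      using e A D by (intro add_mono mult_mono) auto
    finally show "\<bar>Y t k\<bar> \<le> (A + D) * exp (- (lam k * \<delta>))" by (simp add: algebra_simps)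
    have "\<bar>U t k\<bar> = weight k * \<bar>gap k\<bar> * exp (- (lam k * (T - t)))"
      using weight_ge_1[of k] by (simp add: U_def abs_mult)
    also have "\<dots> \<le> (W * lam k) * D * exp (- (lam k * \<delta>))"
      using e D W weight_ge_1[of k] lam_pos[of k] by (intro mult_mono) auto
    finally show "\<bar>U t k\<bar> \<le> (W * D) * (lam k * exp (- (lam k * \<delta>)))" by (simp add: mult_ac)
  qed
  have scale: "(A + D) * exp (- (lam k * \<delta>)) \<le> (A + D) * (lam k * exp (- (lam k * \<delta>)))" for k \<delta>
    using lam_ge_1[of k] A D by (intro mult_left_mono) auto
  have Vb: "\<bar>V t k\<bar> \<le> (W * D + (A + D)) * (lam k * exp (- (lam k * \<delta>)))"
    if "\<delta> > 0" "\<delta> \<le> t" "t \<le> T - \<delta>" for t k \<delta>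
  proof -
    have "\<bar>V t k\<bar> \<le> \<bar>U t k\<bar> + lam k * \<bar>Y t k\<bar>"
      unfolding V_def using lam_pos[of k] by (intro order_trans[OF abs_triangle_ineq4]) (simp add: abs_mult)
    also have "\<dots> \<le> (W * D) * (lam k * exp (- (lam k * \<delta>))) + lam k * ((A + D) * exp (- (lam k * \<delta>)))"
      using Ub[OF that] Yb[OF that] lam_pos[of k] by (intro add_mono mult_left_mono) auto
    finally show ?thesis by (simp add: algebra_simps)
  qed
  show "regular_family T Y"
    unfolding regular_family_def
    using order_trans[OF Yb scale] A D by (auto intro!: continuous_on_YUV exI[of _ "A + D"])
  show "regular_family T U"
    unfolding regular_family_def
    using Ub W D by (auto intro!: continuous_on_YUV exI[of _ "W * D"])
  show "regular_family T V"
    unfolding regular_family_def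
    using Vb W D A by (auto intro!: continuous_on_YUV exI[of _ "W * D + (A + D)"])
qed

lemma rapid_YUV:
  assumes "t \<in> {0<..<T}"
  shows "rapid (Y t)" "rapid (U t)" "rapid (V t)"
  using regular_family_rapid[OF _ assms] regular_YUV by auto

text \<open>At the end points the sine series need not converge pointwise, so the given functions are taken there.\<close>

definition trajectory :: "real \<Rightarrow> real \<Rightarrow> real" where
  "trajectory t = (if t \<le> 0 then y0 else if T \<le> t then yT else field (Y t))"

definition control :: "real \<times> real \<Rightarrow> real" where
  "control = (\<lambda>(x, t). field (U t) x)"

lemma trajectory_L2:
  "trajectory t \<in> L2_unit"
  using y0_L2 yT_L2 rapid_YUV(1)[of t] by (auto simp: trajectory_def intro: field_tendsto(1))

lemma mode_coeff_trajectory: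
  assumes "t \<in> {0..T}"
  shows "mode_coeff (trajectory t) k = Y t k"
proof -
  consider "t = 0" | "t = T" | "t \<in> {0<..<T}" using assms by fastforce
  then show ?thesis
    using T_pos
    by cases (auto simp: trajectory_def Y_initial Y_final intro!: mode_coeff_field rapid_YUV(1))
qed

text \<open>By Parseval's identity and dominated convergence of the series, continuity up to the end
  points only needs the square summable bound \<open>\<bar>initial k\<bar> + \<bar>gap k\<bar>\<close> on the coefficients.\<close>

lemma trajectory_continuous: "continuous_into_L2 T trajectory"
  unfolding continuous_into_L2_def
proof (intro conjI ballI trajectory_L2)
  fix s assume s: "s \<in> {0..T}"
  define F where "F = (at s within {0..T})"
  have F: "F \<noteq> bot"
    using T_pos s trivial_limit_within[of s "{0..T}"] islimpt_Icc[of 0 T s] by (simp add: F_def)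
  have inF: "\<forall>\<^sub>F t in F. t \<in> {0..T}" unfolding F_def eventually_at_filter by simp
  have "((\<lambda>t. \<Sum>k. (Y t k - Y s k)\<^sup>2) \<longlongrightarrow> (\<Sum>k::nat. 0)) F"
  proof (rule tendsto_suminf_dominated[OF _ _ _ F])
    show "((\<lambda>t. (Y t k - Y s k)\<^sup>2) \<longlongrightarrow> 0) F" for k
    proof -
      have "((\<lambda>t. Y t k) \<longlongrightarrow> Y s k) F"
        using continuous_on_YUV(1)[of "{0..T}" k] s unfolding F_def by (simp add: continuous_on)
      then have "((\<lambda>t. (Y t k - Y s k)\<^sup>2) \<longlongrightarrow> (Y s k - Y s k)\<^sup>2) F" by (intro tendsto_intros)
      then show ?thesis by simp
    qed
    show "summable (\<lambda>k. 8 * (initial k)\<^sup>2 + 8 * (gap k)\<^sup>2)"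
      by (intro summable_add summable_mult summable_initial summable_gap)
    have bound: "\<bar>Y t k\<bar> \<le> \<bar>initial k\<bar> + \<bar>gap k\<bar>" if "t \<in> {0..T}" for t k
    proof -
      have "exp (- (lam k * t)) * \<bar>initial k\<bar> + exp (- (lam k * (T - t))) * \<bar>gap k\<bar>
          \<le> 1 * \<bar>initial k\<bar> + 1 * \<bar>gap k\<bar>"
        using that lam_pos[of k] by (intro add_mono mult_right_mono) auto
      then show ?thesis using Y_bound[of t k] that by simp
    qed
    show "\<forall>\<^sub>F t in F. \<forall>k. \<bar>(Y t k - Y s k)\<^sup>2\<bar> \<le> 8 * (initial k)\<^sup>2 + 8 * (gap k)\<^sup>2"
      using inF
    proof (eventually_elim, intro allI)
      fix t k assume t: "t \<in> {0..T}"
      have "\<bar>Y t k - Y s k\<bar> \<le> 2 * (\<bar>initial k\<bar> + \<bar>gap k\<bar>)"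
        using bound[OF t, of k] bound[OF s, of k] abs_triangle_ineq4[of "Y t k" "Y s k"] by argo
      then have "(Y t k - Y s k)\<^sup>2 \<le> (2 * (\<bar>initial k\<bar> + \<bar>gap k\<bar>))\<^sup>2"
        by (rule power2_le_iff_abs_le[THEN iffD2, rotated]) auto
      also have "\<dots> = 4 * (\<bar>initial k\<bar> + \<bar>gap k\<bar>)\<^sup>2" by (simp only: power_mult_distrib) simp
      also have "\<dots> \<le> 8 * (initial k)\<^sup>2 + 8 * (gap k)\<^sup>2"
        using square_sum_le[of "\<bar>initial k\<bar>" "\<bar>gap k\<bar>"] by simp
      finally show "\<bar>(Y t k - Y s k)\<^sup>2\<bar> \<le> 8 * (initial k)\<^sup>2 + 8 * (gap k)\<^sup>2" by simp
    qed
  qed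
  then have "((\<lambda>t. sqrt (\<Sum>k. (Y t k - Y s k)\<^sup>2)) \<longlongrightarrow> 0) F"
    using tendsto_real_sqrt[of _ 0 F] by simp
  moreover have "\<forall>\<^sub>F t in F. sqrt (\<Sum>k. (Y t k - Y s k)\<^sup>2) = norm_unit (trajectory t - trajectory s)"
    using inF
  proof eventually_elim
    case (elim t)
    have "mode_coeff (\<lambda>x. trajectory t x - trajectory s x) k = Y t k - Y s k" for k
      using mode_coeff_trajectory[OF elim, of k] mode_coeff_trajectory[OF s, of k]
        L2_integrable_mult[OF trajectory_L2 mode_L2(1)]
      by (simp add: mode_coeff_def left_diff_distrib)
    then have "(\<lambda>k. (Y t k - Y s k)\<^sup>2) sums (norm_unit (\<lambda>x. trajectory t x - trajectory s x))\<^sup>2"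
      using Parseval[OF L2_diff[OF trajectory_L2 trajectory_L2], of t s] by simp
    from real_sqrt_unique[OF sums_unique[OF this] L2_norm_nonneg] show ?case
      by (simp add: fun_diff_def)
  qed
  ultimately show "((\<lambda>t. norm_unit (trajectory t - trajectory s)) \<longlongrightarrow> 0) (at s within {0..T})"
    unfolding F_def by (rule Lim_transform_eventually)
qed

text \<open>Monotone convergence for a series whose terms have summable integrals.\<close>

lemma series_integral_interval:
  assumes cont: "\<And>k. continuous_on {0..T} (f k)" and nonneg: "\<And>k t. 0 \<le> (f k t :: real)"
    and sum: "\<And>t. t \<in> {0<..<T} \<Longrightarrow> summable (\<lambda>k. f k t)"
    and int: "\<And>k. (\<integral>t. f k t \<partial>time_measure T) \<le> M k" and M: "summable M"
  shows "integrable (time_measure T) (\<lambda>t. \<Sum>k. f k t)"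
    "(\<integral>t. (\<Sum>k. f k t) \<partial>time_measure T) = (\<Sum>k. \<integral>t. f k t \<partial>time_measure T)"
proof -
  have i: "integrable (time_measure T) (f k)" for k
    by (rule integrable_continuous_interval[OF cont])
  have ae: "AE t in time_measure T. summable (\<lambda>k. norm (f k t))"
    using sum nonneg by (intro AE_interval) auto
  have s: "summable (\<lambda>k. \<integral>t. norm (f k t) \<partial>time_measure T)"
  proof (rule summable_comparison_test'[OF M, of 0])
    show "norm (\<integral>t. norm (f k t) \<partial>time_measure T) \<le> M k" for k
      using int[of k] nonneg[of k] by (simp add: integral_nonneg_AE)
  qed
  show "integrable (time_measure T) (\<lambda>t. \<Sum>k. f k t)"
    "(\<integral>t. (\<Sum>k. f k t) \<partial>time_measure T) = (\<Sum>k. \<integral>t. f k t \<partial>time_measure T)"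
    by (rule integrable_suminf[OF i ae s], rule integral_suminf[OF i ae s])
qed

text \<open>Parabolic smoothing: integrating the squared exponentials in time gains the factor \<open>1 / lam k\<close> that
  compensates \<open>1 + lam k\<close>.\<close>

lemma trajectory_energy:
  "integrable (time_measure T) (\<lambda>t. \<Sum>k. (1 + lam k) * (Y t k)\<^sup>2)"
proof (rule series_integral_interval(1))
  show "continuous_on {0..T} (\<lambda>t. (1 + lam k) * (Y t k)\<^sup>2)" for k
    by (intro continuous_intros continuous_on_YUV)
  show "0 \<le> (1 + lam k) * (Y t k)\<^sup>2" for k t using lam_pos[of k] by simp
  show "summable (\<lambda>k. (1 + lam k) * (Y t k)\<^sup>2)" if "t \<in> {0<..<T}" for t
    using field_norm_sums(3)[OF rapid_YUV(1)[OF that]] by (rule sums_summable)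
  show "summable (\<lambda>k. 2 * ((initial k)\<^sup>2 + (gap k)\<^sup>2))"
    by (intro summable_add summable_mult summable_initial summable_gap)
  fix k
  define L where "L = lam k"
  have L: "1 \<le> L" unfolding L_def by (rule lam_ge_1)
  define h where "h t = (1 + L) * (2 * ((initial k)\<^sup>2 * exp (- (2 * L) * t)
      + (gap k)\<^sup>2 * exp (- (2 * L * T)) * exp (2 * L * t)))" for t
  have "(1 + lam k) * (Y t k)\<^sup>2 \<le> h t" if "0 < t" "t < T" for t
  proof -
    have "(Y t k)\<^sup>2 \<le> (exp (- (L * t)) * \<bar>initial k\<bar> + exp (- (L * (T - t))) * \<bar>gap k\<bar>)\<^sup>2"
      using Y_bound[of t k] that unfolding L_def by (intro power2_le_iff_abs_le[THEN iffD2]) auto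
    also have "\<dots> \<le> 2 * ((exp (- (L * t)) * \<bar>initial k\<bar>)\<^sup>2 + (exp (- (L * (T - t))) * \<bar>gap k\<bar>)\<^sup>2)"
      by (rule square_sum_le)
    also have "(exp (- (L * t)) * \<bar>initial k\<bar>)\<^sup>2 = (initial k)\<^sup>2 * exp (- (2 * L) * t)"
      by (simp add: power_mult_distrib exp_double[symmetric] mult_ac)
    also have "(exp (- (L * (T - t))) * \<bar>gap k\<bar>)\<^sup>2 = (gap k)\<^sup>2 * exp (- (2 * L * T)) * exp (2 * L * t)"
      by (simp add: power_mult_distrib exp_double[symmetric] mult_ac algebra_simps flip: exp_add)
    finally show ?thesis unfolding h_def L_def[symmetric] using L by (intro mult_left_mono) auto
  qed
  moreover have conth: "continuous_on {0..T} h" unfolding h_def by (intro continuous_intros)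
  ultimately have "(\<integral>t. (1 + lam k) * (Y t k)\<^sup>2 \<partial>time_measure T) \<le> (\<integral>t. h t \<partial>time_measure T)"
    by (intro integral_mono_AE integrable_continuous_interval AE_interval continuous_intros continuous_on_YUV) auto
  also have "\<dots> = (1 + L) * (2 * ((initial k)\<^sup>2 * (\<integral>t. exp (- (2 * L) * t) \<partial>time_measure T)
      + (gap k)\<^sup>2 * exp (- (2 * L * T)) * (\<integral>t. exp (2 * L * t) \<partial>time_measure T)))"
    unfolding h_def
    by (simp add: integrable_continuous_interval continuous_intros)
  also have "\<dots> = (1 + L) / L * ((1 - exp (- (2 * L * T))) * ((initial k)\<^sup>2 + (gap k)\<^sup>2))"
    using L T_pos by (subst (1 2) integral_exp_interval) (auto simp: field_simps simp flip: exp_add)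
  also have "\<dots> \<le> 2 * (1 * ((initial k)\<^sup>2 + (gap k)\<^sup>2))"
  proof (intro mult_mono)
    show "(1 + L) / L \<le> 2" using L by (simp add: divide_le_eq)
    show "1 - exp (- (2 * L * T)) \<le> 1" by simp
    show "0 \<le> (1 - exp (- (2 * L * T))) * ((initial k)\<^sup>2 + (gap k)\<^sup>2)"
      using L T_pos by (intro mult_nonneg_nonneg) auto
  qed auto
  finally show "(\<integral>t. (1 + lam k) * (Y t k)\<^sup>2 \<partial>time_measure T) \<le> 2 * ((initial k)\<^sup>2 + (gap k)\<^sup>2)"
    by simp
qed

lemma integral_U_sq: "(\<integral>t. (U t k)\<^sup>2 \<partial>time_measure T) = weight k * (gap k)\<^sup>2"
proof -
  have "(U t k)\<^sup>2 = (weight k * gap k)\<^sup>2 * exp (- (2 * lam k * T)) * exp (2 * lam k * t)" for t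
    by (simp add: U_def power_mult_distrib exp_double[symmetric] mult_ac algebra_simps flip: exp_add)
  then have "(\<integral>t. (U t k)\<^sup>2 \<partial>time_measure T)
      = (weight k * gap k)\<^sup>2 * exp (- (2 * lam k * T)) * ((exp (2 * lam k * T) - 1) / (2 * lam k))"
    using lam_pos[of k] T_pos integral_exp_interval[of "2 * lam k" T] by simp
  also have "\<dots> = (weight k * gap k)\<^sup>2 * ((1 - exp (- (2 * lam k * T))) / (2 * lam k))"
    by (simp add: right_diff_distrib flip: exp_add)
  also have "(1 - exp (- (2 * lam k * T))) / (2 * lam k) = 1 / weight k"
    by (simp add: weight_def)
  finally show ?thesis using weight_ge_1[of k] by (simp add: power2_eq_square field_simps)
qed

lemma control_energy:
  "integrable (time_measure T) (\<lambda>t. \<Sum>k. (U t k)\<^sup>2)"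
  "(\<integral>t. (\<Sum>k. (U t k)\<^sup>2) \<partial>time_measure T) = (\<Sum>k. weight k * (gap k)\<^sup>2)"
proof -
  have *: "continuous_on {0..T} (\<lambda>t. (U t k)\<^sup>2)" "(\<integral>t. (U t k)\<^sup>2 \<partial>time_measure T) \<le> weight k * (gap k)\<^sup>2" for k
    using integral_U_sq by (auto intro!: continuous_intros continuous_on_YUV)
  have s: "summable (\<lambda>k. (U t k)\<^sup>2)" if "t \<in> {0<..<T}" for t
    using field_norm_sums(1)[OF rapid_YUV(2)[OF that]] by (rule sums_summable)
  show "integrable (time_measure T) (\<lambda>t. \<Sum>k. (U t k)\<^sup>2)"
    by (rule series_integral_interval(1)[OF *(1) _ s *(2) summable_weighted_gap]) auto
  show "(\<integral>t. (\<Sum>k. (U t k)\<^sup>2) \<partial>time_measure T) = (\<Sum>k. weight k * (gap k)\<^sup>2)"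
    using series_integral_interval(2)[OF *(1) _ s *(2) summable_weighted_gap] integral_U_sq by simp
qed

lemma trajectory_bochner: "trajectory \<in> bochner_L2 (time_measure T) H10 H1_norm"
proof (rule bochner_L2_continuous[OF T_pos])
  show "trajectory t \<in> H10" if "t \<in> {0<..<T}" for t
    using that field_H10(1)[OF rapid_YUV(1)] by (simp add: trajectory_def)
  show "((\<lambda>r. H1_norm (trajectory r - trajectory t)) \<longlongrightarrow> 0) (nhds t)" if t: "t \<in> {0<..<T}" for t
  proof (rule Lim_transform_eventually[OF regular_family_H1_continuous[OF regular_YUV(1) t]])
    have "\<forall>\<^sub>F r in nhds t. r \<in> {0<..<T}" using t by (intro eventually_nhds_in_open) auto
    then show "\<forall>\<^sub>F r in nhds t. H1_norm (field (Y r) - field (Y t)) = H1_norm (trajectory r - trajectory t)"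
      by eventually_elim (use t in \<open>simp add: trajectory_def\<close>)
  qed
  have "(\<Sum>k. (1 + lam k) * (Y t k)\<^sup>2) = (H1_norm (trajectory t))\<^sup>2" if "t \<in> {0<..<T}" for t
    using that sums_unique[OF field_norm_sums(3)[OF rapid_YUV(1)[OF that]]] by (simp add: trajectory_def)
  then show "integrable (time_measure T) (\<lambda>t. (H1_norm (trajectory t))\<^sup>2)"
    using trajectory_energy
    by (subst Bochner_Integration.integrable_cong[OF refl, of _ _ "\<lambda>t. \<Sum>k. (1 + lam k) * (Y t k)\<^sup>2"]) auto
qed

definition velocity :: "real \<Rightarrow> (real \<Rightarrow> real) \<Rightarrow> real" where
  "velocity t = L2_functional (field (V t))"

lemma heat_equation:
  assumes t: "t \<in> {0<..<T}" and v: "v \<in> H10"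
  shows "velocity t v + (\<integral>x. weak_deriv (trajectory t) x * weak_deriv v x \<partial>space_measure)
    = (\<integral>x. field (U t) x * v x \<partial>space_measure)"
proof -
  note r = rapid_YUV[OF t]
  have "(\<integral>x. weak_deriv (field (Y t)) x * weak_deriv v x \<partial>space_measure)
      = (\<integral>x. field' (Y t) x * weak_deriv v x \<partial>space_measure)"
    using field_H10(3)[OF r(1)] H10_L2(2)[OF v] H10_L2(2)[OF field_H10(1)[OF r(1)]]
    by (intro integral_cong_AE) (auto elim!: eventually_mono dest: L2_measurable)
  then have "(\<lambda>k. lam k * Y t k * mode_coeff v k)
      sums (\<integral>x. weak_deriv (trajectory t) x * weak_deriv v x \<partial>space_measure)"
    using field'_inner_sums[OF r(1) v] t by (simp add: trajectory_def)
  from sums_add[OF field_inner_sums[OF r(3) H10_L2(1)[OF v]] this]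
  have "(\<lambda>k. U t k * mode_coeff v k)
      sums (velocity t v + (\<integral>x. weak_deriv (trajectory t) x * weak_deriv v x \<partial>space_measure))"
    by (simp add: velocity_def L2_functional_def V_def algebra_simps)
  then show ?thesis
    using field_inner_sums[OF r(2) H10_L2(1)[OF v]] by (rule sums_unique2)
qed

text \<open>The velocity is continuous in \<open>H\<^sup>-\<^sup>1\<close> at interior times. Its \<open>H\<^sup>-\<^sup>1\<close> norm is estimated through the heat
  equation by the norms of the control and of the state, which are square integrable in time; its \<open>L\<^sup>2\<close>
  norm need not be.\<close>

lemma velocity_bochner: "velocity \<in> bochner_L2 (time_measure T) Hm1 Hm1_norm"
proof (rule bochner_L2_continuous[OF T_pos])
  have L2: "field (V t) \<in> L2_unit" if "t \<in> {0<..<T}" for t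
    by (rule field_tendsto(1)[OF rapid_YUV(3)[OF that]])
  show "velocity t \<in> Hm1" if "t \<in> {0<..<T}" for t
    unfolding velocity_def by (rule L2_functional_Hm1[OF L2[OF that]])
  have in_nhds: "\<forall>\<^sub>F r in nhds t. r \<in> {0<..<T}" if "t \<in> {0<..<T}" for t
    using that by (intro eventually_nhds_in_open) auto
  show "((\<lambda>r. Hm1_norm (velocity r - velocity t)) \<longlongrightarrow> 0) (nhds t)" if t: "t \<in> {0<..<T}" for t
  proof (rule Lim_null_comparison[OF _ regular_family_L2_continuous[OF regular_YUV(3) t]])
    show "\<forall>\<^sub>F r in nhds t. norm (Hm1_norm (velocity r - velocity t))
        \<le> norm_unit (\<lambda>x. field (V r) x - field (V t) x)"
      using in_nhds[OF t]
    proof eventually_elim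
      case (elim r)
      from Hm1_norm_L2_functional_diff(1,2)[OF L2[OF elim] L2[OF t]]
      show ?case unfolding velocity_def by simp
    qed
  qed
  have "continuous_on {0<..<T} (\<lambda>t. Hm1_norm (velocity t))"
  proof (intro continuous_at_imp_continuous_on ballI)
    fix t assume t: "t \<in> {0<..<T}"
    have "((\<lambda>r. Hm1_norm (velocity r) - Hm1_norm (velocity t)) \<longlongrightarrow> 0) (nhds t)"
    proof (rule Lim_null_comparison[OF _ regular_family_L2_continuous[OF regular_YUV(3) t]])
      show "\<forall>\<^sub>F r in nhds t. norm (Hm1_norm (velocity r) - Hm1_norm (velocity t))
          \<le> norm_unit (\<lambda>x. field (V r) x - field (V t) x)"
        using in_nhds[OF t]
      proof eventually_elim
        case (elim r)
        from Hm1_norm_L2_functional_diff(3)[OF L2[OF elim] L2[OF t]]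
        show ?case unfolding velocity_def by simp
      qed
    qed
    then show "isCont (\<lambda>t. Hm1_norm (velocity t)) t"
      unfolding isCont_iff_tendsto_nhds by (rule LIM_zero_cancel)
  qed
  then have meas: "(\<lambda>t. Hm1_norm (velocity t)) \<in> borel_measurable (time_measure T)"
    by (rule continuous_on_borel_measurable_interval)
  show "integrable (time_measure T) (\<lambda>t. (Hm1_norm (velocity t))\<^sup>2)"
  proof (rule Bochner_Integration.integrable_bound)
    show "integrable (time_measure T) (\<lambda>t. 2 * (\<Sum>k. (U t k)\<^sup>2) + 2 * (\<Sum>k. (1 + lam k) * (Y t k)\<^sup>2))"
      by (intro Bochner_Integration.integrable_add integrable_mult_right control_energy trajectory_energy)
    show "AE t in time_measure T. norm ((Hm1_norm (velocity t))\<^sup>2)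
        \<le> norm (2 * (\<Sum>k. (U t k)\<^sup>2) + 2 * (\<Sum>k. (1 + lam k) * (Y t k)\<^sup>2))"
    proof (rule AE_interval)
      fix t assume "0 < t" "t < T"
      then have t: "t \<in> {0<..<T}" by simp
      note r = rapid_YUV[OF t]
      define N where "N = norm_unit (field (U t))"
      define H where "H = H1_norm (field (Y t))"
      have NH: "0 \<le> N" "0 \<le> H" by (simp_all add: N_def H_def)
      have N: "N\<^sup>2 = (\<Sum>k. (U t k)\<^sup>2)" unfolding N_def using sums_unique[OF field_norm_sums(1)[OF r(2)]] by simp
      have H: "H\<^sup>2 = (\<Sum>k. (1 + lam k) * (Y t k)\<^sup>2)" unfolding H_def using sums_unique[OF field_norm_sums(3)[OF r(1)]] by simp
      have "Hm1_norm (velocity t) \<le> N + H"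
      proof (rule Hm1_norm_le)
        fix v assume v: "v \<in> H10"
        have tr: "trajectory t = field (Y t)" using t by (simp add: trajectory_def)
        have "\<bar>\<integral>x. field (U t) x * v x \<partial>space_measure\<bar> \<le> N * H1_norm v"
          using L2_functional_bound[OF field_tendsto(1)[OF r(2)] v] by (simp add: N_def L2_functional_def)
        moreover have "\<bar>\<integral>x. weak_deriv (field (Y t)) x * weak_deriv v x \<partial>space_measure\<bar> \<le> H * H1_norm v"
          unfolding H_def
          by (rule order_trans[OF L2_Cauchy_Schwarz[OF H10_L2(2)[OF field_H10(1)[OF r(1)]] H10_L2(2)[OF v]]])
             (intro mult_mono L2_norm_le_H1_norm; simp)
        ultimately show "\<bar>velocity t v\<bar> \<le> (N + H) * H1_norm v"
          using heat_equation[OF t v] unfolding tr by (simp only: distrib_right)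
      qed (use NH in simp)
      moreover have "0 \<le> Hm1_norm (velocity t)"
        unfolding velocity_def by (rule Hm1_norm_nonneg[OF L2[OF t]])
      ultimately have "(Hm1_norm (velocity t))\<^sup>2 \<le> (N + H)\<^sup>2" by (intro power_mono)
      also have "\<dots> \<le> 2 * N\<^sup>2 + 2 * H\<^sup>2"
        using square_sum_le[of N H] by simp
      finally show "norm ((Hm1_norm (velocity t))\<^sup>2)
        \<le> norm (2 * (\<Sum>k. (U t k)\<^sup>2) + 2 * (\<Sum>k. (1 + lam k) * (Y t k)\<^sup>2))"
        by (simp add: N H)
    qed
  qed (use meas in measurable)
qed

text \<open>At interior times the derivative exists classically, and the test function keeps away from the end
  points.\<close>

lemma velocity_is_time_deriv: "is_time_deriv T trajectory velocity"
  unfolding is_time_deriv_def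
proof (intro ballI)
  fix \<phi> v assume phi: "\<phi> \<in> test_functions 0 T" and v: "v \<in> H10"
  note v2 = H10_L2(1)[OF v]
  have "(\<integral>t. deriv \<phi> t * (\<integral>x. field (Y t) x * v x \<partial>space_measure) \<partial>time_measure T)
      = - (\<integral>t. \<phi> t * (\<integral>x. field (V t) x * v x \<partial>space_measure) \<partial>time_measure T)"
    using T_pos regular_family_inner[OF regular_YUV(3) v2] regular_family_inner(2)[OF regular_YUV(1) v2 regular_YUV(3) Y_DERIV]
    by (intro integral_by_parts_test_function[OF phi]) auto
  moreover have "(\<integral>t. deriv \<phi> t * (\<integral>x. trajectory t x * v x \<partial>space_measure) \<partial>time_measure T)
      = (\<integral>t. deriv \<phi> t * (\<integral>x. field (Y t) x * v x \<partial>space_measure) \<partial>time_measure T)"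
    by (intro Bochner_Integration.integral_cong) (auto simp: trajectory_def)
  ultimately show "(\<integral>t. deriv \<phi> t * (\<integral>x. trajectory t x * v x \<partial>space_measure) \<partial>time_measure T)
      = - (\<integral>t. \<phi> t * velocity t v \<partial>time_measure T)"
    by (simp add: velocity_def L2_functional_def)
qed

lemma control_steers: "steers T y0 yT control"
  unfolding steers_def
proof (intro exI conjI)
  show "weak_solution T y0 control trajectory"
    unfolding weak_solution_def
  proof (intro conjI trajectory_continuous trajectory_bochner bexI[OF _ velocity_bochner] velocity_is_time_deriv)
    show "AE t in time_measure T. \<forall>v\<in>H10.
        velocity t v + (\<integral>x. weak_deriv (trajectory t) x * weak_deriv v x \<partial>space_measure) =
        (\<integral>x. control (x, t) * v x \<partial>space_measure)"
      using heat_equation by (intro AE_interval) (simp add: control_def)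
    show "AE x in space_measure. trajectory 0 x = y0 x" by (simp add: trajectory_def)
  qed
  show "AE x in space_measure. trajectory T x = yT x" using T_pos by (simp add: trajectory_def)
qed

end


section \<open>Iterated integrals over the space-time cylinder\<close>

lemma lebesgue_on_borel:
  fixes f :: "'a::euclidean_space \<Rightarrow> real"
  assumes "S \<in> sets borel" "f \<in> borel_measurable borel"
  shows "integrable (lebesgue_on S) f \<longleftrightarrow> integrable lborel (\<lambda>x. indicator S x * f x)"
    "(\<integral>x. f x \<partial>lebesgue_on S) = (\<integral>x. indicator S x * f x \<partial>lborel)"
proof -
  have S: "S \<inter> space lebesgue \<in> sets lebesgue" using assms(1) by simp
  have m: "(\<lambda>x. indicator S x * f x) \<in> borel_measurable lborel" using assms by measurable
  show "integrable (lebesgue_on S) f \<longleftrightarrow> integrable lborel (\<lambda>x. indicator S x * f x)"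
    using integrable_restrict_space[OF S, of f] integrable_completion[OF m] by simp
  show "(\<integral>x. f x \<partial>lebesgue_on S) = (\<integral>x. indicator S x * f x \<partial>lborel)"
    using integral_restrict_space[OF S, of f] integral_completion[OF m] by simp
qed

text \<open>Lebesgue measure is complete.\<close>

lemma measurable_lebesgue_on_AE:
  fixes f g :: "'a::euclidean_space \<Rightarrow> real"
  assumes "f \<in> borel_measurable (lebesgue_on S)" "AE x in lebesgue_on S. g x = f x" "S \<in> sets lebesgue"
  shows "g \<in> borel_measurable (lebesgue_on S)"
proof -
  have "AE x in lebesgue. x \<in> S \<longrightarrow> g x = f x"
    using assms by (simp add: AE_restrict_space_iff)
  then obtain N where N: "N \<in> null_sets lebesgue" "{x. \<not> (x \<in> S \<longrightarrow> g x = f x)} \<subseteq> N"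
    unfolding eventually_ae_filter by auto
  have "f measurable_on S" using assms by (simp add: measurable_on_iff_borel_measurable)
  then have "g measurable_on S"
    by (rule measurable_on_spike[where S = N]) (use N in \<open>auto simp: negligible_iff_null_sets\<close>)
  then show ?thesis using assms by (simp add: measurable_on_iff_borel_measurable)
qed

lemma Q_set_borel: "{0<..<1::real} \<times> {0<..<T::real} \<in> sets borel"
  by (intro borel_open open_Times) auto

lemma indicator_Q:
  "indicator ({0<..<1} \<times> {0<..<T}) (x, t) = (indicator {0<..<T} t * indicator {0<..<1} x :: real)" for x t T :: real
  by (simp split: split_indicator)

text \<open>Fubini's theorem for functions that are only Lebesgue measurable in the plane, by passing to a
  Borel function which agrees with them almost everywhere.\<close>

lemma Q_Fubini:
  fixes f :: "real \<times> real \<Rightarrow> real"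
  assumes f: "integrable (Q_measure T) f"
  shows "integrable (time_measure T) (\<lambda>t. \<integral>x. f (x, t) \<partial>space_measure)"
    "(\<integral>p. f p \<partial>Q_measure T) = (\<integral>t. (\<integral>x. f (x, t) \<partial>space_measure) \<partial>time_measure T)"
proof -
  define Q where "Q = {0<..<1::real} \<times> {0<..<T}"
  have Q: "Q \<in> sets borel" "Q \<in> sets lebesgue" using Q_set_borel[of T] by (auto simp: Q_def)
  have "(\<lambda>p. if p \<in> Q then f p else 0) \<in> borel_measurable lebesgue"
    using f Q(2) unfolding Q_def by (intro borel_measurable_if_I) auto
  then obtain h where h: "h \<in> borel_measurable borel" and ae0: "AE p in lborel. (if p \<in> Q then f p else 0) = h p"
    using completion_ex_borel_measurable_real by force
  define H where "H p = indicator Q p * h p" for p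
  have H: "H \<in> borel_measurable borel" unfolding H_def[abs_def] using h Q by measurable
  have aeQ: "AE p in Q_measure T. f p = H p"
  proof -
    have "AE p in lebesgue. (if p \<in> Q then f p else 0) = h p" using ae0 by (rule AE_completion)
    then show ?thesis
      unfolding Q_def[symmetric] using Q(2)
      by (subst AE_restrict_space_iff) (auto elim!: eventually_mono simp: H_def)
  qed
  have HM: "H \<in> borel_measurable (Q_measure T)"
    using H by (intro measurable_restrict_space1 measurable_completion) simp
  have intQ: "integrable (Q_measure T) H" "(\<integral>p. f p \<partial>Q_measure T) = (\<integral>p. H p \<partial>Q_measure T)"
    using f aeQ HM by (auto intro: integrable_cong_AE_imp integral_cong_AE)
  have QH: "(\<lambda>p. indicator Q p * H p) = H" by (auto simp: H_def fun_eq_iff split: split_indicator)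
  have intH: "integrable (lborel \<Otimes>\<^sub>M lborel) (\<lambda>(x, t). H (x, t))"
    using intQ(1) lebesgue_on_borel(1)[OF Q(1) H] unfolding Q_def[symmetric] QH by (simp add: lborel_prod)
  have eqQ: "(\<integral>p. f p \<partial>Q_measure T) = (\<integral>p. (\<lambda>(x, t). H (x, t)) p \<partial>(lborel \<Otimes>\<^sub>M lborel))"
    using intQ(2) lebesgue_on_borel(2)[OF Q(1) H] unfolding Q_def[symmetric] QH by (simp add: lborel_prod)
  have sec: "(\<lambda>x. H (x, t)) \<in> borel_measurable borel" for t
    using H by measurable
  have inner: "(\<integral>x. H (x, t) \<partial>lborel) = indicator {0<..<T} t * (\<integral>x. H (x, t) \<partial>space_measure)" for t
  proof -
    have "(\<integral>x. H (x, t) \<partial>lborel) = (\<integral>x. indicator {0<..<T} t * (indicator {0<..<1} x * H (x, t)) \<partial>lborel)"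
      by (intro Bochner_Integration.integral_cong) (auto simp: H_def Q_def split: split_indicator)
    then show ?thesis
      using lebesgue_on_borel(2)[of "{0<..<1}" "\<lambda>x. H (x, t)"] sec by simp
  qed
  have innerM: "(\<lambda>t. \<integral>x. H (x, t) \<partial>lborel) \<in> borel_measurable borel"
    using H by measurable
  have I1: "integrable lborel (\<lambda>t. \<integral>x. H (x, t) \<partial>lborel)"
    by (rule lborel_pair.integrable_snd[OF intH])
  have I2: "(\<integral>t. (\<integral>x. H (x, t) \<partial>lborel) \<partial>lborel) = (\<integral>p. f p \<partial>Q_measure T)"
    unfolding eqQ by (rule lborel_pair.integral_snd[OF intH])
  have ind: "(\<lambda>t. indicator {0<..<T} t * (\<integral>x. H (x, t) \<partial>lborel)) = (\<lambda>t. \<integral>x. H (x, t) \<partial>lborel)"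
    unfolding inner by (auto simp: fun_eq_iff split: split_indicator)
  have J: "integrable (time_measure T) (\<lambda>t. \<integral>x. H (x, t) \<partial>lborel)"
    "(\<integral>t. (\<integral>x. H (x, t) \<partial>lborel) \<partial>time_measure T) = (\<integral>p. f p \<partial>Q_measure T)"
    using lebesgue_on_borel[of "{0<..<T}", OF _ innerM] I1 I2 unfolding ind by simp_all
  have "AE p in lborel \<Otimes>\<^sub>M lborel. f p = H p \<or> p \<notin> Q"
    unfolding lborel_prod using ae0 by eventually_elim (auto simp: H_def)
  then obtain N where N: "N \<in> null_sets (lborel \<Otimes>\<^sub>M lborel)" "{p. \<not> (f p = H p \<or> p \<notin> Q)} \<subseteq> N"
    unfolding eventually_ae_filter by (auto simp: space_pair_measure)
  have "AE x in lborel. AE t in lborel. (x, t) \<notin> N"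
    by (rule lborel_pair.AE_pair[OF AE_not_in[OF N(1)]])
  then have "AE t in lborel. AE x in lborel. (x, t) \<notin> N"
  proof (subst (asm) lborel_pair.AE_commute)
    have "{p \<in> space (lborel \<Otimes>\<^sub>M lborel). (fst p, snd p) \<notin> N} = space (lborel \<Otimes>\<^sub>M lborel) - N"
      by auto
    then show "{p \<in> space (lborel \<Otimes>\<^sub>M lborel). (fst p, snd p) \<notin> N} \<in> sets (lborel \<Otimes>\<^sub>M lborel)"
      using N(1) by (simp only:) (intro sets.compl_sets null_setsD2)
  qed
  then have "AE t in lebesgue. AE x in lebesgue. (x, t) \<notin> N"
    by (intro AE_completion) (auto elim!: eventually_mono intro: AE_completion)
  then have "AE t in time_measure T. t \<in> {0<..<T} \<and> (AE x in lebesgue. (x, t) \<notin> N)"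
    by (subst AE_restrict_space_iff) (auto elim!: eventually_mono)
  then have ae: "AE t in time_measure T. (\<integral>x. f (x, t) \<partial>space_measure) = (\<integral>x. H (x, t) \<partial>lborel)"
  proof eventually_elim
    case (elim t)
    then have t: "t \<in> {0<..<T}" by blast
    have "AE x in space_measure. (x, t) \<notin> N \<and> x \<in> {0<..<1}"
      using elim by (subst AE_restrict_space_iff) (auto elim!: eventually_mono)
    then have ae: "AE x in space_measure. f (x, t) = H (x, t)"
      by eventually_elim (use N(2) t in \<open>auto simp: Q_def\<close>)
    have m: "(\<lambda>x. H (x, t)) \<in> borel_measurable space_measure"
      by (rule borel_measurable_interval[OF sec])
    have "(\<integral>x. f (x, t) \<partial>space_measure) = (\<integral>x. H (x, t) \<partial>space_measure)"
      using ae m measurable_lebesgue_on_AE[OF m ae] by (intro integral_cong_AE) auto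
    then show ?case using inner[of t] t by simp
  qed
  have mf: "(\<lambda>t. \<integral>x. f (x, t) \<partial>space_measure) \<in> borel_measurable (time_measure T)"
    by (rule measurable_lebesgue_on_AE[OF borel_measurable_interval[OF innerM] ae]) simp
  show "integrable (time_measure T) (\<lambda>t. \<integral>x. f (x, t) \<partial>space_measure)"
    by (rule integrable_cong_AE_imp[OF J(1) mf]) (use ae in \<open>auto elim: eventually_mono\<close>)
  show "(\<integral>p. f p \<partial>Q_measure T) = (\<integral>t. (\<integral>x. f (x, t) \<partial>space_measure) \<partial>time_measure T)"
    unfolding J(2)[symmetric] using ae mf borel_measurable_interval[OF innerM]
    by (intro integral_cong_AE) (auto elim: eventually_mono)
qed

text \<open>Time is the outer variable, so that Parseval's identity can be applied in space at each time.\<close>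

lemma Q_Tonelli:
  fixes f :: "real \<times> real \<Rightarrow> real"
  assumes f: "f \<in> borel_measurable borel" "\<And>p. 0 \<le> f p"
    and inner: "\<And>t. t \<in> {0<..<T} \<Longrightarrow> integrable space_measure (\<lambda>x. f (x, t))"
    and outer: "integrable (time_measure T) (\<lambda>t. \<integral>x. f (x, t) \<partial>space_measure)"
  shows "integrable (Q_measure T) f"
proof -
  define g where "g = (\<lambda>(t, x). indicator {0<..<T} t * (indicator {0<..<1} x * f (x, t)))"
  have sec: "(\<lambda>x. f (x, t)) \<in> borel_measurable borel" for t
    using f(1) by measurable
  have secI: "(\<integral>x. f (x, t) \<partial>space_measure) = (\<integral>x. indicator {0<..<1} x * f (x, t) \<partial>lborel)" for t
    using lebesgue_on_borel(2)[of "{0<..<1}" "\<lambda>x. f (x, t)"] sec by simp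
  have outM: "(\<lambda>t. \<integral>x. indicator {0<..<1} x * f (x, t) \<partial>lborel) \<in> borel_measurable borel"
    using f(1) by measurable
  have "integrable (lborel \<Otimes>\<^sub>M lborel) g"
  proof (rule lborel_pair.Fubini_integrable)
    show "g \<in> borel_measurable (lborel \<Otimes>\<^sub>M lborel)"
      unfolding g_def using f(1) by measurable
    have "integrable lborel (\<lambda>t. indicator {0<..<T} t * (\<integral>x. indicator {0<..<1} x * f (x, t) \<partial>lborel))"
      using outer lebesgue_on_borel(1)[of "{0<..<T}", OF _ outM] unfolding secI by simp
    then show "integrable lborel (\<lambda>t. \<integral>x. norm (g (t, x)) \<partial>lborel)"
      using f(2) by (simp add: g_def abs_mult)
    show "AE t in lborel. integrable lborel (\<lambda>x. g (t, x))"
    proof (rule AE_I2)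
      fix t
      show "integrable lborel (\<lambda>x. g (t, x))"
      proof (cases "t \<in> {0<..<T}")
        case True
        then show ?thesis
          using inner[OF True] lebesgue_on_borel(1)[of "{0<..<1}", OF _ sec] by (simp add: g_def)
      qed (simp add: g_def)
    qed
  qed
  from lborel_pair.integrable_product_swap[OF this]
  have "integrable lborel (\<lambda>(x, t). indicator {0<..<T} t * (indicator {0<..<1} x * f (x, t)))"
    by (simp add: g_def lborel_prod)
  also have "(\<lambda>(x, t). indicator {0<..<T} t * (indicator {0<..<1} x * f (x, t)))
      = (\<lambda>p. indicator ({0<..<1} \<times> {0<..<T}) p * f p)"
    by (auto simp: fun_eq_iff indicator_Q split: split_indicator)
  finally show ?thesis
    using lebesgue_on_borel(1)[OF Q_set_borel f(1)] by simp
qed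

lemma finite_measure_Q: "finite_measure (Q_measure T)"
proof (rule finite_measureI)
  have "emeasure lborel ({0<..<1::real} \<times> {0<..<T}) \<le> emeasure lborel (cbox (0 :: real, 0) (1, T))"
  proof (rule emeasure_mono)
    show "{0<..<1} \<times> {0<..<T} \<subseteq> cbox (0 :: real, 0) (1, T)" by (auto simp: cbox_Pair_eq)
  qed simp
  also have "\<dots> < \<infinity>" by (rule emeasure_lborel_cbox_finite)
  finally show "emeasure (Q_measure T) (space (Q_measure T)) \<noteq> \<infinity>"
    using Q_set_borel[of T] by (simp add: emeasure_restrict_space)
qed


section \<open>The moments of a steering control\<close>

lemma integral_ramp': "integrable lborel ramp'" "(\<integral>z. ramp' z \<partial>lborel) = 1"
proof -
  have "(\<integral>\<^sup>+z. ennreal (ramp' z) * indicator {0..} z \<partial>lborel) = ennreal (1 - ramp 0)"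
    by (rule nn_integral_FTC_atLeast) (auto intro: ramp_DERIV ramp_bounds ramp_at_top)
  moreover have "ennreal (ramp' z) * indicator {0..} z = ennreal (ramp' z)" for z
    using ramp_neg(2)[of z] by (auto split: split_indicator)
  ultimately have "(\<integral>\<^sup>+z. ennreal (ramp' z) \<partial>lborel) = ennreal 1"
    using ramp_neg(1)[of 0] by simp
  then have "integrable lborel ramp' \<and> (\<integral>z. ramp' z \<partial>lborel) = 1"
    using ramp_bounds(3) by (subst (asm) nn_integral_eq_integrable) auto
  then show "integrable lborel ramp'" "(\<integral>z. ramp' z \<partial>lborel) = 1" by auto
qed

text \<open>The rising part of the derivative of the cutoff is an approximate identity at \<open>0\<close>. The substitution
  \<open>z = k t - 1\<close> turns it into the fixed density \<open>ramp'\<close> with total mass \<open>1\<close>.\<close>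

lemma ramp'_concentrates:
  fixes \<gamma> :: "real \<Rightarrow> real"
  assumes "0 < T" and cont: "continuous_on UNIV \<gamma>" and bound: "\<And>t. \<bar>\<gamma> t\<bar> \<le> B"
  shows "(\<lambda>k. \<integral>t. indicator {0<..<T} t * (real k * ramp' (real k * t - 1) * ramp (real k * (T - t) - 1) * \<gamma> t) \<partial>lborel)
    \<longlonglongrightarrow> \<gamma> 0"
proof -
  define G where "G k t = indicator {0<..<T} t * (real k * ramp' (real k * t - 1) * ramp (real k * (T - t) - 1) * \<gamma> t)" for k t
  define H where "H k z = indicator {0<..<T} ((z + 1) / real k) * (ramp' z * ramp (real k * T - z - 2) * \<gamma> ((z + 1) / real k))" for k z
  have \<gamma>m [measurable]: "\<gamma> \<in> borel_measurable borel"
    using cont by (rule borel_measurable_continuous_onI)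
  have "(\<integral>t. G k t \<partial>lborel) = (\<integral>z. H k z \<partial>lborel)" if "k > 0" for k
  proof -
    have "(\<integral>t. G k t \<partial>lborel) = \<bar>1 / real k\<bar> *\<^sub>R (\<integral>z. G k (1 / real k + 1 / real k * z) \<partial>lborel)"
      using that by (intro lborel_integral_real_affine) auto
    also have "\<dots> = (\<integral>z. (1 / real k) * G k (1 / real k + 1 / real k * z) \<partial>lborel)"
      by simp
    also have "\<dots> = (\<integral>z. H k z \<partial>lborel)"
    proof (intro Bochner_Integration.integral_cong refl)
      fix z
      have t: "1 / real k + 1 / real k * z = (z + 1) / real k" by (simp add: add_divide_distrib)
      have args: "real k * ((z + 1) / real k) - 1 = z" "real k * (T - (z + 1) / real k) - 1 = real k * T - z - 2"
        using that by (simp_all add: right_diff_distrib)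
      show "(1 / real k) * G k (1 / real k + 1 / real k * z) = H k z"
        using that unfolding t G_def H_def args by simp
    qed
    finally show ?thesis .
  qed
  then have ev: "\<forall>\<^sub>F k in sequentially. (\<integral>z. H k z \<partial>lborel) = (\<integral>t. G k t \<partial>lborel)"
    by (intro eventually_sequentiallyI[of 1]) auto
  have "(\<lambda>k. \<integral>z. H k z \<partial>lborel) \<longlonglongrightarrow> (\<integral>z. \<gamma> 0 * ramp' z \<partial>lborel)"
  proof (rule integral_dominated_convergence[where w = "\<lambda>z. B * ramp' z"])
    show "(\<lambda>z. \<gamma> 0 * ramp' z) \<in> borel_measurable lborel" by measurable
    show "H k \<in> borel_measurable lborel" for k unfolding H_def[abs_def] by measurable
    show "integrable lborel (\<lambda>z. B * ramp' z)" using integral_ramp'(1) by simp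
    show "AE z in lborel. (\<lambda>k. H k z) \<longlonglongrightarrow> \<gamma> 0 * ramp' z"
    proof (rule AE_I2)
      fix z :: real
      show "(\<lambda>k. H k z) \<longlonglongrightarrow> \<gamma> 0 * ramp' z"
      proof (cases "z \<le> 0")
        case True
        then show ?thesis using ramp_neg(2)[of z] by (simp add: H_def)
      next
        case False
        have "(\<lambda>k. (z + 1) / real k) \<longlonglongrightarrow> 0" by real_asymp
        then have small: "\<forall>\<^sub>F k in sequentially. (z + 1) / real k < T" and
          g: "(\<lambda>k. \<gamma> ((z + 1) / real k)) \<longlonglongrightarrow> \<gamma> 0"
          using order_tendstoD(2)[of _ 0 _ T] \<open>0 < T\<close> continuous_on_tendsto_compose[OF cont] by auto
        have "filterlim (\<lambda>k. real k * T - z - 2) at_top sequentially" using \<open>0 < T\<close> by real_asymp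
        then have "(\<lambda>k. ramp (real k * T - z - 2)) \<longlonglongrightarrow> 1" by (rule filterlim_compose[OF ramp_at_top])
        then have "(\<lambda>k. ramp' z * ramp (real k * T - z - 2) * \<gamma> ((z + 1) / real k)) \<longlonglongrightarrow> ramp' z * 1 * \<gamma> 0"
          by (intro tendsto_intros g)
        moreover have "\<forall>\<^sub>F k in sequentially. ramp' z * ramp (real k * T - z - 2) * \<gamma> ((z + 1) / real k) = H k z"
          using small eventually_gt_at_top[of 0]
          by eventually_elim (use False in \<open>auto simp: H_def split: split_indicator\<close>)
        ultimately show ?thesis
          using Lim_transform_eventually by (fastforce simp: mult.commute)
      qed
    qed
    show "AE z in lborel. norm (H k z) \<le> B * ramp' z" for k
    proof (rule AE_I2)
      fix z
      have B: "0 \<le> B" using bound[of 0] by linarith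
      have "indicator {0<..<T} ((z + 1) / real k) * (ramp' z * ramp (real k * T - z - 2) * \<bar>\<gamma> ((z + 1) / real k)\<bar>)
          \<le> 1 * (ramp' z * 1 * B)"
        using ramp_bounds bound B by (intro mult_mono mult_nonneg_nonneg) (auto split: split_indicator)
      then show "norm (H k z) \<le> B * ramp' z"
        using ramp_bounds by (simp add: H_def abs_mult mult.commute)
    qed
  qed
  then have "(\<lambda>k. \<integral>z. H k z \<partial>lborel) \<longlonglongrightarrow> \<gamma> 0"
    using integral_ramp'(2) by simp
  from Lim_transform_eventually[OF this ev] show ?thesis by (simp add: G_def)
qed

text \<open>The falling part is the mirror image of the rising part.\<close>

lemma cutoff'_concentrates:
  fixes \<gamma> :: "real \<Rightarrow> real"
  assumes "0 < T" and cont: "continuous_on {0..T} \<gamma>"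
  shows "(\<lambda>k. \<integral>t. cutoff' 0 T k t * \<gamma> t \<partial>time_measure T) \<longlonglongrightarrow> \<gamma> 0 - \<gamma> T"
proof -
  \<comment> \<open>a continuous and bounded extension of \<open>\<gamma>\<close> to the real line\<close>
  define g where "g t = \<gamma> (max 0 (min T t))" for t
  have contg: "continuous_on UNIV g"
    unfolding g_def using \<open>0 < T\<close>
    by (intro continuous_on_compose2[OF cont] continuous_intros) auto
  have contr: "continuous_on UNIV (\<lambda>t. g (T - t))"
    by (intro continuous_on_compose2[OF contg] continuous_intros) auto
  have "bounded (\<gamma> ` {0..T})" using cont by (intro compact_imp_bounded compact_continuous_image) auto
  then obtain B where B: "\<forall>y \<in> \<gamma> ` {0..T}. norm y \<le> B" unfolding bounded_iff ..
  have bound: "\<bar>g t\<bar> \<le> B" for t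
    using B \<open>0 < T\<close> by (simp add: g_def)
  have gm: "g \<in> borel_measurable borel" using contg by (rule borel_measurable_continuous_onI)
  define P where "P k t = real k * ramp' (real k * t - 1) * ramp (real k * (T - t) - 1) * g t" for k t
  define S where "S k t = real k * ramp' (real k * (T - t) - 1) * ramp (real k * t - 1) * g t" for k t
  have P: "(\<lambda>k. \<integral>t. indicator {0<..<T} t * P k t \<partial>lborel) \<longlonglongrightarrow> g 0"
    unfolding P_def by (rule ramp'_concentrates[OF \<open>0 < T\<close> contg bound])
  have "(\<integral>t. indicator {0<..<T} t * S k t \<partial>lborel) = (\<integral>t. indicator {0<..<T} t *
      (real k * ramp' (real k * t - 1) * ramp (real k * (T - t) - 1) * g (T - t)) \<partial>lborel)" for k
  proof -
    have "(\<integral>t. indicator {0<..<T} t * S k t \<partial>lborel)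
        = \<bar>-1\<bar> *\<^sub>R (\<integral>t. indicator {0<..<T} (T + (-1) * t) * S k (T + (-1) * t) \<partial>lborel)"
      by (intro lborel_integral_real_affine) auto
    also have "\<dots> = (\<integral>t. indicator {0<..<T} t *
      (real k * ramp' (real k * t - 1) * ramp (real k * (T - t) - 1) * g (T - t)) \<partial>lborel)"
      by (simp, intro Bochner_Integration.integral_cong) (auto simp: S_def split: split_indicator)
    finally show ?thesis .
  qed
  then have S: "(\<lambda>k. \<integral>t. indicator {0<..<T} t * S k t \<partial>lborel) \<longlonglongrightarrow> g T"
    using ramp'_concentrates[OF \<open>0 < T\<close> contr bound] by simp
  have contPS: "continuous_on {0..T} (P k)" "continuous_on {0..T} (S k)" for k
    unfolding P_def[abs_def] S_def[abs_def]
    by (intro continuous_intros continuous_on_subset[OF contg] continuous_on_compose2[OF ramp_continuous(1)[of UNIV]]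
        continuous_on_compose2[OF ramp_continuous(2)[of UNIV]]; simp)+
  have PSm: "P k \<in> borel_measurable borel" "S k \<in> borel_measurable borel" for k
    unfolding P_def[abs_def] S_def[abs_def] using gm by measurable
  have "(\<integral>t. cutoff' 0 T k t * \<gamma> t \<partial>time_measure T)
      = (\<integral>t. indicator {0<..<T} t * P k t \<partial>lborel) - (\<integral>t. indicator {0<..<T} t * S k t \<partial>lborel)" for k
  proof -
    have "(\<integral>t. cutoff' 0 T k t * \<gamma> t \<partial>time_measure T) = (\<integral>t. P k t - S k t \<partial>time_measure T)"
      by (intro Bochner_Integration.integral_cong) (auto simp: cutoff'_def P_def S_def g_def algebra_simps)
    also have "\<dots> = (\<integral>t. P k t \<partial>time_measure T) - (\<integral>t. S k t \<partial>time_measure T)"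
      by (intro Bochner_Integration.integral_diff integrable_continuous_interval contPS)
    finally show ?thesis
      using lebesgue_on_borel(2)[of "{0<..<T}", OF _ PSm(1)] lebesgue_on_borel(2)[of "{0<..<T}", OF _ PSm(2)] by simp
  qed
  moreover have "g 0 = \<gamma> 0" "g T = \<gamma> T" using \<open>0 < T\<close> by (simp_all add: g_def)
  ultimately show ?thesis using tendsto_diff[OF P S] by simp
qed


text \<open>These functions solve the adjoint (backward) heat equation, so pairing them with a solution leaves only
  the values at \<open>0\<close>, at \<open>T\<close> and the control.\<close>

definition adjoint_mode :: "real \<Rightarrow> nat \<Rightarrow> real \<times> real \<Rightarrow> real" where
  "adjoint_mode T k = (\<lambda>(x, t). exp (- (lam k * (T - t))) * mode k x)"

lemma adjoint_mode_L2: "adjoint_mode T k \<in> L2_space (Q_measure T)"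
proof (rule L2_bounded[OF finite_measure_Q])
  have "adjoint_mode T k \<in> borel_measurable (borel \<Otimes>\<^sub>M borel)"
    unfolding adjoint_mode_def by measurable
  then have "adjoint_mode T k \<in> borel_measurable borel" by (simp add: borel_prod)
  then show "adjoint_mode T k \<in> borel_measurable (Q_measure T)"
    by (intro measurable_restrict_space1 measurable_completion) simp
  show "AE p in Q_measure T. \<bar>adjoint_mode T k p\<bar> \<le> 1 * sqrt 2"
  proof (rule AE_I2)
    fix p assume p: "p \<in> space (Q_measure T)"
    obtain x t where "p = (x, t)" by (cases p)
    with p have t: "t < T" by (auto simp: space_restrict_space)
    have "exp (- (lam k * (T - t))) * \<bar>mode k x\<bar> \<le> 1 * sqrt 2"
      using t lam_pos[of k] mode_bounds(1) by (intro mult_mono) auto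
    then show "\<bar>adjoint_mode T k p\<bar> \<le> 1 * sqrt 2"
      by (simp add: \<open>p = (x, t)\<close> adjoint_mode_def abs_mult)
  qed
qed

lemma Q_inner_adjoint_mode:
  assumes "u \<in> L2_space (Q_measure T)"
  shows "integrable (time_measure T) (\<lambda>t. exp (- (lam k * (T - t))) * (\<integral>x. u (x, t) * mode k x \<partial>space_measure))"
    "(\<integral>p. u p * adjoint_mode T k p \<partial>Q_measure T)
      = (\<integral>t. exp (- (lam k * (T - t))) * (\<integral>x. u (x, t) * mode k x \<partial>space_measure) \<partial>time_measure T)"
proof -
  have "(\<integral>x. u (x, t) * adjoint_mode T k (x, t) \<partial>space_measure)
      = exp (- (lam k * (T - t))) * (\<integral>x. u (x, t) * mode k x \<partial>space_measure)" for t
  proof -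
    have "u (x, t) * adjoint_mode T k (x, t) = exp (- (lam k * (T - t))) * (u (x, t) * mode k x)" for x
      by (simp add: adjoint_mode_def)
    then show ?thesis by (simp only: integral_mult_right_zero)
  qed
  then show "integrable (time_measure T) (\<lambda>t. exp (- (lam k * (T - t))) * (\<integral>x. u (x, t) * mode k x \<partial>space_measure))"
    "(\<integral>p. u p * adjoint_mode T k p \<partial>Q_measure T)
      = (\<integral>t. exp (- (lam k * (T - t))) * (\<integral>x. u (x, t) * mode k x \<partial>space_measure) \<partial>time_measure T)"
    using Q_Fubini[OF L2_integrable_mult[OF assms adjoint_mode_L2[of T k]]] by simp_all
qed

text \<open>The time test function is a cutoff of \<open>exp (- lam k (T - t))\<close>. As the cutoff tends to \<open>1\<close>, its
  derivative produces the values of the solution at the two end points.\<close>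

lemma weak_solution_moment:
  assumes "0 < T" and u: "u \<in> L2_space (Q_measure T)" and sol: "weak_solution T y0 u y"
  shows "(\<integral>p. u p * adjoint_mode T k p \<partial>Q_measure T)
    = mode_coeff (y T) k - exp (- (lam k * T)) * mode_coeff (y 0) k"
proof -
  define E where "E t = exp (lam k * t + (- (lam k * T)))" for t
  define \<alpha> where "\<alpha> t = mode_coeff (y t) k" for t
  define \<beta> where "\<beta> t = (\<integral>x. u (x, t) * mode k x \<partial>space_measure)" for t
  have E_eq: "exp (- (lam k * (T - t))) = E t" for t
    by (simp add: E_def algebra_simps)
  have y_cont: "continuous_into_L2 T y" and y_H10: "y \<in> bochner_L2 (time_measure T) H10 H1_norm"
    using sol by (auto simp: weak_solution_def)
  obtain w where w: "is_time_deriv T y w"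
    and eq: "AE t in time_measure T. \<forall>v \<in> H10.
        w t v + (\<integral>x. weak_deriv (y t) x * weak_deriv v x \<partial>space_measure) =
        (\<integral>x. u (x, t) * v x \<partial>space_measure)"
    using sol by (auto simp: weak_solution_def)
  have contE: "continuous_on S E" for S unfolding E_def[abs_def] by (intro continuous_intros)
  have cont\<alpha>: "continuous_on {0..T} \<alpha>"
    unfolding continuous_on_def
  proof
    fix s assume s: "s \<in> {0..T}"
    have L2: "y t \<in> L2_unit" if "t \<in> {0..T}" for t
      using y_cont that by (simp add: continuous_into_L2_def)
    have "((\<lambda>t. \<alpha> t - \<alpha> s) \<longlongrightarrow> 0) (at s within {0..T})"
    proof (rule Lim_null_comparison)
      show "((\<lambda>t. norm_unit (y t - y s)) \<longlongrightarrow> 0) (at s within {0..T})"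
        using y_cont s by (simp add: continuous_into_L2_def)
      show "\<forall>\<^sub>F t in at s within {0..T}. norm (\<alpha> t - \<alpha> s) \<le> norm_unit (y t - y s)"
        unfolding eventually_at_filter
      proof (intro always_eventually allI impI)
        fix t assume t: "t \<in> {0..T}"
        have "\<alpha> t - \<alpha> s = mode_coeff (\<lambda>x. y t x - y s x) k"
          using L2_integrable_mult[OF L2[OF t] mode_L2(1)] L2_integrable_mult[OF L2[OF s] mode_L2(1)]
          by (simp add: \<alpha>_def mode_coeff_def left_diff_distrib)
        then show "norm (\<alpha> t - \<alpha> s) \<le> norm_unit (y t - y s)"
          using mode_coeff_bound[OF L2_diff[OF L2[OF t] L2[OF s]]] by (simp add: fun_diff_def)
      qed
    qed
    then show "(\<alpha> \<longlongrightarrow> \<alpha> s) (at s within {0..T})" by (rule LIM_zero_cancel)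
  qed
  have int_E\<beta>: "integrable (time_measure T) (\<lambda>t. E t * \<beta> t)"
    using Q_inner_adjoint_mode(1)[OF u, of k] by (simp add: E_eq \<beta>_def)
  have "\<beta> = (\<lambda>t. (E t * \<beta> t) / E t)" by (simp add: E_def fun_eq_iff)
  moreover have "(\<lambda>t. (E t * \<beta> t) / E t) \<in> borel_measurable (time_measure T)"
    using int_E\<beta> continuous_on_borel_measurable_interval[OF contE[of "{0<..<T}"]]
    by (intro borel_measurable_divide) auto
  ultimately have \<beta>m: "\<beta> \<in> borel_measurable (time_measure T)" by simp
  have \<alpha>m: "\<alpha> \<in> borel_measurable (time_measure T)"
    by (intro continuous_on_borel_measurable_interval continuous_on_subset[OF cont\<alpha>]) auto
  have "AE t in time_measure T. y t \<in> H10"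
    using y_H10 by (auto simp: bochner_L2_def elim: eventually_mono)
  with eq have ae: "AE t in time_measure T. w t (mode k) = \<beta> t - lam k * \<alpha> t"
  proof eventually_elim
    case (elim t)
    have "(\<integral>x. weak_deriv (y t) x * weak_deriv (mode k) x \<partial>space_measure)
        = (\<integral>x. weak_deriv (y t) x * mode' k x \<partial>space_measure)"
      using H1I(2)[OF mode_L2 mode_is_weak_deriv(1)[of k]] H10_L2(2)[OF elim(2)] H10_L2(2)[OF mode_H10[of k]]
      by (intro integral_cong_AE) (auto elim!: eventually_mono dest: L2_measurable)
    also have "\<dots> = lam k * \<alpha> t"
      using Dirichlet_form_mode[OF elim(2)] by (simp add: lam_def \<alpha>_def)
    finally show ?case
      using elim(1) mode_H10[of k] by (auto simp: \<beta>_def)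
  qed
  have step: "(\<integral>t. cutoff' 0 T n t * (E t * \<alpha> t) \<partial>time_measure T)
      = - (\<integral>t. cutoff 0 T n t * (E t * \<beta> t) \<partial>time_measure T)" for n
  proof -
    define \<phi> where "\<phi> t = cutoff 0 T n t * E t" for t
    have phi: "\<phi> \<in> test_functions 0 T"
      unfolding \<phi>_def[abs_def] E_def by (rule smooth_cutoff_in_test_functions[OF smooth_exp])
    have "(E has_real_derivative lam k * E t) (at t)" for t
      unfolding E_def[abs_def] by (auto intro!: derivative_eq_intros)
    then have dphi: "deriv \<phi> = (\<lambda>t. cutoff' 0 T n t * E t + lam k * (cutoff 0 T n t * E t))"
      unfolding \<phi>_def[abs_def]
      by (intro ext DERIV_imp_deriv, rule DERIV_cong[OF DERIV_mult[OF cutoff_DERIV]]) (auto simp: algebra_simps)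
    have i1: "integrable (time_measure T) (\<lambda>t. cutoff' 0 T n t * (E t * \<alpha> t))"
      "integrable (time_measure T) (\<lambda>t. cutoff 0 T n t * (E t * \<alpha> t))"
      by (intro integrable_continuous_interval continuous_intros cutoff_continuous contE cont\<alpha>)+
    have i2: "integrable (time_measure T) (\<lambda>t. cutoff 0 T n t * (E t * \<beta> t))"
    proof (rule Bochner_Integration.integrable_bound[OF int_E\<beta>])
      show "(\<lambda>t. cutoff 0 T n t * (E t * \<beta> t)) \<in> borel_measurable (time_measure T)"
        using borel_measurable_interval[OF cutoff_borel(1)] borel_measurable_integrable[OF int_E\<beta>]
        by (rule borel_measurable_times)
      show "AE t in time_measure T. norm (cutoff 0 T n t * (E t * \<beta> t)) \<le> norm (E t * \<beta> t)"
        using cutoff_bounds by (intro always_eventually allI) (simp add: abs_mult mult_left_le_one_le)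
    qed
    have "(\<integral>t. cutoff' 0 T n t * (E t * \<alpha> t) \<partial>time_measure T)
        + lam k * (\<integral>t. cutoff 0 T n t * (E t * \<alpha> t) \<partial>time_measure T)
        = (\<integral>t. deriv \<phi> t * \<alpha> t \<partial>time_measure T)"
      using i1 by (simp add: dphi distrib_right mult.assoc)
    also have "\<dots> = - (\<integral>t. \<phi> t * w t (mode k) \<partial>time_measure T)"
      using w phi mode_H10[of k] by (simp add: is_time_deriv_def \<alpha>_def mode_coeff_def)
    also have "(\<integral>t. \<phi> t * w t (mode k) \<partial>time_measure T)
        = (\<integral>t. \<phi> t * (\<beta> t - lam k * \<alpha> t) \<partial>time_measure T)"
    proof (intro integral_cong_AE)
      have m: "(\<lambda>t. \<beta> t - lam k * \<alpha> t) \<in> borel_measurable (time_measure T)"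
        using \<alpha>m \<beta>m by measurable
      \<comment> \<open>measurability of \<open>w\<close> at a fixed element of \<open>H\<^sub>0\<^sup>1\<close> is read off from the equation\<close>
      have wm: "(\<lambda>t. w t (mode k)) \<in> borel_measurable (time_measure T)"
        by (rule measurable_lebesgue_on_AE[OF m ae]) simp
      have pm: "\<phi> \<in> borel_measurable (time_measure T)"
        by (rule borel_measurable_interval[OF test_function_deriv_borel(3)[OF phi]])
      show "(\<lambda>t. \<phi> t * w t (mode k)) \<in> borel_measurable (time_measure T)"
        "(\<lambda>t. \<phi> t * (\<beta> t - lam k * \<alpha> t)) \<in> borel_measurable (time_measure T)"
        using m wm pm by (auto intro: borel_measurable_times)
      show "AE t in time_measure T. \<phi> t * w t (mode k) = \<phi> t * (\<beta> t - lam k * \<alpha> t)"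
        using ae by eventually_elim simp
    qed
    also have "\<dots> = (\<integral>t. cutoff 0 T n t * (E t * \<beta> t) - lam k * (cutoff 0 T n t * (E t * \<alpha> t)) \<partial>time_measure T)"
      by (simp add: \<phi>_def algebra_simps)
    also have "\<dots> = (\<integral>t. cutoff 0 T n t * (E t * \<beta> t) \<partial>time_measure T)
        - lam k * (\<integral>t. cutoff 0 T n t * (E t * \<alpha> t) \<partial>time_measure T)"
      using i1 i2 by simp
    finally show ?thesis by simp
  qed
  have "(\<lambda>n. \<integral>t. cutoff' 0 T n t * (E t * \<alpha> t) \<partial>time_measure T) \<longlonglongrightarrow> E 0 * \<alpha> 0 - E T * \<alpha> T"
    by (intro cutoff'_concentrates[OF \<open>0 < T\<close>] continuous_intros contE cont\<alpha>)
  moreover have "(\<lambda>n. - (\<integral>t. cutoff 0 T n t * (E t * \<beta> t) \<partial>time_measure T)) \<longlonglongrightarrow> - (\<integral>t. E t * \<beta> t \<partial>time_measure T)"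
  proof (intro tendsto_minus integral_dominated_convergence[where w = "\<lambda>t. norm (E t * \<beta> t)"])
    show "AE t in time_measure T. (\<lambda>n. cutoff 0 T n t * (E t * \<beta> t)) \<longlonglongrightarrow> E t * \<beta> t"
    proof (rule AE_interval)
      fix t assume "0 < t" "t < T"
      then have "(\<lambda>n. cutoff 0 T n t * (E t * \<beta> t)) \<longlonglongrightarrow> 1 * (E t * \<beta> t)"
        by (intro tendsto_mult cutoff_tendsto tendsto_const) auto
      then show "(\<lambda>n. cutoff 0 T n t * (E t * \<beta> t)) \<longlonglongrightarrow> E t * \<beta> t" by simp
    qed
    show "AE t in time_measure T. norm (cutoff 0 T n t * (E t * \<beta> t)) \<le> norm (E t * \<beta> t)" for n
      using cutoff_bounds by (intro always_eventually allI) (simp add: abs_mult mult_left_le_one_le)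
    show "(\<lambda>t. cutoff 0 T n t * (E t * \<beta> t)) \<in> borel_measurable (time_measure T)" for n
      using borel_measurable_interval[OF cutoff_borel(1)] borel_measurable_integrable[OF int_E\<beta>]
      by (rule borel_measurable_times)
  qed (use int_E\<beta> in auto)
  ultimately have "E 0 * \<alpha> 0 - E T * \<alpha> T = - (\<integral>t. E t * \<beta> t \<partial>time_measure T)"
    unfolding step by (rule LIMSEQ_unique)
  moreover have "(\<integral>p. u p * adjoint_mode T k p \<partial>Q_measure T) = (\<integral>t. E t * \<beta> t \<partial>time_measure T)"
    using Q_inner_adjoint_mode(2)[OF u, of k] by (simp add: E_eq \<beta>_def)
  ultimately show ?thesis by (simp add: E_def \<alpha>_def)
qed


section \<open>Optimality\<close>

context steering
begin

lemma steering_moment: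
  assumes u: "u \<in> L2_space (Q_measure T)" and st: "steers T y0 yT u"
  shows "(\<integral>p. u p * adjoint_mode T k p \<partial>Q_measure T) = gap k"
proof -
  obtain y where sol: "weak_solution T y0 u y" and fin: "AE x in space_measure. y T x = yT x"
    using st by (auto simp: steers_def)
  have ini: "AE x in space_measure. y 0 x = y0 x" and L2: "y 0 \<in> L2_unit" "y T \<in> L2_unit"
    using sol T_pos by (auto simp: weak_solution_def continuous_into_L2_def)
  have coeff: "mode_coeff f k = mode_coeff g k"
    if "AE x in space_measure. f x = g x" "f \<in> L2_unit" "g \<in> L2_unit" for f g
    unfolding mode_coeff_def
    using that(1) L2_integrable_mult[OF that(2) mode_L2(1)[of k]] L2_integrable_mult[OF that(3) mode_L2(1)[of k]]
    by (intro integral_cong_AE) (auto elim: eventually_mono)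
  show ?thesis
    using weak_solution_moment[OF T_pos u sol] coeff[OF ini L2(1) y0_L2] coeff[OF fin L2(2) yT_L2]
    by (simp add: gap_def initial_def)
qed

lemma control_borel: "control \<in> borel_measurable borel"
proof -
  have "control \<in> borel_measurable (borel \<Otimes>\<^sub>M borel)"
    unfolding control_def field_def U_def by measurable
  then show ?thesis by (simp add: borel_prod)
qed

text \<open>Parseval in space at each time, then integration in time.\<close>

lemma control_norm:
  "control \<in> L2_space (Q_measure T)"
  "(L2_norm (Q_measure T) control)\<^sup>2 = (\<Sum>k. weight k * (gap k)\<^sup>2)"
proof -
  have slice: "(\<integral>x. (control (x, t))\<^sup>2 \<partial>space_measure) = (\<Sum>k. (U t k)\<^sup>2)"
    "integrable space_measure (\<lambda>x. (control (x, t))\<^sup>2)" if "t \<in> {0<..<T}" for t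
  proof -
    note r = rapid_YUV(2)[OF that]
    show "(\<integral>x. (control (x, t))\<^sup>2 \<partial>space_measure) = (\<Sum>k. (U t k)\<^sup>2)"
      using sums_unique[OF field_norm_sums(1)[OF r]] by (simp add: control_def L2_norm_sq)
    show "integrable space_measure (\<lambda>x. (control (x, t))\<^sup>2)"
      using field_tendsto(1)[OF r] by (simp add: control_def L2_space_def)
  qed
  have out: "integrable (time_measure T) (\<lambda>t. \<integral>x. (control (x, t))\<^sup>2 \<partial>space_measure)"
    "(\<integral>t. (\<integral>x. (control (x, t))\<^sup>2 \<partial>space_measure) \<partial>time_measure T) = (\<Sum>k. weight k * (gap k)\<^sup>2)"
  proof -
    have "integrable (time_measure T) (\<lambda>t. \<integral>x. (control (x, t))\<^sup>2 \<partial>space_measure)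
        \<longleftrightarrow> integrable (time_measure T) (\<lambda>t. \<Sum>k. (U t k)\<^sup>2)"
      by (intro Bochner_Integration.integrable_cong refl) (auto simp: slice)
    then show "integrable (time_measure T) (\<lambda>t. \<integral>x. (control (x, t))\<^sup>2 \<partial>space_measure)"
      using control_energy(1) by simp
    have "(\<integral>t. (\<integral>x. (control (x, t))\<^sup>2 \<partial>space_measure) \<partial>time_measure T)
        = (\<integral>t. (\<Sum>k. (U t k)\<^sup>2) \<partial>time_measure T)"
      by (intro Bochner_Integration.integral_cong refl) (auto simp: slice)
    then show "(\<integral>t. (\<integral>x. (control (x, t))\<^sup>2 \<partial>space_measure) \<partial>time_measure T) = (\<Sum>k. weight k * (gap k)\<^sup>2)"
      using control_energy(2) by simp
  qed
  have int: "integrable (Q_measure T) (\<lambda>p. (control p)\<^sup>2)"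
    using control_borel by (intro Q_Tonelli slice out(1)) auto
  have "control \<in> borel_measurable (Q_measure T)"
    using control_borel by (intro measurable_restrict_space1 measurable_completion) simp
  then show "control \<in> L2_space (Q_measure T)" using int by (simp add: L2_space_def)
  show "(L2_norm (Q_measure T) control)\<^sup>2 = (\<Sum>k. weight k * (gap k)\<^sup>2)"
    unfolding L2_norm_sq using Q_Fubini(2)[OF int] out(2) by simp
qed

lemma adjoint_mode_inner:
  "(\<integral>p. adjoint_mode T j p * adjoint_mode T k p \<partial>Q_measure T) = (if j = k then 1 / weight k else 0)"
proof -
  have inner: "(\<integral>x. adjoint_mode T j (x, t) * mode k x \<partial>space_measure)
      = exp (- (lam j * (T - t))) * (if j = k then 1 else 0)" for t
    unfolding mode_orthonormal[symmetric] by (simp add: adjoint_mode_def mult.assoc)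
  have "(\<integral>p. adjoint_mode T j p * adjoint_mode T k p \<partial>Q_measure T)
      = (\<integral>t. exp (- (lam k * (T - t))) * (exp (- (lam j * (T - t))) * (if j = k then 1 else 0)) \<partial>time_measure T)"
    unfolding Q_inner_adjoint_mode(2)[OF adjoint_mode_L2] inner ..
  also have "\<dots> = (if j = k then 1 / weight k else 0)"
  proof (cases "j = k")
    case True
    have "exp (- (lam k * (T - t))) * (exp (- (lam j * (T - t))) * (if j = k then 1 else 0))
        = exp (- (2 * lam k * T)) * exp (2 * lam k * t)" for t
      using True by (simp add: algebra_simps flip: exp_add)
    then have "(\<integral>t. exp (- (lam k * (T - t))) * (exp (- (lam j * (T - t))) * (if j = k then 1 else 0)) \<partial>time_measure T)
        = exp (- (2 * lam k * T)) * ((exp (2 * lam k * T) - 1) / (2 * lam k))"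
      using lam_pos[of k] T_pos integral_exp_interval[of "2 * lam k" T] by simp
    also have "\<dots> = (1 - exp (- (2 * lam k * T))) / (2 * lam k)"
      by (simp add: right_diff_distrib flip: exp_add)
    finally show ?thesis using True by (simp add: weight_def)
  qed simp
  finally show ?thesis .
qed

text \<open>Bessel's inequality for the orthogonal family of adjoint modes: the moments fix the projection of \<open>w\<close>
  onto their closed span, and the squared norm of that projection is that of \<open>control\<close>.\<close>

lemma moments_norm_bound:
  assumes w: "w \<in> L2_space (Q_measure T)"
    and mom: "\<And>k. (\<integral>p. w p * adjoint_mode T k p \<partial>Q_measure T) = gap k"
  shows "(L2_norm (Q_measure T) control)\<^sup>2 \<le> (L2_norm (Q_measure T) w)\<^sup>2"
proof -
  have "(L2_norm (Q_measure T) (\<lambda>p. w p - (\<Sum>k<N. weight k * gap k * adjoint_mode T k p)))\<^sup>2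
      = (L2_norm (Q_measure T) w)\<^sup>2 - (\<Sum>k<N. weight k * (gap k)\<^sup>2)" for N
  proof (induction N)
    case (Suc N)
    define c where "c k = weight k * gap k" for k
    define g where "g p = w p - (\<Sum>k<N. c k * adjoint_mode T k p)" for p
    have g: "g \<in> L2_space (Q_measure T)"
      unfolding g_def[abs_def] by (intro L2_diff w L2_sum L2_cmult adjoint_mode_L2)
    have "(\<integral>p. g p * adjoint_mode T N p \<partial>Q_measure T) =
        (\<integral>p. w p * adjoint_mode T N p - (\<Sum>k<N. c k * (adjoint_mode T k p * adjoint_mode T N p)) \<partial>Q_measure T)"
      by (simp add: g_def left_diff_distrib sum_distrib_right mult.assoc)
    also have "\<dots> = gap N"
      using w by (simp add: L2_integrable_mult adjoint_mode_L2 adjoint_mode_inner mom)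
    finally have inner: "(\<integral>p. g p * adjoint_mode T N p \<partial>Q_measure T) = gap N" .
    have "(L2_norm (Q_measure T) (adjoint_mode T N))\<^sup>2 = 1 / weight N"
      unfolding L2_norm_sq using adjoint_mode_inner[of N N] by (simp add: power2_eq_square)
    then have "(L2_norm (Q_measure T) (\<lambda>p. g p + (- c N) * adjoint_mode T N p))\<^sup>2
        = (L2_norm (Q_measure T) g)\<^sup>2 + 2 * (- c N) * gap N + (c N)\<^sup>2 * (1 / weight N)"
      using L2_norm_sq_expand[OF g adjoint_mode_L2, of "- c N" N] inner by simp
    also have "\<dots> = (L2_norm (Q_measure T) g)\<^sup>2 - weight N * (gap N)\<^sup>2"
      using weight_ge_1[of N] by (simp add: c_def power2_eq_square field_simps)
    also have "(\<lambda>p. g p + (- c N) * adjoint_mode T N p)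
        = (\<lambda>p. w p - (\<Sum>k<Suc N. weight k * gap k * adjoint_mode T k p))"
      by (simp add: g_def c_def fun_eq_iff)
    finally show ?case using Suc by (simp add: g_def c_def)
  qed simp
  then have "0 \<le> (L2_norm (Q_measure T) w)\<^sup>2 - (\<Sum>k<N. weight k * (gap k)\<^sup>2)" for N
    by (rule subst[where P = "\<lambda>z. 0 \<le> z"]) simp
  then have "(\<Sum>k<N. weight k * (gap k)\<^sup>2) \<le> (L2_norm (Q_measure T) w)\<^sup>2" for N
    by simp
  then show ?thesis
    unfolding control_norm(2) by (intro suminf_le_const summable_weighted_gap)
qed

lemma control_optimal: "optimal_control T y0 yT control"
  unfolding optimal_control_def
proof (intro conjI ballI impI control_norm(1) control_steers)
  fix w assume w: "w \<in> L2_space (Q_measure T)" "steers T y0 yT w"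
  show "cost T control \<le> cost T w"
    using moments_norm_bound[OF w(1) steering_moment[OF w]] by (simp add: cost_def)
qed

text \<open>The midpoint of two steering controls has the same moments, so strict convexity of the norm
  gives uniqueness.\<close>

lemma optimal_control_unique:
  assumes "optimal_control T y0 yT w"
  shows "AE p in Q_measure T. w p = control p"
proof -
  define Q where "Q = Q_measure T"
  have w: "w \<in> L2_space Q" "steers T y0 yT w" "cost T w \<le> cost T control"
    using assms control_norm(1) control_steers by (auto simp: optimal_control_def Q_def)
  note c = control_norm(1)[folded Q_def]
  define h where "h p = 1/2 * w p + 1/2 * control p" for p
  have h: "h \<in> L2_space Q" unfolding h_def[abs_def] by (rule L2_combination[OF w(1) c])
  have "(\<integral>p. h p * adjoint_mode T k p \<partial>Q) = gap k" for k
  proof -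
    note i = L2_integrable_mult[OF w(1) adjoint_mode_L2[of T k, folded Q_def]]
      L2_integrable_mult[OF c adjoint_mode_L2[of T k, folded Q_def]]
    have "(\<integral>p. h p * adjoint_mode T k p \<partial>Q)
      = (\<integral>p. 1/2 * (w p * adjoint_mode T k p) + 1/2 * (control p * adjoint_mode T k p) \<partial>Q)"
      by (simp add: h_def algebra_simps)
    also have "\<dots> = gap k"
      using i steering_moment[OF w(1,2)[unfolded Q_def], of k]
        steering_moment[OF control_norm(1) control_steers, of k]
      by (simp add: Q_def)
    finally show ?thesis .
  qed
  then have "(L2_norm Q control)\<^sup>2 \<le> (L2_norm Q h)\<^sup>2"
    using moments_norm_bound[of h] h by (simp add: Q_def)
  moreover have "4 * (L2_norm Q h)\<^sup>2 = (L2_norm Q (\<lambda>p. w p + 1 * control p))\<^sup>2"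
  proof -
    have "h = (\<lambda>p. 1/2 * (w p + 1 * control p))" by (simp add: h_def fun_eq_iff)
    then have "L2_norm Q h = 1/2 * L2_norm Q (\<lambda>p. w p + 1 * control p)"
      using L2_norm_cmult[of Q "1/2" "\<lambda>p. w p + 1 * control p"] by simp
    then have "L2_norm Q (\<lambda>p. w p + 1 * control p) = 2 * L2_norm Q h" by simp
    then show ?thesis by (simp only: power_mult_distrib) simp
  qed
  moreover have "(L2_norm Q w)\<^sup>2 \<le> (L2_norm Q control)\<^sup>2"
    using w(3) by (simp add: cost_def Q_def)
  moreover have "(L2_norm Q (\<lambda>p. w p + 1 * control p))\<^sup>2 + (L2_norm Q (\<lambda>p. w p - control p))\<^sup>2
      = 2 * (L2_norm Q w)\<^sup>2 + 2 * (L2_norm Q control)\<^sup>2"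
    using L2_norm_sq_expand[OF w(1) c, of 1] L2_norm_sq_expand[OF w(1) c, of "-1"] by simp
  ultimately have "(L2_norm Q (\<lambda>p. w p - control p))\<^sup>2 \<le> 0" by linarith
  then have "L2_norm Q (\<lambda>p. w p - control p) = 0" by simp
  then have "AE p in Q. w p - control p = 0"
    by (rule L2_norm_eq_0_AE[OF L2_diff[OF w(1) c]])
  then have "AE p in Q. w p = control p" by simp
  then show ?thesis unfolding Q_def .
qed

end

theorem theorem3p2:
  fixes T :: real and y0 yT :: "real \<Rightarrow> real"
  assumes "T > 0"
    and "y0 \<in> L2_space space_measure"
    and "yT \<in> admissible_targets T y0"
  shows "\<exists>u. optimal_control T y0 yT u \<and>
    (\<forall>w. optimal_control T y0 yT w \<longrightarrow> (AE p in Q_measure T. w p = u p))"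
proof -
  interpret steering T y0 yT by standard (fact assms)+
  show ?thesis using control_optimal optimal_control_unique by blast
qed


end
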